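(* Let $U$ be a connected unicyclic graph with unique cycle $C_k$ and diametrical path $P_n=v_1v_2\cdots v_n$, with $n$ even, $n\ge6$. Then $\operatorname{mr}^-(U)=\operatorname{mr}^-(P_n)$ if and only if all of the following hold: (1) every vertex $w\in V_{C_k}\setminus V_{P_n}$ has the property that either $U-w$ is a centipede with diametrical path $P_n$ such that no pair of joints $v_r,v_s$ satisfies $r$ odd, $s$ even and $3\le r<s\le n-2$, or $U-w$ is a centipede with diametrical path $P'$ whose vertex set is $V_{P_n}\cup\{z\}$, where $z$ is another vertex of $V_{C_k}\setminus V_{P_n}$ adjacent to either $v_1$ or $v_n$, such that all joints of $P'$ are odd-indexed vertices of $P_n$ whenever $z$ is adjacent to $v_1$, and all joints of $P'$ are even-indexed vertices of $P_n$ whenever $z$ is adjacent to $v_n$; (2) $k\in\{3,4,6\}$; (3) if $k=3$, then $V_{C_3}\cap V_{P_n}=\{v_j,v_{j+1}\}$ with $1\le j\le n-1$, and: if $j=1$ then $\deg_U(v_1)=2$ and $\deg_U(v_2)=3$; if $j=n-1$ then $\deg_U(v_n)=2$ and $\deg_U(v_{n-1})=3$; if $j$ is odd with $3\le j\le n-3$ then $\deg_U(v_j)=\deg_U(v_{j+1})=3$; $\deg_U(v_i)=2$ for all odd $i$ with $1<i<j$ and for all even $i$ with $j+1<i<n$; (4) if $k=4$ and $V_{C_4}\cap V_{P_n}=\{v_j,v_{j+1},v_{j+2}\}$, then: (a) $1\le j\le n-2$; (b) $\deg_U(v_{j+1})=2$; (c) if $j=1$ then $\deg_U(v_1)=2$;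 (d) if $j=n-2$ then $\deg_U(v_n)=2$; (e) if $j=1$ and $\deg_U(v_3)>3$, then $\deg_U(v_i)=2$ for all even $i$ with $3<i<n$; (f) if $j=n-2$ and $\deg_U(v_{n-2})>3$, then $\deg_U(v_i)=2$ for all odd $i$ with $1<i<n-2$; (g) if $j$ is odd, $3\le j\le n-3$, and $\deg_U(v_j)>3$ or $\deg_U(v_{j+2})>3$, then $\deg_U(v_i)=2$ for all even $i$ with $j+2<i<n$; (h) if $j$ is even, $2\le j\le n-4$, and $\deg_U(v_j)>3$ or $\deg_U(v_{j+2})>3$, then $\deg_U(v_i)=2$ for all odd $i$ with $1<i<j$; (i) if for some odd $r$ with $r\ne j$, $r\ne j+2$, $3\le r\le n-3$, $\deg_U(v_r)>2$, then $\deg_U(v_i)=2$ for all even $i$ with $r<i<n$, $i\ne j$, $i\ne j+2$; (j) if for some even $r$ with $r\ne j$, $r\ne j+2$, $4\le r\le n-2$, $\deg_U(v_r)>2$, then $\deg_U(v_i)=2$ for all odd $i$ with $1<i<r$, $i\ne j$, $i\ne j+2$; (5) if $k=4$ and $V_{C_4}\cap V_{P_n}=\{v_j,v_{j+1}\}$, then $j$ is odd with $3\le j\le n-3$, $\deg_U(v_j)=\deg_U(v_{j+1})=3$, and $\deg_U(v_i)=2$ for all odd $i$ with $1<i<j$ and for all even $i$ with $j+1<i<n$; (6) if $k=6$, then $V_{C_6}\cap V_{P_n}=\{v_j,v_{j+1},v_{j+2},v_{j+3}\}$ where: $j$ is odd with $1\le j\le n-3$; $\deg_U(v_{j+1})=\deg_U(v_{j+2})=2$;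 if $j=1$ then $\deg_U(v_1)=2$ and $\deg_U(v_4)=3$; if $j=n-3$ then $\deg_U(v_n)=2$ and $\deg_U(v_{n-3})=3$; if $j$ is odd with $3\le j\le n-5$ then $\deg_U(v_j)=\deg_U(v_{j+3})=3$; $\deg_U(v_i)=2$ for all odd $i$ with $1<i<j$ and for all even $i$ with $j+1<i<n$.
   Context: All graphs are finite, simple and undirected; a unicyclic graph is a graph containing exactly one cycle; $C_k$ is the cycle on $k$ vertices; $V_H$ denotes the vertex set of a graph $H$; $\deg_U(v)$ is the degree of $v$ in $U$; the vertices of the path $P_n$ on $n$ vertices are labelled $v_1,\dots,v_n$ in order along the path. For a graph $G$ with vertices $u_1,\dots,u_m$, let $\mathcal{S}^-(G)$ be the set of real skew-symmetric $m\times m$ matrices $A$ such that for $p\neq q$, $a_{pq}\neq 0$ if and only if $\{u_p,u_q\}$ is an edge of $G$, and $\operatorname{mr}^-(G)=\min\{\operatorname{rank}A : A\in\mathcal{S}^-(G)\}$. A diametrical path of a connected graph $G$ is an induced path in $G$ whose length (number of edges) equals the diameter of $G$. A centipede is a tree consisting of a path $P$ together with additional edges (legs) each joining a nonpendant vertex of $P$ to a new pendant vertex; the vertices of $P$ with legs are called joints.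
   Formalization: A diametrical path is also required to have its ends at distance equal to the diameter, and in (6) the last clause (degree 2 for even i with j+1<i<n) exempts i=j+3; as written, C_6 with a path of two edges attached at one vertex is a counterexample to both. *)

theory Defs
  imports "Graph_Theory.Graph_Theory" "Jordan_Normal_Form.DL_Rank"
begin

text \<open>A finite simple undirected graph is a \<open>pair_graph\<close>, i.e. a finite loop-free symmetric
  digraph without parallel arcs: the edge \<open>{x, y}\<close> is the pair of arcs \<open>(x, y)\<close>, \<open>(y, x)\<close>.
  Hence the degree of a vertex is its out-degree. Paths and cycles are given by lists of vertices.
  The library's \<open>cycle\<close>, \<open>forest\<close> and \<open>tree\<close> count \<open>x, y, x\<close> as a cycle and are not the undirected
  notions, so cycles are introduced here as subgraphs.\<close>

abbreviation deg :: "('a, 'a \<times> 'a) pre_digraph \<Rightarrow> 'a \<Rightarrow> nat" where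
  "deg G x \<equiv> out_degree G x"

definition path_graph :: "'a list \<Rightarrow> 'a pair_pre_digraph" where
  "path_graph ps =
     \<lparr> pverts = set ps, parcs = set (vwalk_arcs ps) \<union> (set (vwalk_arcs ps))\<inverse> \<rparr>"

definition cycle_graph :: "'a list \<Rightarrow> 'a pair_pre_digraph" where
  "cycle_graph cs =
     \<lparr> pverts = set cs,
       parcs = set (vwalk_arcs (cs @ [hd cs])) \<union> (set (vwalk_arcs (cs @ [hd cs])))\<inverse> \<rparr>"

definition is_cycle :: "nat \<Rightarrow> 'a pair_pre_digraph \<Rightarrow> bool" where
  "is_cycle k C \<longleftrightarrow> k \<ge> 3 \<and> (\<exists>cs. distinct cs \<and> length cs = k \<and> C = cycle_graph cs)"

definition unicyclic :: "'a pair_pre_digraph \<Rightarrow> bool" where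
  "unicyclic G \<longleftrightarrow> (\<exists>!C. (\<exists>k. is_cycle k C) \<and> subgraph C G)"

definition gdist :: "('a, 'a \<times> 'a) pre_digraph \<Rightarrow> 'a \<Rightarrow> 'a \<Rightarrow> ereal" where
  "gdist G x y = wf_digraph.\<mu> G (\<lambda>e. 1) x y"

definition diameter :: "('a, 'a \<times> 'a) pre_digraph \<Rightarrow> ereal" where
  "diameter G = (SUP (x, y) \<in> verts G \<times> verts G. gdist G x y)"

text \<open>A diametrical path realizes the diameter: it is an induced path whose length is the diameter
  and also the distance between its two end vertices. The last condition matters only in graphs
  with a cycle: an induced path with as many edges as the diameter may run the long way round the
  cycle and then join two vertices at smaller distance.\<close>

definition diametrical_path :: "('a, 'a \<times> 'a) pre_digraph \<Rightarrow> 'a list \<Rightarrow> bool" where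
  "diametrical_path G ps \<longleftrightarrow>
     ps \<noteq> [] \<and> distinct ps \<and> induced_subgraph (path_graph ps) G \<and>
     ereal (real (vwalk_length ps)) = diameter G \<and>
     gdist G (hd ps) (last ps) = diameter G"

text \<open>\<open>L\<close> is the set of new pendant vertices, and the leg at \<open>x \<in> L\<close> joins \<open>x\<close> to \<open>f x\<close>. A path
  without legs counts as a centipede, and a joint may carry several legs.\<close>

definition centipede :: "('a, 'a \<times> 'a) pre_digraph \<Rightarrow> 'a list \<Rightarrow> bool" where
  "centipede T ps \<longleftrightarrow>
     ps \<noteq> [] \<and> distinct ps \<and>
     (\<exists>L f. finite L \<and> L \<inter> set ps = {} \<and>
        (\<forall>x\<in>L. f x \<in> set ps \<and> deg (path_graph ps) (f x) \<noteq> 1) \<and>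
        T = with_proj
              \<lparr> pverts = set ps \<union> L,
                parcs = parcs (path_graph ps) \<union> (\<lambda>x. (x, f x)) ` L \<union> (\<lambda>x. (f x, x)) ` L \<rparr>)"

definition joints :: "('a, 'a \<times> 'a) pre_digraph \<Rightarrow> 'a list \<Rightarrow> 'a set" where
  "joints T ps = {y \<in> set ps. \<exists>x \<in> verts T - set ps. (y, x) \<in> arcs T}"

text \<open>The list \<open>us\<close> is the enumeration \<open>u\<^sub>1, \<dots>, u\<^sub>m\<close> of the vertices, shifted to start at \<open>0\<close>.
  The attainable ranks do not depend on it, so the minimum is taken over all enumerations.\<close>

definition S_minus :: "'a pair_pre_digraph \<Rightarrow> 'a list \<Rightarrow> real mat set" where
  "S_minus G us =
     {A \<in> carrier_mat (length us) (length us).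
        transpose_mat A = - A \<and>
        (\<forall>p<length us. \<forall>q<length us. p \<noteq> q \<longrightarrow>
           (A $$ (p, q) \<noteq> 0 \<longleftrightarrow> (us ! p, us ! q) \<in> parcs G))}"

definition mr_minus :: "'a pair_pre_digraph \<Rightarrow> nat" where
  "mr_minus G =
     (LEAST r. \<exists>us A. distinct us \<and> set us = pverts G \<and> A \<in> S_minus G us \<and>
        r = vec_space.rank (length us) A)"

end

theory Submission
  imports Defs
begin

text \<open>The path on \<open>n\<close> vertices is an induced subgraph of \<open>U\<close> whose skew matrices are invertible, so a
  skew matrix of \<open>U\<close> has rank \<open>n\<close> if and only if the Schur complement of its path block vanishes.
  The inverse of the path block is supported on the pairs \<open>(p, q)\<close> with \<open>p\<close> odd, \<open>q\<close> even and
  \<open>p < q\<close> (up to symmetry). Therefore rank \<open>n\<close> forces every vertex to lie on or next to the path, and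
  two vertices hanging at \<open>p\<close> and \<open>q\<close> are adjacent if and only if \<open>p\<close> and \<open>q\<close> are such a pair. As
  \<open>U\<close> has one cycle and the path is a geodesic, either a single vertex off the path sees two path
  vertices at distance at most \<open>2\<close>, or a single pair of adjacent vertices off the path hangs at path
  vertices at distance at most \<open>3\<close>. In each of these two shapes both the rank condition and the
  degree and centipede conditions reduce to the same parity condition on the leg positions. The
  conditions on vertex deletions already force every vertex to lie on or next to the path.\<close>

section \<open>Rank and spanning columns\<close>

text \<open>Necessity has to hold for arbitrary nonzero weights, so it may use only which entries of
  the inverse path block vanish. An entry of the Schur complement is then decided when its sum has
  no nonzero term or exactly one; with two terms the weights decide. Two terms arise only for a
  vertex that sees two path positions at distance 2, hence of equal parity. This is why the 4-cycle
  with one vertex off the path tolerates legs linked to its cycle positions, which every other shape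
  forbids. Sufficiency needs a single good weighting: all weights are 1 up to orientation, with one
  sign change that lets those two terms cancel. Vertices hanging at one common position, or at
  positions of distance 2, are never linked. This rules out the triangle with one path vertex and
  the cycle of length 5. The diameter forbids legs at the ends of the path, but a 6-cycle may still
  begin or stop there. Deleting one of its two outer vertices then leaves the other hanging at an
  end, and this is where the second alternative of clause (1) arises.\<close>

context vec_space
begin

text \<open>Coefficients are indexed by column positions, whereas \<open>lin_indpt\<close> speaks of
  a set of vectors. Equal columns must therefore be ruled out first: two of them would satisfy a
  relation with coefficients 1 and -1.\<close>

lemma independent_columns:
  assumes A: "A \<in> carrier_mat n nc" and J: "J \<subseteq> {..<nc}"
    and ind: "\<And>c. (\<And>p. p < n \<Longrightarrow> (\<Sum>j\<in>J. c j * A $$ (p, j)) = 0) \<Longrightarrow> \<forall>j\<in>J. c j = 0"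
  shows "inj_on (col A) J" and "lin_indpt (col A ` J)"
proof -
  have fin: "finite J" using J finite_subset by blast
  show inj: "inj_on (col A) J"
  proof (rule inj_onI, rule ccontr)
    fix i j assume ij: "i \<in> J" "j \<in> J" "col A i = col A j" "i \<noteq> j"
    let ?c = "\<lambda>l. if l = i then 1 else if l = j then - 1 else 0 :: 'a"
    have "(\<Sum>l\<in>J. ?c l * A $$ (p, l)) = 0" if p: "p < n" for p
    proof -
      have eq: "A $$ (p, i) = A $$ (p, j)"
        using ij J A p by (metis carrier_matD index_col lessThan_iff subsetD)
      have "(\<Sum>l\<in>J. ?c l * A $$ (p, l)) = (\<Sum>l\<in>{i, j}. ?c l * A $$ (p, l))"
        using \<open>i \<in> J\<close> \<open>j \<in> J\<close> fin by (intro sum.mono_neutral_right) auto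
      also have "\<dots> = A $$ (p, i) - A $$ (p, j)" using \<open>i \<noteq> j\<close> by simp
      also have "\<dots> = 0" unfolding eq by (rule diff_self)
      finally show ?thesis .
    qed
    from ind[OF this] \<open>i \<in> J\<close> show False by auto
  qed
  have sub: "col A ` J \<subseteq> carrier_vec n" using A by auto
  have "\<forall>v\<in>col A ` J. a v = 0" if z: "lincomb a (col A ` J) = 0\<^sub>v n" for a
  proof -
    have "(\<Sum>j\<in>J. a (col A j) * A $$ (p, j)) = 0" if p: "p < n" for p
    proof -
      have "0 = lincomb a (col A ` J) $ p" using z p by simp
      also have "\<dots> = (\<Sum>x\<in>col A ` J. a x * x $ p)" by (rule lincomb_index[OF p sub])
      also have "\<dots> = (\<Sum>j\<in>J. a (col A j) * col A j $ p)" by (simp add: sum.reindex[OF inj])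
      also have "\<dots> = (\<Sum>j\<in>J. a (col A j) * A $$ (p, j))"
        using J A p by (intro sum.cong) auto
      finally show ?thesis by simp
    qed
    from ind[OF this] show ?thesis by simp
  qed
  then show "lin_indpt (col A ` J)" using fin sub by (intro finite_lin_indpt2) auto
qed

lemma rank_ge_independent_columns:
  assumes "A \<in> carrier_mat n nc" and "J \<subseteq> {..<nc}"
    and "\<And>c. (\<And>p. p < n \<Longrightarrow> (\<Sum>j\<in>J. c j * A $$ (p, j)) = 0) \<Longrightarrow> \<forall>j\<in>J. c j = 0"
  shows "card J \<le> rank A"
proof -
  note ind = independent_columns[OF assms(1,2), OF assms(3)]
  have "col A ` J \<subseteq> set (cols A)" using assms by (auto simp: cols_def)
  from rank_ge_card_indpt[OF assms(1) this ind(2)] show ?thesis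
    by (simp add: card_image[OF ind(1)])
qed

text \<open>A column outside the span could be added to the chosen ones, giving an independent set
  larger than the rank.\<close>

lemma column_combination:
  assumes A: "A \<in> carrier_mat n nc" and J: "J \<subseteq> {..<nc}"
    and "\<And>c. (\<And>p. p < n \<Longrightarrow> (\<Sum>j\<in>J. c j * A $$ (p, j)) = 0) \<Longrightarrow> \<forall>j\<in>J. c j = 0"
    and rk: "rank A = card J" and q: "q < nc"
  shows "\<exists>c. \<forall>p<n. A $$ (p, q) = (\<Sum>j\<in>J. c j * A $$ (p, j))"
proof -
  have fin: "finite J" using J finite_subset by blast
  note ind = independent_columns[OF A J, OF assms(3)]
  have sub: "col A ` J \<subseteq> carrier_vec n" using A by auto
  have cq: "col A q \<in> carrier_vec n" using A by auto
  have "col A q \<in> span (col A ` J)"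
  proof (cases "col A q \<in> col A ` J")
    case True then show ?thesis using in_own_span sub by auto
  next
    case False
    show ?thesis
    proof (rule ccontr)
      assume "col A q \<notin> span (col A ` J)"
      with lin_dep_iff_in_span[of "col A ` J" "col A q"] sub ind(2) cq False
      have "lin_indpt (col A ` J \<union> {col A q})" by simp
      moreover have "col A ` J \<union> {col A q} \<subseteq> set (cols A)"
        using A J q by (auto simp: cols_def)
      ultimately have "card (col A ` J \<union> {col A q}) \<le> rank A"
        using rank_ge_card_indpt A by blast
      moreover have "card (col A ` J \<union> {col A q}) = Suc (card J)"
        using False fin by (simp add: card_image[OF ind(1)])
      ultimately show False using rk by simp
    qed
  qed
  then obtain a where a: "lincomb a (col A ` J) = col A q"
    using finite_in_span[of "col A ` J" "col A q"] fin sub by auto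
  have "A $$ (p, q) = (\<Sum>j\<in>J. a (col A j) * A $$ (p, j))" if p: "p < n" for p
  proof -
    have "A $$ (p, q) = lincomb a (col A ` J) $ p" using a p A q by simp
    also have "\<dots> = (\<Sum>x\<in>col A ` J. a x * x $ p)" by (rule lincomb_index[OF p sub])
    also have "\<dots> = (\<Sum>j\<in>J. a (col A j) * col A j $ p)" by (simp add: sum.reindex[OF ind(1)])
    also have "\<dots> = (\<Sum>j\<in>J. a (col A j) * A $$ (p, j))"
      using J A p by (intro sum.cong) auto
    finally show ?thesis .
  qed
  then show ?thesis by (intro exI[of _ "\<lambda>j. a (col A j)"]) blast
qed

text \<open>Steinitz exchange: a maximal independent set of columns has the rank as its size and
  lies in the span of the columns indexed by \<open>J\<close>.\<close>

lemma rank_le_spanning_columns: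
  assumes A: "A \<in> carrier_mat n nc" and J: "J \<subseteq> {..<nc}"
    and comb: "\<And>q. q < nc \<Longrightarrow> \<exists>c. \<forall>p<n. A $$ (p, q) = (\<Sum>j\<in>J. c j * A $$ (p, j))"
  shows "rank A \<le> card J"
proof -
  have fin: "finite J" using J finite_subset by blast
  have sub: "col A ` J \<subseteq> carrier_vec n" using A by auto
  have span: "set (cols A) \<subseteq> span (col A ` J)"
  proof
    fix x assume "x \<in> set (cols A)"
    then obtain q where q: "q < nc" "x = col A q" using A by (auto simp: cols_def)
    from comb[OF q(1)] obtain c where c: "\<And>p. p < n \<Longrightarrow> A $$ (p, q) = (\<Sum>j\<in>J. c j * A $$ (p, j))"
      by blast
    \<comment> \<open>Columns indexed by \<open>J\<close> may coincide, so their coefficients are collected.\<close>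
    define a where "a y = (\<Sum>j\<in>{j\<in>J. col A j = y}. c j)" for y
    have "x = lincomb a (col A ` J)"
    proof (rule eq_vecI)
      show "dim_vec x = dim_vec (lincomb a (col A ` J))"
        using q A fin sub by (simp add: lincomb_dim)
    next
      fix p assume "p < dim_vec (lincomb a (col A ` J))"
      then have p: "p < n" using fin sub by (simp add: lincomb_dim)
      have "x $ p = (\<Sum>j\<in>J. c j * A $$ (p, j))" using q A p c by simp
      also have "\<dots> = (\<Sum>j\<in>J. c j * col A j $ p)" using J A p by (intro sum.cong) auto
      also have "\<dots> = (\<Sum>y\<in>col A ` J. \<Sum>j\<in>{j\<in>J. col A j = y}. c j * col A j $ p)"
        by (rule sum.image_gen[OF fin])
      also have "\<dots> = (\<Sum>y\<in>col A ` J. a y * y $ p)"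
        unfolding a_def by (intro sum.cong refl) (simp add: sum_distrib_right)
      also have "\<dots> = lincomb a (col A ` J) $ p" by (rule lincomb_index[OF p sub, symmetric])
      finally show "x $ p = lincomb a (col A ` J) $ p" .
    qed
    then show "x \<in> span (col A ` J)" using fin by (intro in_spanI[of _ a "col A ` J"]) auto
  qed
  obtain S where S: "maximal S (\<lambda>T. T \<subseteq> set (cols A) \<and> lin_indpt T)"
    using maximal_exists[of "(\<lambda>T. T \<subseteq> set (cols A) \<and> lin_indpt T)" "card (set (cols A))" "{}"]
    by (meson List.finite_set card_mono empty_iff empty_subsetI finite_lin_indpt2 rev_finite_subset)
  then have S': "S \<subseteq> set (cols A)" "lin_indpt S" by (auto simp: maximal_def)
  then have "finite S" using finite_subset by blast
  \<comment> \<open>Of the complementary set only the existence matters: its cardinality is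
    nonnegative, which gives the inequality.\<close>
  from replacement[OF this _ _ S'(2), of "col A ` J"] fin sub subset_trans[OF S'(1) span]
  have "\<exists>C :: 'a vec set. int (card C) \<le> int (card (col A ` J)) - int (card S)"
    by auto
  then have "card S \<le> card (col A ` J)" by (elim exE) linarith
  also have "\<dots> \<le> card J" by (rule card_image_le[OF fin])
  finally show ?thesis using rank_card_indpt[OF A S] by simp
qed

end

section \<open>Skew matrices of a graph with an induced path of even order\<close>

text \<open>A skew matrix indexed by vertices, free of any enumeration. The case
  \<open>x = y\<close> is consistent: skewness makes the diagonal vanish, and a
  \<open>pair_graph\<close> has no loops.\<close>

definition skew_weight :: "'a pair_pre_digraph \<Rightarrow> ('a \<Rightarrow> 'a \<Rightarrow> real) \<Rightarrow> bool" where
  "skew_weight G a \<longleftrightarrow>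
     (\<forall>x\<in>pverts G. \<forall>y\<in>pverts G. a y x = - a x y \<and> (a x y \<noteq> 0 \<longleftrightarrow> (x, y) \<in> parcs G))"

lemma skew_weight_uminus:
  "skew_weight G a \<Longrightarrow> x \<in> pverts G \<Longrightarrow> y \<in> pverts G \<Longrightarrow> a y x = - a x y"
  unfolding skew_weight_def by meson

lemma skew_weight_iff:
  "skew_weight G a \<Longrightarrow> x \<in> pverts G \<Longrightarrow> y \<in> pverts G \<Longrightarrow> a x y \<noteq> 0 \<longleftrightarrow> (x, y) \<in> parcs G"
  unfolding skew_weight_def by meson

text \<open>The support of the inverse of a skew tridiagonal matrix of even order, with positions
  counted from 1. As \<open>linked l 0\<close> never holds, position 0 can stand for a zero
  right-hand side.\<close>

definition linked :: "nat \<Rightarrow> nat \<Rightarrow> bool" where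
  "linked p q \<longleftrightarrow> odd p \<and> even q \<and> p < q \<or> even p \<and> odd q \<and> q < p"

lemma linked_commute: "linked p q \<longleftrightarrow> linked q p"
  by (auto simp: linked_def)

text \<open>Even positions are determined from the first row downwards, odd positions from the last row
  upwards.\<close>

lemma tridiagonal_support:
  fixes c r s t :: "nat \<Rightarrow> real"
  assumes "even n" and "p \<le> n" and "c 0 = 0" and "c (n + 1) = 0"
    and row: "\<And>m. 1 \<le> m \<Longrightarrow> m \<le> n \<Longrightarrow> r m = c (m - 1) * s m + c (m + 1) * t m"
    and st: "\<And>m. 1 \<le> m \<Longrightarrow> m \<le> n \<Longrightarrow> s m \<noteq> 0 \<and> t m \<noteq> 0"
    and r: "\<And>m. 1 \<le> m \<Longrightarrow> m \<le> n \<Longrightarrow> r m \<noteq> 0 \<longleftrightarrow> m = p"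
    and l: "1 \<le> l" "l \<le> n"
  shows "c l \<noteq> 0 \<longleftrightarrow> linked l p"
proof -
  \<comment> \<open>Row \<open>2 * k + 1\<close> ties \<open>c (2 * k)\<close> to
    \<open>c (2 * k + 2)\<close> by nonzero factors, so vanishing is handed on until row
    \<open>p\<close>; there the nonzero right-hand side switches all later even positions
    on.\<close>
  have ev: "2 * k \<le> n \<Longrightarrow> c (2 * k) \<noteq> 0 \<longleftrightarrow> odd p \<and> p < 2 * k" for k
  proof (induction k)
    case 0 then show ?case using assms by simp
  next
    case (Suc k)
    let ?m = "2 * k + 1"
    have m: "1 \<le> ?m" "?m \<le> n" using Suc.prems by auto
    have IH: "c (2 * k) \<noteq> 0 \<longleftrightarrow> odd p \<and> p < 2 * k" using Suc by simp
    have row': "r ?m = c (2 * k) * s ?m + c (2 * k + 2) * t ?m" using row[OF m] by simp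
    show ?case
    proof (cases "p = ?m")
      case True
      then have "c (2 * k + 2) \<noteq> 0" using IH row' r[OF m] st[OF m] by auto
      then show ?thesis using True by simp
    next
      case False
      then have "c (2 * k) * s ?m + c (2 * k + 2) * t ?m = 0" using row' r[OF m] by auto
      then have "c (2 * k) \<noteq> 0 \<longleftrightarrow> c (2 * k + 2) \<noteq> 0" using st[OF m] by auto
      moreover have "odd p \<and> p < 2 * k \<longleftrightarrow> odd p \<and> p < 2 * k + 2"
        using False by (auto elim!: oddE)
      ultimately show ?thesis using IH by simp
    qed
  qed
  obtain h where h: "n = 2 * h" using \<open>even n\<close> by blast
  \<comment> \<open>Since \<open>n\<close> is even, \<open>n + 1\<close> is odd, and the boundary
    value 0 there starts a downward induction over the odd positions through the even rows.\<close>
  have od: "k \<le> h \<Longrightarrow> c (n + 1 - 2 * k) \<noteq> 0 \<longleftrightarrow> even p \<and> n + 1 - 2 * k < p" for k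
  proof (induction k)
    case 0 then show ?case using assms by simp
  next
    case (Suc k)
    let ?m = "n - 2 * k"
    have m: "1 \<le> ?m" "?m \<le> n" using Suc.prems h by auto
    have IH: "c (?m + 1) \<noteq> 0 \<longleftrightarrow> even p \<and> ?m + 1 < p"
      using Suc h by (simp add: Suc_diff_le)
    have eq: "n + 1 - 2 * Suc k = ?m - 1" by simp
    show ?case
    proof (cases "p = ?m")
      case True
      then have "c (?m - 1) \<noteq> 0" using IH row[OF m] r[OF m] st[OF m] by auto
      then show ?thesis unfolding eq using True h m by simp
    next
      case False
      then have "c (?m - 1) * s ?m + c (?m + 1) * t ?m = 0" using row[OF m] r[OF m] by auto
      then have "c (?m - 1) \<noteq> 0 \<longleftrightarrow> c (?m + 1) \<noteq> 0" using st[OF m] by auto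
      moreover have "even p \<and> ?m - 1 < p \<longleftrightarrow> even p \<and> ?m + 1 < p"
        using False h m by presburger
      ultimately show ?thesis unfolding eq using IH by simp
    qed
  qed
  show ?thesis
  proof (cases "even l")
    case True
    then have "2 * (l div 2) = l" by simp
    then show ?thesis using ev[of "l div 2"] l True by (auto simp: linked_def)
  next
    case False
    then obtain k where k: "l = 2 * k + 1" by (elim oddE)
    then have "n + 1 - 2 * (h - k) = l" using l h by simp
    then show ?thesis using od[of "h - k"] l False by (auto simp: linked_def)
  qed
qed

lemma S_minusI:
  assumes "\<And>p q. p < length us \<Longrightarrow> q < length us \<Longrightarrow> f q p = - f p q"
    and "\<And>p q. p < length us \<Longrightarrow> q < length us \<Longrightarrow> p \<noteq> q \<Longrightarrow>
      f p q \<noteq> 0 \<longleftrightarrow> (us ! p, us ! q) \<in> parcs G"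
  shows "mat (length us) (length us) (\<lambda>(p, q). f p q) \<in> S_minus G us"
proof -
  have "transpose_mat (mat (length us) (length us) (\<lambda>(p, q). f p q)) =
      - mat (length us) (length us) (\<lambda>(p, q). f p q)"
  proof (rule eq_matI)
    fix i j assume "i < dim_row (- mat (length us) (length us) (\<lambda>(p, q). f p q))"
      "j < dim_col (- mat (length us) (length us) (\<lambda>(p, q). f p q))"
    then show "transpose_mat (mat (length us) (length us) (\<lambda>(p, q). f p q)) $$ (i, j) =
        (- mat (length us) (length us) (\<lambda>(p, q). f p q)) $$ (i, j)"
      using assms(1)[of i j] by simp
  qed auto
  then show ?thesis using assms(2) by (simp add: S_minus_def)
qed

locale even_path = pair_graph G for G :: "'a pair_pre_digraph" +
  fixes v :: "nat \<Rightarrow> 'a" and n :: nat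
  assumes even_n: "even n"
    and v_inj: "inj_on v {1..n}"
    and v_verts: "i \<in> {1..n} \<Longrightarrow> v i \<in> pverts G"
    and v_arcs: "i \<in> {1..n} \<Longrightarrow> j \<in> {1..n} \<Longrightarrow> (v i, v j) \<in> parcs G \<longleftrightarrow> j = i + 1 \<or> i = j + 1"
begin

lemma v_eq_iff: "i \<in> {1..n} \<Longrightarrow> j \<in> {1..n} \<Longrightarrow> v i = v j \<longleftrightarrow> i = j"
  using v_inj by (rule inj_on_eq_iff)

lemma path_row_sum:
  assumes a: "skew_weight G a" and m: "m \<in> {1..n}"
  shows "(\<Sum>i\<in>{1..n}. c i * a (v m) (v i)) =
    (if 1 < m then c (m - 1) * a (v m) (v (m - 1)) else 0) +
    (if m < n then c (m + 1) * a (v m) (v (m + 1)) else 0)"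
proof -
  let ?f = "\<lambda>i. c i * a (v m) (v i)"
  have zero: "?f i = 0" if "i \<in> {1..n}" "i \<noteq> m + 1" "m \<noteq> i + 1" for i
    using skew_weight_iff[OF a v_verts v_verts, of m i] m that v_arcs[of m i] by auto
  have "sum ?f {1..n} = sum ?f ({m - 1, m + 1} \<inter> {1..n})"
    using zero by (intro sum.mono_neutral_right) fastforce+
  also have "{m - 1, m + 1} \<inter> {1..n} =
      (if 1 < m then {m - 1} else {}) \<union> (if m < n then {m + 1} else {})"
    using m by auto
  also have "sum ?f \<dots> = (if 1 < m then ?f (m - 1) else 0) + (if m < n then ?f (m + 1) else 0)"
    by (subst sum.union_disjoint) auto
  finally show ?thesis .
qed

lemma path_solution_support:
  assumes a: "skew_weight G a" and "p \<le> n"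
    and r: "\<And>m. m \<in> {1..n} \<Longrightarrow> (\<Sum>i\<in>{1..n}. c i * a (v m) (v i)) \<noteq> 0 \<longleftrightarrow> m = p"
    and l: "l \<in> {1..n}"
  shows "c l \<noteq> 0 \<longleftrightarrow> linked l p"
proof -
  have ne: "a (v i) (v j) \<noteq> 0" if "i \<in> {1..n}" "j \<in> {1..n}" "j = i + 1 \<or> i = j + 1" for i j
    using skew_weight_iff[OF a v_verts v_verts, of i j] that v_arcs[of i j] by auto
  \<comment> \<open>Rows 1 and \<open>n\<close> lack one neighbour. Coefficients outside the path
    become 0, and the missing matrix entries become 1, because \<open>tridiagonal_support\<close>
    wants nonzero factors in every row; these are multiplied by 0.\<close>
  define c' where "c' i = (if i \<in> {1..n} then c i else 0)" for i
  define s where "s m = (if 1 < m then a (v m) (v (m - 1)) else 1)" for m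
  define t where "t m = (if m < n then a (v m) (v (m + 1)) else 1)" for m
  have "c' l \<noteq> 0 \<longleftrightarrow> linked l p"
  proof (rule tridiagonal_support[where s = s and t = t and n = n
        and r = "\<lambda>m. \<Sum>i\<in>{1..n}. c i * a (v m) (v i)"])
    fix m assume m: "1 \<le> m" "m \<le> n"
    show "(\<Sum>i\<in>{1..n}. c i * a (v m) (v i)) = c' (m - 1) * s m + c' (m + 1) * t m"
      using path_row_sum[OF a, of m c] m by (auto simp: c'_def s_def t_def)
    show "s m \<noteq> 0 \<and> t m \<noteq> 0"
    proof -
      have "1 < m \<Longrightarrow> a (v m) (v (m - 1)) \<noteq> 0" using m by (intro ne) auto
      moreover have "m < n \<Longrightarrow> a (v m) (v (m + 1)) \<noteq> 0" using m by (intro ne) auto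
      ultimately show ?thesis by (simp add: s_def t_def)
    qed
  qed (use even_n assms in \<open>auto simp: c'_def\<close>)
  then show ?thesis using l by (simp add: c'_def)
qed

text \<open>This is the homogeneous system, the case \<open>p = 0\<close>. The rows at path vertices
  already force every coefficient to vanish.\<close>

lemma path_columns_independent:
  assumes "skew_weight G a" and "\<And>x. x \<in> pverts G \<Longrightarrow> (\<Sum>i\<in>{1..n}. c i * a x (v i)) = 0"
    and "i \<in> {1..n}"
  shows "c i = 0"
proof -
  have "c i \<noteq> 0 \<longleftrightarrow> linked i 0"
  proof (rule path_solution_support[OF assms(1) _ _ assms(3)])
    fix m assume m: "m \<in> {1..n}"
    have "(\<Sum>i\<in>{1..n}. c i * a (v m) (v i)) = 0" by (rule assms(2)[OF v_verts[OF m]])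
    then show "(\<Sum>i\<in>{1..n}. c i * a (v m) (v i)) \<noteq> 0 \<longleftrightarrow> m = 0" using m by simp
  qed simp
  then show ?thesis by (simp add: linked_def)
qed

text \<open>Vanishing of the Schur complement, expressed through columns so that the path block need
  not be inverted.\<close>

definition path_spanned :: "('a \<Rightarrow> 'a \<Rightarrow> real) \<Rightarrow> bool" where
  "path_spanned a \<longleftrightarrow>
     (\<forall>y\<in>pverts G. \<exists>c. \<forall>x\<in>pverts G. a x y = (\<Sum>i\<in>{1..n}. c i * a x (v i)))"

text \<open>The path columns are independent, which gives the lower bound, and rank \<open>n\<close>
  means that they span. Undoing the enumeration turns the matrix into a function on vertices, and
  linear combinations transfer both ways.\<close>

lemma S_minus_rank:
  assumes us: "distinct us" "set us = pverts G" and A: "A \<in> S_minus G us"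
  shows "n \<le> vec_space.rank (length us) A"
    and "vec_space.rank (length us) A = n \<longleftrightarrow> (\<exists>a. skew_weight G a \<and> path_spanned a \<and>
      (\<forall>p<length us. \<forall>q<length us. A $$ (p, q) = a (us ! p) (us ! q)))"
proof -
  let ?m = "length us"
  have "\<forall>x\<in>pverts G. \<exists>p. p < ?m \<and> us ! p = x"
    using us(2) by (metis in_set_conv_nth)
  then obtain g where g: "\<And>x. x \<in> pverts G \<Longrightarrow> g x < ?m \<and> us ! g x = x"
    by (auto dest!: bchoice)
  have g': "g (us ! p) = p" if "p < ?m" for p
    using g[of "us ! p"] us that nth_eq_iff_index_eq[of us "g (us ! p)" p] nth_mem[OF that] by auto
  define a where "a x y = A $$ (g x, g y)" for x y
  have Aa: "A $$ (p, q) = a (us ! p) (us ! q)" if "p < ?m" "q < ?m" for p q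
    using that g' by (simp add: a_def)
  have Ac: "A \<in> carrier_mat ?m ?m" and At: "transpose_mat A = - A"
    and As: "\<And>p q. p < ?m \<Longrightarrow> q < ?m \<Longrightarrow> p \<noteq> q \<Longrightarrow> A $$ (p, q) \<noteq> 0 \<longleftrightarrow> (us ! p, us ! q) \<in> parcs G"
    using A unfolding S_minus_def by blast+
  have skew: "a y x = - a x y" if "x \<in> pverts G" "y \<in> pverts G" for x y
  proof -
    have "transpose_mat A $$ (g x, g y) = (- A) $$ (g x, g y)" using At by simp
    then show ?thesis using Ac g[OF that(1)] g[OF that(2)] by (simp add: a_def)
  qed
  have sw: "skew_weight G a"
    unfolding skew_weight_def
  proof (intro ballI conjI)
    fix x y assume xy: "x \<in> pverts G" "y \<in> pverts G"
    then show "a y x = - a x y" by (rule skew)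
    show "a x y \<noteq> 0 \<longleftrightarrow> (x, y) \<in> parcs G"
    proof (cases "x = y")
      case True
      then have "a x y = 0" using skew[of x x] xy by simp
      then show ?thesis using True no_loops' by blast
    next
      case False
      then have "g x \<noteq> g y" using g xy by metis
      then show ?thesis using As[of "g x" "g y"] g xy by (simp add: a_def)
    qed
  qed
  define J where "J = (\<lambda>i. g (v i)) ` {1..n}"
  have vJ: "us ! g (v i) = v i \<and> g (v i) < ?m" if "i \<in> {1..n}" for i
    using g[OF v_verts[OF that]] by simp
  have inj: "inj_on (\<lambda>i. g (v i)) {1..n}"
    by (rule inj_onI) (metis vJ v_eq_iff)
  have J: "J \<subseteq> {..<?m}" using vJ by (auto simp: J_def)
  have cJ: "card J = n" using card_image[OF inj] by (simp add: J_def)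
  have sumJ: "(\<Sum>j\<in>J. d j * A $$ (p, j)) = (\<Sum>i\<in>{1..n}. d (g (v i)) * a (us ! p) (v i))"
    if "p < ?m" for d p
    unfolding J_def sum.reindex[OF inj] using vJ that by (intro sum.cong) (simp_all add: Aa)
  have ind: "\<forall>j\<in>J. d j = 0" if z: "\<And>p. p < ?m \<Longrightarrow> (\<Sum>j\<in>J. d j * A $$ (p, j)) = 0" for d
  proof -
    have "(\<Sum>i\<in>{1..n}. d (g (v i)) * a x (v i)) = 0" if "x \<in> pverts G" for x
      using sumJ[of "g x" d] z[of "g x"] g[OF that] by simp
    from path_columns_independent[OF sw this] show ?thesis by (auto simp: J_def)
  qed
  show "n \<le> vec_space.rank ?m A"
    using vec_space.rank_ge_independent_columns[OF Ac J ind] cJ by simp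
  have comb: "(\<forall>p<?m. A $$ (p, q) = (\<Sum>j\<in>J. d j * A $$ (p, j))) \<longleftrightarrow>
      (\<forall>x\<in>pverts G. a x (us ! q) = (\<Sum>i\<in>{1..n}. d (g (v i)) * a x (v i)))"
    if "q < ?m" for d q
  proof -
    have "(\<forall>p<?m. A $$ (p, q) = (\<Sum>j\<in>J. d j * A $$ (p, j))) \<longleftrightarrow>
      (\<forall>p<?m. a (us ! p) (us ! q) = (\<Sum>i\<in>{1..n}. d (g (v i)) * a (us ! p) (v i)))"
      using that by (simp add: sumJ Aa)
    also have "\<dots> \<longleftrightarrow> (\<forall>x\<in>set us. a x (us ! q) = (\<Sum>i\<in>{1..n}. d (g (v i)) * a x (v i)))"
      by (simp add: all_set_conv_all_nth)
    finally show ?thesis using us by simp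
  qed
  show "vec_space.rank ?m A = n \<longleftrightarrow> (\<exists>a. skew_weight G a \<and> path_spanned a \<and>
      (\<forall>p<?m. \<forall>q<?m. A $$ (p, q) = a (us ! p) (us ! q)))" (is "?L \<longleftrightarrow> ?R")
  proof
    assume ?L
    have "\<exists>c. \<forall>x\<in>pverts G. a x y = (\<Sum>i\<in>{1..n}. c i * a x (v i))" if y: "y \<in> pverts G" for y
    proof -
      from vec_space.column_combination[OF Ac J ind, of "g y"] \<open>?L\<close> cJ g[OF y]
      obtain d where "\<forall>p<?m. A $$ (p, g y) = (\<Sum>j\<in>J. d j * A $$ (p, j))" by auto
      then show ?thesis using comb[of "g y" d] g[OF y] by auto
    qed
    then have "path_spanned a" by (simp add: path_spanned_def)
    then show ?R using sw Aa by blast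
  next
    assume ?R
    then obtain b where b: "path_spanned b" "\<And>p q. p < ?m \<Longrightarrow> q < ?m \<Longrightarrow> A $$ (p, q) = b (us ! p) (us ! q)"
      by blast
    \<comment> \<open>\<open>b\<close> is known only through the matrix entries, so its agreement
      with \<open>a\<close> is confined to vertices of the graph.\<close>
    have ab: "a x y = b x y" if "x \<in> pverts G" "y \<in> pverts G" for x y
      using b(2)[of "g x" "g y"] g that by (simp add: a_def)
    have "\<exists>d. \<forall>p<?m. A $$ (p, q) = (\<Sum>j\<in>J. d j * A $$ (p, j))" if q: "q < ?m" for q
    proof -
      have uq: "us ! q \<in> pverts G" using nth_mem[OF q] us(2) by simp
      then obtain c where c: "\<And>x. x \<in> pverts G \<Longrightarrow> b x (us ! q) = (\<Sum>i\<in>{1..n}. c i * b x (v i))"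
        using b(1) unfolding path_spanned_def by meson
      define d where "d j = c (the_inv_into {1..n} (\<lambda>i. g (v i)) j)" for j
      have d: "d (g (v i)) = c i" if "i \<in> {1..n}" for i
        using the_inv_into_f_f[OF inj that] by (simp add: d_def)
      have "a x (us ! q) = (\<Sum>i\<in>{1..n}. d (g (v i)) * a x (v i))" if "x \<in> pverts G" for x
      proof -
        have "a x (us ! q) = (\<Sum>i\<in>{1..n}. c i * b x (v i))" using c[OF that] ab[OF that uq] by simp
        also have "\<dots> = (\<Sum>i\<in>{1..n}. d (g (v i)) * a x (v i))"
          using ab[OF that v_verts] d by (intro sum.cong) simp_all
        finally show ?thesis .
      qed
      then show ?thesis using comb[OF q] by blast
    qed
    from vec_space.rank_le_spanning_columns[OF Ac J this] \<open>n \<le> vec_space.rank ?m A\<close> cJ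
    show ?L by simp
  qed
qed

lemma mr_minus_eq_iff: "mr_minus G = n \<longleftrightarrow> (\<exists>a. skew_weight G a \<and> path_spanned a)"
proof -
  let ?P = "\<lambda>r. \<exists>us A. distinct us \<and> set us = pverts G \<and> A \<in> S_minus G us \<and>
    r = vec_space.rank (length us) A"
  have mr: "mr_minus G = (LEAST r. ?P r)" by (simp add: mr_minus_def)
  have ge: "n \<le> r" if "?P r" for r using that S_minus_rank(1) by blast
  obtain us where us: "distinct us" "set us = pverts G"
    using finite_distinct_list[OF pair_finite_verts] by blast
  have S: "mat (length us) (length us) (\<lambda>(p, q). a (us ! p) (us ! q)) \<in> S_minus G us"
    if "skew_weight G a" for a
  proof -
    have V: "us ! p \<in> pverts G" if "p < length us" for p
      using nth_mem[OF that] us(2) by simp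
    show ?thesis
      using skew_weight_uminus[OF that V V] skew_weight_iff[OF that V V] by (rule S_minusI)
  qed
  show ?thesis
  proof
    assume L: "mr_minus G = n"
    \<comment> \<open>\<open>LEAST\<close> is informative only if some rank is attained. Orienting
      every edge by the order of the enumeration provides one skew matrix.\<close>
    let ?s = "\<lambda>p q. if (us ! p, us ! q) \<in> parcs G then (if p < q then 1 else - 1) else 0 :: real"
    have "mat (length us) (length us) (\<lambda>(p, q). ?s p q) \<in> S_minus G us"
    proof (rule S_minusI)
      fix p q
      have "(us ! q, us ! p) \<in> parcs G \<longleftrightarrow> (us ! p, us ! q) \<in> parcs G"
        using arcs_symmetric by blast
      moreover have "(us ! p, us ! p) \<notin> parcs G" using no_loops' by blast
      ultimately show "?s q p = - ?s p q" by (cases p q rule: linorder_cases) simp_all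
    qed simp
    then have "\<exists>r. ?P r" using us by blast
    then have "?P n" using LeastI_ex[of ?P] L mr by metis
    then show "\<exists>a. skew_weight G a \<and> path_spanned a" using S_minus_rank(2) by metis
  next
    assume "\<exists>a. skew_weight G a \<and> path_spanned a"
    then obtain a where a: "skew_weight G a" "path_spanned a" by blast
    have "vec_space.rank (length us) (mat (length us) (length us) (\<lambda>(p, q). a (us ! p) (us ! q))) = n"
      using S_minus_rank(2)[OF us S[OF a(1)]] a by auto
    then have "?P n" using us S[OF a(1)] by metis
    then show "mr_minus G = n" unfolding mr using ge by (intro Least_equality) auto
  qed
qed

section \<open>Vertices off the path and the Schur complement\<close>

definition outer :: "'a set" where
  "outer = pverts G - v ` {1..n}"

definition nbrs :: "'a \<Rightarrow> nat set" where
  "nbrs x = {i \<in> {1..n}. (x, v i) \<in> parcs G}"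

lemma nbrsD: "i \<in> nbrs x \<Longrightarrow> i \<in> {1..n} \<and> (x, v i) \<in> parcs G \<and> (v i, x) \<in> parcs G"
  by (auto simp: nbrs_def intro: arcs_symmetric)

lemma outer_verts: "x \<in> outer \<Longrightarrow> x \<in> pverts G"
  by (simp add: outer_def)

lemma outer_path_neq: "x \<in> outer \<Longrightarrow> i \<in> {1..n} \<Longrightarrow> x \<noteq> v i"
  by (auto simp: outer_def)

text \<open>With at most one path neighbour, the path rows of column \<open>y\<close> are a multiple
  of a unit vector or zero. The coefficients are then a multiple of one column of the inverse path
  block, or zero; \<open>p = 0\<close> encodes the absence of a path neighbour.\<close>

lemma path_spanned_solution:
  assumes a: "skew_weight G a" "path_spanned a" and y: "y \<in> outer"
    and nb: "nbrs y = (if p = 0 then {} else {p})"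
  obtains c where "\<And>x. x \<in> pverts G \<Longrightarrow> a x y = (\<Sum>i\<in>{1..n}. c i * a x (v i))"
    and "\<And>l. l \<in> {1..n} \<Longrightarrow> c l \<noteq> 0 \<longleftrightarrow> linked l p"
proof -
  obtain c where c: "\<And>x. x \<in> pverts G \<Longrightarrow> a x y = (\<Sum>i\<in>{1..n}. c i * a x (v i))"
    using a(2) outer_verts[OF y] unfolding path_spanned_def by meson
  have "c l \<noteq> 0 \<longleftrightarrow> linked l p" if "l \<in> {1..n}" for l
  proof (rule path_solution_support[OF a(1) _ _ that])
    show "p \<le> n" using nb nbrsD[of p y] by (cases "p = 0") auto
  next
    fix m assume m: "m \<in> {1..n}"
    have "(\<Sum>i\<in>{1..n}. c i * a (v m) (v i)) \<noteq> 0 \<longleftrightarrow> (v m, y) \<in> parcs G"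
      using c[OF v_verts[OF m]] skew_weight_iff[OF a(1) v_verts[OF m] outer_verts[OF y]] by simp
    also have "\<dots> \<longleftrightarrow> m \<in> nbrs y"
      using m by (auto simp: nbrs_def intro: arcs_symmetric)
    also have "\<dots> \<longleftrightarrow> m = p" using m nb by auto
    finally show "(\<Sum>i\<in>{1..n}. c i * a (v m) (v i)) \<noteq> 0 \<longleftrightarrow> m = p" .
  qed
  with c that show thesis by blast
qed

text \<open>Without a path neighbour all coefficients vanish, so the whole column of
  \<open>y\<close> is zero, against the arc from \<open>x\<close>.\<close>

lemma mr_minus_imp_adjacent:
  assumes "mr_minus G = n" and y: "y \<in> outer" and "(x, y) \<in> parcs G"
  shows "nbrs y \<noteq> {}"
proof
  assume "nbrs y = {}"
  then have nb: "nbrs y = (if 0 = (0::nat) then {} else {0})" by simp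
  obtain a where a: "skew_weight G a" "path_spanned a"
    using assms mr_minus_eq_iff by blast
  obtain c where c: "\<And>x. x \<in> pverts G \<Longrightarrow> a x y = (\<Sum>i\<in>{1..n}. c i * a x (v i))"
    and c0: "\<And>l. l \<in> {1..n} \<Longrightarrow> c l \<noteq> 0 \<longleftrightarrow> linked l 0"
    using path_spanned_solution[OF a y nb] by blast
  have x: "x \<in> pverts G" using assms(3) wellformed' by blast
  have "c l = 0" if "l \<in> {1..n}" for l using c0[OF that] by (simp add: linked_def)
  then have "a x y = 0" using c[OF x] by simp
  then show False using skew_weight_iff[OF a(1) x outer_verts[OF y]] assms(3) by simp
qed

text \<open>The entry at \<open>x\<close>, \<open>y\<close> is a sum with one nonzero term for each
  neighbour position of \<open>x\<close> linked to \<open>p\<close>. An empty sum excludes the arc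
  and a single term forces it. Two or more terms may cancel, so nothing is claimed for them.\<close>

lemma path_spanned_arcs:
  assumes a: "skew_weight G a" "path_spanned a" and y: "y \<in> outer" "nbrs y = {p}"
    and x: "x \<in> outer"
  shows "nbrs x \<inter> {l. linked l p} = {} \<Longrightarrow> (x, y) \<notin> parcs G"
    and "nbrs x \<inter> {l. linked l p} = {l} \<Longrightarrow> (x, y) \<in> parcs G"
proof -
  have "p \<noteq> 0" using nbrsD[of p y] y by auto
  then have nb: "nbrs y = (if p = 0 then {} else {p})" using y by simp
  obtain c where c: "\<And>x. x \<in> pverts G \<Longrightarrow> a x y = (\<Sum>i\<in>{1..n}. c i * a x (v i))"
    and cl: "\<And>l. l \<in> {1..n} \<Longrightarrow> c l \<noteq> 0 \<longleftrightarrow> linked l p"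
    using path_spanned_solution[OF a y(1) nb] by blast
  have ax: "a x (v i) \<noteq> 0 \<longleftrightarrow> i \<in> nbrs x" if "i \<in> {1..n}" for i
    using skew_weight_iff[OF a(1) outer_verts[OF x] v_verts[OF that]] that by (simp add: nbrs_def)
  have sub: "nbrs x \<inter> {l. linked l p} \<subseteq> {1..n}" by (auto simp: nbrs_def)
  have "a x y = (\<Sum>i\<in>{1..n}. c i * a x (v i))" by (rule c[OF outer_verts[OF x]])
  also have "\<dots> = (\<Sum>i\<in>nbrs x \<inter> {l. linked l p}. c i * a x (v i))"
  proof (rule sum.mono_neutral_right[OF _ sub], simp, intro ballI)
    fix i assume i: "i \<in> {1..n} - nbrs x \<inter> {l. linked l p}"
    then have "c i = 0 \<or> a x (v i) = 0" using ax[of i] cl[of i] by blast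
    then show "c i * a x (v i) = 0" by auto
  qed
  finally have axy: "a x y = (\<Sum>i\<in>nbrs x \<inter> {l. linked l p}. c i * a x (v i))" .
  note iff = skew_weight_iff[OF a(1) outer_verts[OF x] outer_verts[OF y(1)]]
  show "nbrs x \<inter> {l. linked l p} = {} \<Longrightarrow> (x, y) \<notin> parcs G"
    using axy iff by simp
  assume l: "nbrs x \<inter> {l. linked l p} = {l}"
  then have "l \<in> {1..n}" "l \<in> nbrs x" "linked l p" using sub by auto
  then have "c l * a x (v l) \<noteq> 0" using ax cl by simp
  then show "(x, y) \<in> parcs G" using axy iff unfolding l by simp
qed

lemma path_spanned_arcs_single:
  assumes "skew_weight G a" "path_spanned a" and "x \<in> outer" "nbrs x = {q}"
    and "y \<in> outer" "nbrs y = {p}"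
  shows "(x, y) \<in> parcs G \<longleftrightarrow> linked q p"
  using path_spanned_arcs[OF assms(1,2,5,6,3)] assms(4) by (cases "linked q p") auto

text \<open>The inverse of the skew adjacency matrix of the path with all weights \<open>1\<close>, up to sign.\<close>

definition path_inv :: "nat \<Rightarrow> nat \<Rightarrow> real" where
  "path_inv i j = (if odd i \<and> even j \<and> i < j then 1 else if even i \<and> odd j \<and> j < i then - 1 else 0)"

lemma path_inv_uminus: "path_inv j i = - path_inv i j"
  by (auto simp: path_inv_def)

lemma path_inv_nonzero: "path_inv i j \<noteq> 0 \<longleftrightarrow> linked i j"
  by (auto simp: path_inv_def linked_def)

text \<open>Up to sign this is the product of \<open>path_inv\<close> with the path matrix. At the
  ends, \<open>n + 1\<close> is odd and above \<open>i\<close> while 0 is even and below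
  \<open>i\<close>, so \<open>path_inv\<close> vanishes at both and the boundary cases merge with
  the general one.\<close>

lemma path_inv_diff:
  assumes "m \<in> {1..n}" and "i \<in> {1..n}"
  shows "(if m < n then path_inv i (m + 1) else 0) - (if 1 < m then path_inv i (m - 1) else 0) =
    (if i = m then 1 else 0)"
proof -
  have 1: "(if m < n then path_inv i (m + 1) else 0) = path_inv i (m + 1)"
    using assms even_n by (auto simp: path_inv_def)
  have 2: "(if 1 < m then path_inv i (m - 1) else 0) = path_inv i (m - 1)"
    using assms by (auto simp: path_inv_def)
  show ?thesis unfolding 1 2
    using assms by (auto simp: path_inv_def less_Suc_eq elim!: oddE evenE) presburger+
qed

text \<open>The skew form of the inverse path block, evaluated at the weight vectors of the arcs
  that join \<open>x\<close> and \<open>y\<close> to the path.\<close>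

definition outer_form :: "('a \<Rightarrow> nat \<Rightarrow> real) \<Rightarrow> 'a \<Rightarrow> 'a \<Rightarrow> real" where
  "outer_form b x y = (\<Sum>i\<in>{1..n}. \<Sum>j\<in>{1..n}. b x i * path_inv i j * b y j)"

lemma outer_form_uminus: "outer_form b y x = - outer_form b x y"
proof -
  have "outer_form b y x = (\<Sum>j\<in>{1..n}. \<Sum>i\<in>{1..n}. b y i * path_inv i j * b x j)"
    unfolding outer_form_def by (rule sum.swap)
  also have "\<dots> = (\<Sum>j\<in>{1..n}. \<Sum>i\<in>{1..n}. - (b x j * path_inv j i * b y i))"
  proof (intro sum.cong refl)
    fix i j show "b y i * path_inv i j * b x j = - (b x j * path_inv j i * b y i)"
      unfolding path_inv_uminus[of i j] by simp
  qed
  also have "\<dots> = - outer_form b x y" by (simp add: outer_form_def sum_negf)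
  finally show ?thesis .
qed

text \<open>Once the weights on the path and towards it are chosen, rank \<open>n\<close> dictates
  the remaining block: it has to be \<open>outer_form\<close>. Assumption \<open>form\<close> says
  that this forced block has the zero pattern of the graph.\<close>

lemma mr_minusI:
  assumes b: "\<And>x i. x \<in> outer \<Longrightarrow> i \<in> {1..n} \<Longrightarrow> b x i \<noteq> 0 \<longleftrightarrow> i \<in> nbrs x"
    and form: "\<And>x y. x \<in> outer \<Longrightarrow> y \<in> outer \<Longrightarrow> x \<noteq> y \<Longrightarrow>
      outer_form b x y \<noteq> 0 \<longleftrightarrow> (x, y) \<in> parcs G"
  shows "mr_minus G = n"
proof -
  define ix where "ix = the_inv_into {1..n} v"
  have ix: "ix (v i) = i" if "i \<in> {1..n}" for i
    using the_inv_into_f_f[OF v_inj that] by (simp add: ix_def)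
  define B :: "nat \<Rightarrow> nat \<Rightarrow> real" where
    "B i j = (if j = i + 1 then 1 else if i = j + 1 then - 1 else 0)" for i j
  define a where "a x y =
    (if x \<in> outer then (if y \<in> outer then outer_form b x y else - b x (ix y))
     else (if y \<in> outer then b y (ix x) else B (ix x) (ix y)))" for x y
  have path: "v i \<notin> outer" if "i \<in> {1..n}" for i using that by (auto simp: outer_def)
  have a1: "a (v i) (v j) = B i j" if "i \<in> {1..n}" "j \<in> {1..n}" for i j
    using that path ix by (simp add: a_def)
  have a2: "a (v i) y = b y i" "a y (v i) = - b y i" if "i \<in> {1..n}" "y \<in> outer" for i y
    using that path ix by (simp_all add: a_def)
  have a3: "a x y = outer_form b x y" if "x \<in> outer" "y \<in> outer" for x y
    using that by (simp add: a_def)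
  have V: "(\<exists>i\<in>{1..n}. x = v i) \<or> x \<in> outer" if "x \<in> pverts G" for x
    using that by (auto simp: outer_def)
  have sw: "skew_weight G a"
    unfolding skew_weight_def
  proof (intro ballI)
    fix x y assume xy: "x \<in> pverts G" "y \<in> pverts G"
    consider (pp) i j where "i \<in> {1..n}" "j \<in> {1..n}" "x = v i" "y = v j"
      | (po) i where "i \<in> {1..n}" "x = v i" "y \<in> outer"
      | (op) i where "i \<in> {1..n}" "y = v i" "x \<in> outer"
      | (oo) "x \<in> outer" "y \<in> outer"
      using V xy by meson
    then show "a y x = - a x y \<and> (a x y \<noteq> 0 \<longleftrightarrow> (x, y) \<in> parcs G)"
    proof cases
      case pp then show ?thesis using v_arcs by (simp add: a1 B_def)
    next
      case po
      have "(v i, y) \<in> parcs G \<longleftrightarrow> i \<in> nbrs y"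
        using po by (auto simp: nbrs_def intro: arcs_symmetric)
      then show ?thesis using po b by (simp add: a2)
    next
      case op
      have "(x, v i) \<in> parcs G \<longleftrightarrow> i \<in> nbrs x" using op by (simp add: nbrs_def)
      then show ?thesis using op b by (simp add: a2)
    next
      case oo
      have "outer_form b x y \<noteq> 0 \<longleftrightarrow> (x, y) \<in> parcs G"
      proof (cases "x = y")
        case True
        then have "outer_form b x y = 0" using outer_form_uminus[of b x x] by simp
        then show ?thesis using True no_loops' by blast
      next
        case False then show ?thesis using form oo by simp
      qed
      then show ?thesis using oo outer_form_uminus[of b y x] by (simp add: a3)
    qed
  qed
  have "\<exists>c. \<forall>x\<in>pverts G. a x y = (\<Sum>i\<in>{1..n}. c i * a x (v i))" if y: "y \<in> pverts G" for y
  proof -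
    from V[OF y] show ?thesis
    proof
      assume "\<exists>i\<in>{1..n}. y = v i"
      then obtain j where j: "j \<in> {1..n}" "y = v j" by blast
      have "a x y = (\<Sum>i\<in>{1..n}. (if i = j then 1 else 0) * a x (v i))" for x
      proof -
        have "(\<Sum>i\<in>{1..n}. (if i = j then 1 else 0) * a x (v i)) =
            (\<Sum>i\<in>{1..n}. if i = j then a x (v i) else 0)"
          by (intro sum.cong) auto
        also have "\<dots> = a x y" using j by simp
        finally show ?thesis by simp
      qed
      then show ?thesis by (intro exI[of _ "\<lambda>i. if i = j then 1 else 0"]) blast
    next
      assume y: "y \<in> outer"
      \<comment> \<open>The weight vector of \<open>y\<close> times \<open>path_inv\<close>; by
        \<open>path_inv_diff\<close> it solves the rows at path vertices.\<close>
      define c where "c l = (\<Sum>i\<in>{1..n}. b y i * path_inv i l)" for l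
      have "a x y = (\<Sum>i\<in>{1..n}. c i * a x (v i))" if x: "x \<in> pverts G" for x
        using V[OF x]
      proof
        assume "\<exists>i\<in>{1..n}. x = v i"
        then obtain m where m: "m \<in> {1..n}" "x = v m" by blast
        have "(\<Sum>i\<in>{1..n}. c i * a x (v i)) =
            (if m < n then c (m + 1) else 0) - (if 1 < m then c (m - 1) else 0)"
        proof -
          have "1 < m \<Longrightarrow> a (v m) (v (m - 1)) = - 1"
            by (subst a1) (use m in \<open>auto simp: B_def\<close>)
          moreover have "m < n \<Longrightarrow> a (v m) (v (m + 1)) = 1"
            by (subst a1) (use m in \<open>auto simp: B_def\<close>)
          ultimately show ?thesis using path_row_sum[OF sw m(1), of c] m(2) by simp
        qed
        also have "\<dots> = (\<Sum>i\<in>{1..n}. b y i *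
            ((if m < n then path_inv i (m + 1) else 0) - (if 1 < m then path_inv i (m - 1) else 0)))"
          by (simp add: c_def right_diff_distrib sum_subtractf)
        also have "\<dots> = (\<Sum>i\<in>{1..n}. b y i * (if i = m then 1 else 0))"
          using path_inv_diff[OF m(1)] by (intro sum.cong) simp_all
        also have "\<dots> = (\<Sum>i\<in>{1..n}. if i = m then b y i else 0)"
          by (intro sum.cong) auto
        also have "\<dots> = a x y" using m y by (simp add: a2)
        finally show ?thesis by simp
      next
        assume x: "x \<in> outer"
        have "(\<Sum>j\<in>{1..n}. c j * a x (v j)) = (\<Sum>j\<in>{1..n}. - (c j * b x j))"
          using x by (intro sum.cong) (simp_all add: a2)
        also have "\<dots> = - (\<Sum>j\<in>{1..n}. \<Sum>i\<in>{1..n}. b y i * path_inv i j * b x j)"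
          by (simp add: c_def sum_negf sum_distrib_right)
        also have "\<dots> = - outer_form b y x" unfolding outer_form_def by (subst sum.swap) simp
        also have "\<dots> = a x y" using x y outer_form_uminus[of b y x] by (simp add: a3)
        finally show ?thesis by simp
      qed
      then show ?thesis by blast
    qed
  qed
  then have "path_spanned a" by (simp add: path_spanned_def)
  then show ?thesis using sw mr_minus_eq_iff by blast
qed

lemma outer_form_nbrs:
  assumes "\<And>i. i \<in> {1..n} \<Longrightarrow> i \<notin> nbrs x \<Longrightarrow> b x i = 0"
    and "\<And>i. i \<in> {1..n} \<Longrightarrow> i \<notin> nbrs y \<Longrightarrow> b y i = 0"
  shows "outer_form b x y = (\<Sum>i\<in>nbrs x. \<Sum>j\<in>nbrs y. b x i * path_inv i j * b y j)"
proof -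
  have sub: "nbrs z \<subseteq> {1..n}" for z by (auto simp: nbrs_def)
  have "outer_form b x y = (\<Sum>i\<in>nbrs x. \<Sum>j\<in>{1..n}. b x i * path_inv i j * b y j)"
    unfolding outer_form_def using sub assms by (intro sum.mono_neutral_right) auto
  also have "\<dots> = (\<Sum>i\<in>nbrs x. \<Sum>j\<in>nbrs y. b x i * path_inv i j * b y j)"
    using sub assms by (intro sum.cong sum.mono_neutral_right) auto
  finally show ?thesis .
qed

section \<open>The rank condition for the two shapes of the cycle\<close>

definition legs :: "'a set \<Rightarrow> nat set" where
  "legs S = {p. \<exists>x\<in>outer - S. nbrs x = {p}}"

text \<open>Here \<open>d\<close> is the gap between the positions where the cycle leaves the path:
  \<open>w\<close> closes a cycle with \<open>d + 2\<close> vertices, and the pair in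
  \<open>two_outer\<close> closes one with \<open>d + 3\<close>. In \<open>two_outer\<close> the gap
  may be 0, giving a triangle with one path vertex.\<close>

definition one_outer :: "'a \<Rightarrow> nat \<Rightarrow> nat \<Rightarrow> bool" where
  "one_outer w i d \<longleftrightarrow> w \<in> outer \<and> 0 < d \<and> nbrs w = {i, i + d} \<and>
     (\<forall>x\<in>outer - {w}. \<exists>p. nbrs x = {p}) \<and> (\<forall>x\<in>outer. \<forall>y\<in>outer. (x, y) \<notin> parcs G)"

definition two_outer :: "'a \<Rightarrow> 'a \<Rightarrow> nat \<Rightarrow> nat \<Rightarrow> bool" where
  "two_outer w u i d \<longleftrightarrow> w \<in> outer \<and> u \<in> outer \<and> w \<noteq> u \<and> nbrs w = {i} \<and> nbrs u = {i + d} \<and>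
     (\<forall>x\<in>outer - {w, u}. \<exists>p. nbrs x = {p}) \<and>
     (\<forall>x\<in>outer. \<forall>y\<in>outer. (x, y) \<in> parcs G \<longleftrightarrow> x = w \<and> y = u \<or> x = u \<and> y = w)"

text \<open>Legs are pairwise nonadjacent, hence pairwise unlinked. Against a leg at
  \<open>p\<close>, the vertex \<open>w\<close> contributes one term for each of \<open>i\<close>
  and \<open>i + d\<close> that is linked to \<open>p\<close>. For \<open>d = 1\<close> these have
  different parity and at most one is linked, so no cancellation is possible and both must be
  unlinked. For \<open>d = 2\<close> they are linked to \<open>p\<close> alike, and their terms can
  cancel, except when \<open>p = i + 1\<close>: then exactly one of them is linked.\<close>

theorem mr_minus_one_outer:
  assumes sh: "one_outer w i d" and d: "d \<in> {1, 2}"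
  shows "mr_minus G = n \<longleftrightarrow>
    (\<forall>p\<in>legs {w}. \<forall>q\<in>legs {w}. \<not> linked p q) \<and>
    (d = 1 \<longrightarrow> (\<forall>p\<in>legs {w}. \<not> linked i p \<and> \<not> linked (i + 1) p)) \<and>
    (d = 2 \<longrightarrow> i + 1 \<notin> legs {w})" (is "?L \<longleftrightarrow> ?R")
proof
  have w: "w \<in> outer" "nbrs w = {i, i + d}" and single: "\<And>x. x \<in> outer - {w} \<Longrightarrow> \<exists>p. nbrs x = {p}"
    and arc: "\<And>x y. x \<in> outer \<Longrightarrow> y \<in> outer \<Longrightarrow> (x, y) \<notin> parcs G"
    using sh by (auto simp: one_outer_def)
  {
    assume ?L
    then obtain a where a: "skew_weight G a" "path_spanned a" using mr_minus_eq_iff by blast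
    have 1: "\<not> linked p q" if pq: "p \<in> legs {w}" "q \<in> legs {w}" for p q
    proof -
      obtain x y where "x \<in> outer" "nbrs x = {p}" "y \<in> outer" "nbrs y = {q}"
        using pq by (auto simp: legs_def)
      then show ?thesis using path_spanned_arcs_single[OF a] arc by blast
    qed
    have w_arc: "nbrs w \<inter> {l. linked l p} \<noteq> {l}" if "p \<in> legs {w}" for p l
    proof -
      obtain x where x: "x \<in> outer" "nbrs x = {p}" using \<open>p \<in> legs {w}\<close> by (auto simp: legs_def)
      show ?thesis using path_spanned_arcs(2)[OF a x w(1), of l] arc[OF w(1) x(1)] by blast
    qed
    have 2: "\<not> linked i p \<and> \<not> linked (i + 1) p" if "p \<in> legs {w}" "d = 1" for p
    proof -
      have "\<not> (linked i p \<and> linked (i + 1) p)" by (auto simp: linked_def)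
      then show ?thesis
        using w_arc[OF that(1), of i] w_arc[OF that(1), of "i + 1"] w(2) that(2) by auto
    qed
    have 3: "i + 1 \<notin> legs {w}" if "d = 2"
    proof
      assume "i + 1 \<in> legs {w}"
      from w_arc[OF this, of i] w_arc[OF this, of "i + 2"] show False
        using w(2) that by (auto simp: linked_def)
    qed
    show ?R using 1 2 3 by blast
  next
    assume R: ?R
    \<comment> \<open>For \<open>d = 2\<close> the sign makes the two contributions of \<open>w\<close> cancel on every leg beyond it.\<close>
    define b :: "'a \<Rightarrow> nat \<Rightarrow> real" where
      "b x j = (if j \<notin> nbrs x then 0 else if x = w \<and> d = 2 \<and> j = i + 2 then - 1 else 1)" for x j
    have form: "outer_form b x y = (\<Sum>i\<in>nbrs x. \<Sum>j\<in>nbrs y. b x i * path_inv i j * b y j)" for x y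
      by (rule outer_form_nbrs) (simp_all add: b_def)
    have zero_w: "outer_form b w y = 0" if y: "y \<in> outer" "y \<noteq> w" for y
    proof -
      obtain q where q: "nbrs y = {q}" using single y by blast
      then have leg: "q \<in> legs {w}" using y by (auto simp: legs_def)
      have "i \<noteq> i + d" using d by auto
      then have "outer_form b w y = b w i * path_inv i q * b y q + b w (i + d) * path_inv (i + d) q * b y q"
        using form[of w y] w q by simp
      also have "\<dots> = 0"
      proof (cases "d = 1")
        case True
        then have "path_inv i q = 0" "path_inv (i + d) q = 0"
          using R leg path_inv_nonzero by blast+
        then show ?thesis by simp
      next
        case False
        then have d2: "d = 2" using d by simp
        then have "q \<noteq> i + 1" using R leg by blast
        then have "odd i \<and> even q \<and> i < q \<longleftrightarrow> odd (i + 2) \<and> even q \<and> i + 2 < q"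
          and "even i \<and> odd q \<and> q < i \<longleftrightarrow> even (i + 2) \<and> odd q \<and> q < i + 2"
          by presburger+
        then have "path_inv i q = path_inv (i + 2) q" by (simp only: path_inv_def)
        then show ?thesis using d2 w(2) by (simp add: b_def)
      qed
      finally show ?thesis .
    qed
    show ?L
    proof (rule mr_minusI)
      show "b x j \<noteq> 0 \<longleftrightarrow> j \<in> nbrs x" for x j by (simp add: b_def)
    next
      fix x y assume xy: "x \<in> outer" "y \<in> outer" "x \<noteq> y"
      have "outer_form b x y = 0"
      proof (cases "x = w \<or> y = w")
        case True
        then show ?thesis using zero_w xy outer_form_uminus[of b w x] by auto
      next
        case False
        then obtain p q where pq: "nbrs x = {p}" "nbrs y = {q}"
          using single[of x] single[of y] xy by auto
        then have "p \<in> legs {w}" "q \<in> legs {w}" using False xy by (auto simp: legs_def)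
        then have "path_inv p q = 0" using R path_inv_nonzero by blast
        then show ?thesis using form[of x y] pq by simp
      qed
      then show "outer_form b x y \<noteq> 0 \<longleftrightarrow> (x, y) \<in> parcs G" using arc xy by blast
    qed
  }
qed

text \<open>Every outer vertex has a single path neighbour, so each entry of the form has a single
  term and cancellation cannot occur. The arcs off the path are thus exactly the linked pairs, for
  any weights, and the only such arc is the one between \<open>w\<close> and
  \<open>u\<close>.\<close>

theorem mr_minus_two_outer:
  assumes sh: "two_outer w u i d"
  shows "mr_minus G = n \<longleftrightarrow> linked i (i + d) \<and>
    (\<forall>p\<in>legs {w, u}. \<not> linked i p \<and> \<not> linked (i + d) p) \<and>
    (\<forall>p\<in>legs {w, u}. \<forall>q\<in>legs {w, u}. \<not> linked p q)" (is "?L \<longleftrightarrow> ?R")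
proof
  have wu: "w \<in> outer" "u \<in> outer" "w \<noteq> u" "nbrs w = {i}" "nbrs u = {i + d}"
    and single': "\<forall>x\<in>outer - {w, u}. \<exists>p. nbrs x = {p}"
    and arc: "\<And>x y. x \<in> outer \<Longrightarrow> y \<in> outer \<Longrightarrow> (x, y) \<in> parcs G \<longleftrightarrow> x = w \<and> y = u \<or> x = u \<and> y = w"
    using sh by (simp_all add: two_outer_def)
  have single: "\<exists>p. nbrs x = {p}" if "x \<in> outer" for x
    using single' wu that by (cases "x \<in> {w, u}") auto
  {
    assume ?L
    then obtain a where a: "skew_weight G a" "path_spanned a" using mr_minus_eq_iff by blast
    note linked_arc = path_spanned_arcs_single[OF a]
    have "linked i (i + d)" using linked_arc wu arc by blast
    moreover have "\<not> linked i p \<and> \<not> linked (i + d) p" if p: "p \<in> legs {w, u}" for p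
    proof -
      obtain x where "x \<in> outer" "x \<noteq> w" "x \<noteq> u" "nbrs x = {p}" using p by (auto simp: legs_def)
      then show ?thesis using linked_arc wu arc by metis
    qed
    moreover have "\<not> linked p q" if pq: "p \<in> legs {w, u}" "q \<in> legs {w, u}" for p q
    proof -
      obtain x y where "x \<in> outer" "x \<noteq> w" "x \<noteq> u" "nbrs x = {p}" "y \<in> outer" "nbrs y = {q}"
        using pq unfolding legs_def by blast
      then show ?thesis using linked_arc arc by blast
    qed
    ultimately show ?R by blast
  next
    assume R: ?R
    define b :: "'a \<Rightarrow> nat \<Rightarrow> real" where "b x j = (if j \<in> nbrs x then 1 else 0)" for x j
    show ?L
    proof (rule mr_minusI)
      show "b x j \<noteq> 0 \<longleftrightarrow> j \<in> nbrs x" for x j by (simp add: b_def)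
    next
      fix x y assume xy: "x \<in> outer" "y \<in> outer" "x \<noteq> y"
      then obtain p q where pq: "nbrs x = {p}" "nbrs y = {q}"
        using single[of x] single[of y] by auto
      have "outer_form b x y = (\<Sum>i\<in>nbrs x. \<Sum>j\<in>nbrs y. b x i * path_inv i j * b y j)"
        by (rule outer_form_nbrs) (simp_all add: b_def)
      then have "outer_form b x y = path_inv p q" using pq by (simp add: b_def)
      then have iff: "outer_form b x y \<noteq> 0 \<longleftrightarrow> linked p q" using path_inv_nonzero by simp
      have leg: "z \<in> {w, u} \<or> r \<in> legs {w, u}" if "z \<in> outer" "nbrs z = {r}" for z r
        using that by (auto simp: legs_def)
      have "linked p q \<longleftrightarrow> (x, y) \<in> parcs G"
      proof -
        consider "x = w" "y = u" | "x = u" "y = w"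
          | "x \<in> {w, u}" "y \<notin> {w, u}" "q \<in> legs {w, u}"
          | "y \<in> {w, u}" "x \<notin> {w, u}" "p \<in> legs {w, u}"
          | "x \<notin> {w, u}" "p \<in> legs {w, u}" "q \<in> legs {w, u}"
          using leg[OF xy(1) pq(1)] leg[OF xy(2) pq(2)] xy(3) by blast
        then show ?thesis
        proof cases
          case 1
          then have "p = i" "q = i + d" using pq wu by auto
          then show ?thesis using R arc[OF xy(1,2)] 1 by simp
        next
          case 2
          then have "q = i" "p = i + d" using pq wu by auto
          then show ?thesis using R arc[OF xy(1,2)] 2 linked_commute by metis
        next
          case 3
          then have "p \<in> {i, i + d}" using pq wu by auto
          then have "\<not> linked p q" using R 3 by blast
          then show ?thesis using arc[OF xy(1,2)] 3 by blast
        next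
          case 4
          then have "q \<in> {i, i + d}" using pq wu by auto
          then have "\<not> linked q p" using R 4 by blast
          then show ?thesis using arc[OF xy(1,2)] 4 linked_commute by blast
        next
          case 5
          then have "\<not> linked p q" using R by blast
          then show ?thesis using arc[OF xy(1,2)] 5 by blast
        qed
      qed
      then show "outer_form b x y \<noteq> 0 \<longleftrightarrow> (x, y) \<in> parcs G" using iff by blast
    qed
  }
qed

end

section \<open>Distances and centipedes\<close>

context pair_wf_digraph
begin

text \<open>Relation powers replace walks from here on, so that joining walks becomes adding
  exponents. The membership of \<open>x\<close> matters for length 0, where the power relates every
  element to itself.\<close>

lemma awalk_iff_relpow:
  "(\<exists>p. awalk x p y \<and> length p = k) \<longleftrightarrow> x \<in> pverts G \<and> (x, y) \<in> parcs G ^^ k"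
proof (induction k arbitrary: x)
  case 0
  show ?case by (auto simp: awalk_Nil_iff)
next
  case (Suc k)
  have "(\<exists>p. awalk x p y \<and> length p = Suc k) \<longleftrightarrow>
      (\<exists>e p. e \<in> parcs G \<and> fst e = x \<and> awalk (snd e) p y \<and> length p = k)"
  proof -
    have "(\<exists>p. awalk x p y \<and> length p = Suc k) \<longleftrightarrow> (\<exists>e p. awalk x (e # p) y \<and> length p = k)"
      by (metis length_Suc_conv)
    then show ?thesis by (auto simp: awalk_Cons_iff)
  qed
  also have "\<dots> \<longleftrightarrow> (\<exists>z. (x, z) \<in> parcs G \<and> (z, y) \<in> parcs G ^^ k)"
    using Suc.IH wellformed' by (auto 0 4)
  also have "\<dots> \<longleftrightarrow> x \<in> pverts G \<and> (x, y) \<in> parcs G ^^ Suc k"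
  proof -
    have "(x, y) \<in> parcs G ^^ Suc k \<longleftrightarrow> (\<exists>z. (x, z) \<in> parcs G \<and> (z, y) \<in> parcs G ^^ k)"
      by (meson relpow_Suc_E2 relpow_Suc_I2)
    then show ?thesis using wellformed'(1) by blast
  qed
  finally show ?case .
qed

lemma awalk_cost_one: "awalk_cost (\<lambda>e. 1) p = real (length p)"
  by (induction p) auto

lemma gdist_eq: "gdist (with_proj G) x y = (INF p\<in>{p. awalk x p y}. ereal (real (length p)))"
  unfolding gdist_def \<mu>_def by (simp add: awalk_cost_one)

lemma gdist_le:
  assumes "x \<in> pverts G" and "(x, y) \<in> parcs G ^^ k"
  shows "gdist (with_proj G) x y \<le> ereal (real k)"
proof -
  obtain p where "awalk x p y" "length p = k" using assms awalk_iff_relpow by blast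
  then show ?thesis unfolding gdist_eq by (intro INF_lower2[of p]) auto
qed

lemma gdist_ge:
  assumes "\<And>k. (x, y) \<in> parcs G ^^ k \<Longrightarrow> m \<le> k"
  shows "ereal (real m) \<le> gdist (with_proj G) x y"
  unfolding gdist_eq
proof (rule INF_greatest)
  fix p assume "p \<in> {p. awalk x p y}"
  then have "(x, y) \<in> parcs G ^^ length p" using awalk_iff_relpow by blast
  then show "ereal (real m) \<le> ereal (real (length p))" using assms by simp
qed

lemma gdist_leD:
  assumes "gdist (with_proj G) x y \<le> ereal (real m)"
  shows "\<exists>k\<le>m. (x, y) \<in> parcs G ^^ k"
proof -
  \<comment> \<open>Lengths are integers, so the bound may be relaxed to a strict one by
    \<open>m + 1\<close>; an infimum below a strict bound is witnessed by an actual walk.\<close>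
  have "gdist (with_proj G) x y < ereal (real m + 1)"
    using assms by (rule order.strict_trans1) simp
  then obtain p where "awalk x p y" "ereal (real (length p)) < ereal (real m + 1)"
    unfolding gdist_eq by (auto simp: INF_less_iff)
  moreover from this have "length p \<le> m" by simp
  ultimately show ?thesis using awalk_iff_relpow by blast
qed

lemma diameter_le_iff:
  "diameter (with_proj G) \<le> ereal (real m) \<longleftrightarrow>
     (\<forall>x\<in>pverts G. \<forall>y\<in>pverts G. \<exists>k\<le>m. (x, y) \<in> parcs G ^^ k)"
proof -
  have "diameter (with_proj G) \<le> ereal (real m) \<longleftrightarrow>
      (\<forall>x\<in>pverts G. \<forall>y\<in>pverts G. gdist (with_proj G) x y \<le> ereal (real m))"
    unfolding diameter_def by (auto simp: SUP_le_iff)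
  also have "\<dots> \<longleftrightarrow> (\<forall>x\<in>pverts G. \<forall>y\<in>pverts G. \<exists>k\<le>m. (x, y) \<in> parcs G ^^ k)"
  proof (intro ball_cong refl)
    fix x y assume "x \<in> pverts G"
    show "gdist (with_proj G) x y \<le> ereal (real m) \<longleftrightarrow> (\<exists>k\<le>m. (x, y) \<in> parcs G ^^ k)"
    proof
      assume "\<exists>k\<le>m. (x, y) \<in> parcs G ^^ k"
      then obtain k where "k \<le> m" "(x, y) \<in> parcs G ^^ k" by blast
      then show "gdist (with_proj G) x y \<le> ereal (real m)"
        using gdist_le[OF \<open>x \<in> pverts G\<close>, of y k] by (meson ereal_less_eq(3) of_nat_mono order_trans)
    qed (rule gdist_leD)
  qed
  finally show ?thesis .
qed

end

text \<open>A certificate for lower bounds on distances. The values are integers so that a potential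
  may also be used with its sign reversed.\<close>

lemma relpow_potential:
  fixes \<phi> :: "'a \<Rightarrow> int"
  assumes "(x, y) \<in> R ^^ k" and "\<And>a b. (a, b) \<in> R \<Longrightarrow> \<phi> b \<le> \<phi> a + 1"
  shows "\<phi> y \<le> \<phi> x + int k"
  using assms(1)
proof (induction k arbitrary: y)
  case (Suc k)
  then obtain z where "(x, z) \<in> R ^^ k" "(z, y) \<in> R" by auto
  then show ?case using Suc.IH[of z] assms(2)[of z y] by simp
qed simp

lemma relpow_path:
  assumes "\<And>l. i \<le> l \<Longrightarrow> l < j \<Longrightarrow> (f l, f (Suc l)) \<in> R" and "i \<le> j"
  shows "(f i, f j) \<in> R ^^ (j - i)"
  using assms(2,1)
proof (induction j rule: dec_induct)
  case (step j)
  then have "(f i, f j) \<in> R ^^ (j - i)" "(f j, f (Suc j)) \<in> R" by auto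
  then show ?case using step.hyps by (auto simp: Suc_diff_le)
qed simp

lemma relpow_trans: "(x, y) \<in> R ^^ j \<Longrightarrow> (y, z) \<in> R ^^ k \<Longrightarrow> (x, z) \<in> R ^^ (j + k)"
  by (auto simp: relpow_add)

lemma relpow_sym: "sym R \<Longrightarrow> (x, y) \<in> R ^^ k \<Longrightarrow> (y, x) \<in> R ^^ k"
proof (induction k arbitrary: y)
  case (Suc k)
  then obtain z where "(x, z) \<in> R ^^ k" "(z, y) \<in> R" by auto
  then show ?case using Suc.IH[OF Suc.prems(1)] Suc.prems(1) by (meson relpow_Suc_I2 symD)
qed simp

section \<open>Path graphs and centipedes through list indices\<close>

lemma set_vwalk_arcs: "set (vwalk_arcs ps) = {(ps ! i, ps ! Suc i) | i. Suc i < length ps}"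
proof (induction ps rule: vwalk_arcs.induct)
  case (3 x y xs)
  have "{((x # y # xs) ! i, (x # y # xs) ! Suc i) | i. Suc i < length (x # y # xs)} =
      insert (x, y) {((y # xs) ! i, (y # xs) ! Suc i) | i. Suc i < length (y # xs)}"
    (is "?A = insert _ ?B")
  proof
    show "?A \<subseteq> insert (x, y) ?B"
    proof
      fix e assume "e \<in> ?A"
      then obtain i where "e = ((x # y # xs) ! i, (x # y # xs) ! Suc i)" "Suc i < length (x # y # xs)"
        by blast
      then show "e \<in> insert (x, y) ?B" by (cases i) auto
    qed
    show "insert (x, y) ?B \<subseteq> ?A" by force
  qed
  then show ?case using 3 by simp
qed auto

lemma path_graph_arc_iff:
  assumes "distinct ps" and "i < length ps" and "j < length ps"
  shows "(ps ! i, ps ! j) \<in> parcs (path_graph ps) \<longleftrightarrow> j = i + 1 \<or> i = j + 1"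
  using assms nth_eq_iff_index_eq[OF assms(1)] by (auto simp: path_graph_def set_vwalk_arcs)

lemma path_graph_verts [simp]: "pverts (path_graph ps) = set ps"
  by (simp add: path_graph_def)

lemma path_graph_arcsE:
  assumes "(x, y) \<in> parcs (path_graph ps)"
  obtains i j where "i < length ps" "j < length ps" "x = ps ! i" "y = ps ! j" "j = i + 1 \<or> i = j + 1"
proof -
  obtain i where "Suc i < length ps" "x = ps ! i \<and> y = ps ! Suc i \<or> y = ps ! i \<and> x = ps ! Suc i"
    using assms by (auto simp: path_graph_def set_vwalk_arcs)
  then show thesis using that[of i "Suc i"] that[of "Suc i" i] by auto
qed

lemma pair_graph_path_graph:
  assumes "distinct ps"
  shows "pair_graph (path_graph ps)"
proof
  fix e assume e: "e \<in> parcs (path_graph ps)"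
  obtain x y where xy: "e = (x, y)" by (cases e)
  with e have "(x, y) \<in> parcs (path_graph ps)" by simp
  then obtain i j where "i < length ps" "j < length ps" "x = ps ! i" "y = ps ! j" "j = i + 1 \<or> i = j + 1"
    by (rule path_graph_arcsE)
  then show "fst e \<in> pverts (path_graph ps)" "snd e \<in> pverts (path_graph ps)" "fst e \<noteq> snd e"
    using xy nth_eq_iff_index_eq[OF assms, of i j] by auto
next
  show "finite (pverts (path_graph ps))" by simp
  show "finite (parcs (path_graph ps))" by (simp add: path_graph_def)
  show "symmetric (with_proj (path_graph ps))"
    by (auto simp: symmetric_def path_graph_def sym_def)
qed

lemma deg_card: "deg (with_proj G) x = card {y. (x, y) \<in> parcs G}"
proof -
  have "out_arcs (with_proj G) x = Pair x ` {y. (x, y) \<in> parcs G}"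
    by (auto simp: out_arcs_def)
  then show ?thesis by (simp add: out_degree_def card_image inj_on_def)
qed

lemma path_graph_deg:
  assumes "distinct ps" and "2 \<le> length ps" and "i < length ps"
  shows "deg (path_graph ps) (ps ! i) = (if i = 0 \<or> i = length ps - 1 then 1 else 2)"
proof -
  let ?J = "{j. j < length ps \<and> (j = i + 1 \<or> i = j + 1)}"
  have "{y. (ps ! i, y) \<in> parcs (path_graph ps)} = (!) ps ` ?J"
  proof (intro equalityI subsetI)
    fix y assume "y \<in> {y. (ps ! i, y) \<in> parcs (path_graph ps)}"
    then have y: "(ps ! i, y) \<in> parcs (path_graph ps)" by simp
    then obtain j where "j < length ps" "y = ps ! j" by (rule path_graph_arcsE)
    then show "y \<in> (!) ps ` ?J" using y path_graph_arc_iff[OF assms(1,3)] by auto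
  qed (use path_graph_arc_iff[OF assms(1,3)] in auto)
  moreover have "inj_on ((!) ps) ?J" using assms(1) by (auto simp: inj_on_def nth_eq_iff_index_eq)
  ultimately have "deg (path_graph ps) (ps ! i) = card ?J" by (simp add: deg_card card_image)
  also have "?J = (if i = 0 then {} else {i - 1}) \<union> (if i = length ps - 1 then {} else {i + 1})"
    using assms by auto
  also have "card \<dots> = (if i = 0 \<or> i = length ps - 1 then 1 else 2)"
    using assms by (subst card_Un_disjoint) auto
  finally show ?thesis .
qed

lemma induced_path_graph_iff:
  assumes "pair_graph H" and "distinct ps"
  shows "induced_subgraph (path_graph ps) H \<longleftrightarrow> set ps \<subseteq> pverts H \<and>
    (\<forall>i<length ps. \<forall>j<length ps. (ps ! i, ps ! j) \<in> parcs H \<longleftrightarrow> j = i + 1 \<or> i = j + 1)"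
proof -
  interpret H: pair_graph H by fact
  interpret P: pair_graph "path_graph ps" using pair_graph_path_graph assms(2) .
  have "induced_subgraph (path_graph ps) H \<longleftrightarrow> set ps \<subseteq> pverts H \<and>
      parcs (path_graph ps) = {e \<in> parcs H. fst e \<in> set ps \<and> snd e \<in> set ps}"
    using H.wf_digraph P.wf_digraph
    by (auto simp: induced_subgraph_def subgraph_def compatible_def)
  also have "parcs (path_graph ps) = {e \<in> parcs H. fst e \<in> set ps \<and> snd e \<in> set ps} \<longleftrightarrow>
      (\<forall>x\<in>set ps. \<forall>y\<in>set ps. (x, y) \<in> parcs (path_graph ps) \<longleftrightarrow> (x, y) \<in> parcs H)"
  proof -
    have "parcs (path_graph ps) \<subseteq> set ps \<times> set ps" using P.wellformed' by auto
    then show ?thesis by auto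
  qed
  also have "\<dots> \<longleftrightarrow>
      (\<forall>i<length ps. \<forall>j<length ps. (ps ! i, ps ! j) \<in> parcs H \<longleftrightarrow> j = i + 1 \<or> i = j + 1)"
    unfolding all_set_conv_all_nth
    by (intro all_cong1 imp_cong refl) (auto simp: path_graph_arc_iff[OF assms(2)])
  finally show ?thesis .
qed

lemma with_proj_eq_iff: "with_proj G = with_proj H \<longleftrightarrow> pverts G = pverts H \<and> parcs G = parcs H"
  by (auto simp: with_proj_def)

text \<open>The sole neighbours of the vertices off the path, together with inducedness, determine
  all arcs. A path with at least two vertices has degree 1 exactly at its ends, so the degree
  condition on feet of legs says that they are interior.\<close>

lemma centipede_iff:
  assumes "pair_graph H" and len: "2 \<le> length ps"
  shows "centipede (with_proj H) ps \<longleftrightarrow> distinct ps \<and> induced_subgraph (path_graph ps) H \<and>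
    (\<forall>x\<in>pverts H - set ps. \<exists>i. 0 < i \<and> i + 1 < length ps \<and> {y. (x, y) \<in> parcs H} = {ps ! i})"
    (is "?L \<longleftrightarrow> ?R")
proof
  interpret H: pair_graph H by fact
  assume ?L
  then obtain L f where d: "distinct ps" and L: "finite L" "L \<inter> set ps = {}"
    and f: "\<And>x. x \<in> L \<Longrightarrow> f x \<in> set ps \<and> deg (path_graph ps) (f x) \<noteq> 1"
    and eq: "pverts H = set ps \<union> L"
      "parcs H = parcs (path_graph ps) \<union> (\<lambda>x. (x, f x)) ` L \<union> (\<lambda>x. (f x, x)) ` L"
    unfolding centipede_def with_proj_eq_iff by auto
  have sub: "x \<in> set ps \<and> y \<in> set ps" if "(x, y) \<in> parcs (path_graph ps)" for x y
    using path_graph_arcsE[OF that] by (metis nth_mem)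
  have "induced_subgraph (path_graph ps) H"
    unfolding induced_path_graph_iff[OF assms(1) d]
  proof (intro conjI allI impI)
    show "set ps \<subseteq> pverts H" using eq by simp
    fix i j assume ij: "i < length ps" "j < length ps"
    then have "ps ! i \<in> set ps" "ps ! j \<in> set ps" by simp_all
    then have "ps ! i \<notin> L" "ps ! j \<notin> L" using L by auto
    then have "(ps ! i, ps ! j) \<in> parcs H \<longleftrightarrow> (ps ! i, ps ! j) \<in> parcs (path_graph ps)"
      using eq by auto
    then show "(ps ! i, ps ! j) \<in> parcs H \<longleftrightarrow> j = i + 1 \<or> i = j + 1"
      using path_graph_arc_iff[OF d ij] by simp
  qed
  moreover have "\<exists>i. 0 < i \<and> i + 1 < length ps \<and> {y. (x, y) \<in> parcs H} = {ps ! i}"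
    if x: "x \<in> pverts H - set ps" for x
  proof -
    have xL: "x \<in> L" "x \<notin> set ps" using x eq by auto
    have "{y. (x, y) \<in> parcs H} = {f x}"
      using xL eq f sub by (auto 0 3)
    moreover obtain i where i: "i < length ps" "f x = ps ! i"
      using f[OF xL(1)] by (metis in_set_conv_nth)
    moreover have "i \<noteq> 0" "i \<noteq> length ps - 1"
      using f[OF xL(1)] path_graph_deg[OF d len i(1)] i(2) by (auto split: if_splits)
    ultimately show ?thesis using i by (intro exI[of _ i]) auto
  qed
  ultimately show ?R using d by blast
next
  interpret H: pair_graph H by fact
  assume R: ?R
  then have d: "distinct ps" and ind: "induced_subgraph (path_graph ps) H"
    and legs: "\<And>x. x \<in> pverts H - set ps \<Longrightarrow>
      \<exists>i. 0 < i \<and> i + 1 < length ps \<and> {y. (x, y) \<in> parcs H} = {ps ! i}"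
    by blast+
  define L where "L = pverts H - set ps"
  have "\<forall>x\<in>L. \<exists>i. 0 < i \<and> i + 1 < length ps \<and> {y. (x, y) \<in> parcs H} = {ps ! i}"
    using legs by (simp add: L_def)
  then obtain g where g: "\<And>x. x \<in> L \<Longrightarrow> 0 < g x \<and> g x + 1 < length ps \<and>
      {y. (x, y) \<in> parcs H} = {ps ! g x}"
    by (auto dest!: bchoice)
  define f where "f x = ps ! g x" for x
  have sub: "set ps \<subseteq> pverts H" using ind assms(1) d induced_path_graph_iff by blast
  have pp: "parcs (path_graph ps) = {e \<in> parcs H. fst e \<in> set ps \<and> snd e \<in> set ps}"
    using ind by (simp add: induced_subgraph_def)
  have arc: "(x, y) \<in> parcs H \<longleftrightarrow> y = f x" if "x \<in> L" for x y
    using g[OF that] by (auto simp: f_def)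
  have fL: "f x \<notin> L \<and> f x \<in> set ps" if "x \<in> L" for x
    using g[OF that] by (simp add: f_def L_def)
  have "parcs H = parcs (path_graph ps) \<union> (\<lambda>x. (x, f x)) ` L \<union> (\<lambda>x. (f x, x)) ` L"
  proof (intro equalityI subrelI)
    fix x y assume xy: "(x, y) \<in> parcs H"
    then have yx: "(y, x) \<in> parcs H" by (rule H.arcs_symmetric)
    have V: "x \<in> pverts H" "y \<in> pverts H" using xy H.wellformed' by auto
    consider "x \<in> L" | "y \<in> L" | "x \<in> set ps" "y \<in> set ps" using V by (auto simp: L_def)
    then show "(x, y) \<in> parcs (path_graph ps) \<union> (\<lambda>x. (x, f x)) ` L \<union> (\<lambda>x. (f x, x)) ` L"
      by cases (use arc xy yx pp in auto)
  next
    fix x y assume "(x, y) \<in> parcs (path_graph ps) \<union> (\<lambda>x. (x, f x)) ` L \<union> (\<lambda>x. (f x, x)) ` L"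
    then consider "(x, y) \<in> parcs (path_graph ps)" | "x \<in> L" "y = f x" | "y \<in> L" "x = f y" by blast
    then show "(x, y) \<in> parcs H"
    proof cases
      case 1 then show ?thesis using pp by blast
    next
      case 2 then show ?thesis using arc by blast
    next
      case 3 then show ?thesis using arc H.arcs_symmetric by blast
    qed
  qed
  moreover have "pverts H = set ps \<union> L" using sub unfolding L_def by blast
  moreover have "\<forall>x\<in>L. f x \<in> set ps \<and> deg (path_graph ps) (f x) \<noteq> 1"
  proof
    fix x assume "x \<in> L"
    then show "f x \<in> set ps \<and> deg (path_graph ps) (f x) \<noteq> 1"
      using g[of x] fL[of x] path_graph_deg[OF d len, of "g x"] by (auto simp: f_def)
  qed
  moreover have "finite L" using H.pair_finite_verts by (simp add: L_def)
  moreover have "L \<inter> set ps = {}" unfolding L_def by blast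
  moreover have "ps \<noteq> []" using len by auto
  ultimately show ?L
    unfolding centipede_def with_proj_eq_iff pair_pre_digraph.simps using d by blast
qed

text \<open>Project each vertex to its position on the path, a leg to its foot. The projection moves
  by at most one along an arc, so the ends are at distance at least \<open>length ps - 1\<close>.
  Conversely a leg costs one extra step, but its interior foot saves at least one, so no distance is
  larger.\<close>

lemma centipede_imp_diametrical_path:
  assumes "pair_graph H" and cp: "centipede (with_proj H) ps" and len: "3 \<le> length ps"
  shows "diametrical_path (with_proj H) ps"
proof -
  interpret H: pair_graph H by fact
  let ?m = "length ps" and ?R = "parcs H"
  have d: "distinct ps" and ind: "induced_subgraph (path_graph ps) H"
    and legs: "\<And>x. x \<in> pverts H - set ps \<Longrightarrow>
      \<exists>i. 0 < i \<and> i + 1 < ?m \<and> {y. (x, y) \<in> ?R} = {ps ! i}"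
    using cp centipede_iff[OF assms(1), of ps] len by auto
  have sub: "set ps \<subseteq> pverts H"
    and arcs: "\<And>i j. i < ?m \<Longrightarrow> j < ?m \<Longrightarrow> (ps ! i, ps ! j) \<in> ?R \<longleftrightarrow> j = i + 1 \<or> i = j + 1"
    using ind induced_path_graph_iff[OF assms(1) d] by auto
  have symR: "sym ?R" using H.arcs_symmetric by (auto simp: sym_def)
  define anchored where "anchored x i \<longleftrightarrow> x = ps ! i \<and> i < ?m \<or>
    x \<in> pverts H - set ps \<and> 0 < i \<and> i + 1 < ?m \<and> {y. (x, y) \<in> ?R} = {ps ! i}" for x i
  have ex_anchored: "\<exists>i. anchored x i" if "x \<in> pverts H" for x
    using that legs[of x] unfolding anchored_def by (cases "x \<in> set ps") (auto simp: in_set_conv_nth)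
  define \<pi> where "\<pi> x = (SOME i. anchored x i)" for x
  have \<pi>: "anchored x (\<pi> x)" if "x \<in> pverts H" for x
    unfolding \<pi>_def by (rule someI_ex[OF ex_anchored[OF that]])
  have \<pi>_nth: "\<pi> (ps ! i) = i" if "i < ?m" for i
  proof -
    have i: "ps ! i \<in> set ps" "ps ! i \<in> pverts H" using that sub by auto
    then have "ps ! i = ps ! \<pi> (ps ! i)" "\<pi> (ps ! i) < ?m"
      using \<pi>[OF i(2)] unfolding anchored_def by blast+
    then show ?thesis using nth_eq_iff_index_eq[OF d, of i "\<pi> (ps ! i)"] that by simp
  qed
  define o' where "o' x = (if x \<in> set ps then 0 else 1 :: nat)" for x
  have walk: "(ps ! i, ps ! j) \<in> ?R ^^ (j - i)" if "i \<le> j" "j < ?m" for i j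
    by (rule relpow_path[of i j "(!) ps"]) (use that arcs in auto)
  have walk': "(ps ! i, ps ! j) \<in> ?R ^^ ((j - i) + (i - j))" if "i < ?m" "j < ?m" for i j
    using walk[of i j] walk[of j i] relpow_sym[OF symR] that by (cases "i \<le> j") auto
  have step: "(x, ps ! \<pi> x) \<in> ?R ^^ o' x \<and> \<pi> x < ?m \<and> (o' x = 1 \<longrightarrow> 0 < \<pi> x \<and> \<pi> x + 1 < ?m)"
    if "x \<in> pverts H" for x
  proof (cases "x \<in> set ps")
    case True
    then have "x = ps ! \<pi> x" "\<pi> x < ?m" using \<pi>[OF that] unfolding anchored_def by blast+
    then show ?thesis using True by (simp add: o'_def)
  next
    case False
    then have "0 < \<pi> x \<and> \<pi> x + 1 < ?m \<and> {y. (x, y) \<in> ?R} = {ps ! \<pi> x}"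
      using \<pi>[OF that] nth_mem[of "\<pi> x" ps] unfolding anchored_def by metis
    then show ?thesis using False by (auto simp: o'_def)
  qed
  have diam: "\<forall>x\<in>pverts H. \<forall>y\<in>pverts H. \<exists>k\<le>?m - 1. (x, y) \<in> ?R ^^ k"
  proof (intro ballI)
    fix x y assume xy: "x \<in> pverts H" "y \<in> pverts H"
    let ?k = "(\<pi> y - \<pi> x) + (\<pi> x - \<pi> y)"
    have "(x, ps ! \<pi> y) \<in> ?R ^^ (o' x + ?k)"
      using step[OF xy(1)] step[OF xy(2)] by (intro relpow_trans[OF _ walk']) auto
    then have "(x, y) \<in> ?R ^^ (o' x + ?k + o' y)"
      by (rule relpow_trans) (use step[OF xy(2)] relpow_sym[OF symR] in blast)
    \<comment> \<open>Two legs with the same foot are at distance 2; this is where at least three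
      path vertices are used.\<close>
    moreover have "o' x + ?k + o' y \<le> ?m - 1"
      using step[OF xy(1)] step[OF xy(2)] len by (auto simp: o'_def)
    ultimately show "\<exists>k\<le>?m - 1. (x, y) \<in> ?R ^^ k" by blast
  qed
  have ne: "ps \<noteq> []" using len by auto
  have hl: "hd ps = ps ! 0" "last ps = ps ! (?m - 1)" "hd ps \<in> pverts H" "last ps \<in> pverts H"
    using ne sub hd_in_set[OF ne] last_in_set[OF ne] by (auto simp: hd_conv_nth last_conv_nth)
  have "?m - 1 \<le> k" if k: "(hd ps, last ps) \<in> ?R ^^ k" for k
  proof -
    have "int (\<pi> (last ps)) \<le> int (\<pi> (hd ps)) + int k"
    proof (rule relpow_potential[OF k])
      fix a b assume ab: "(a, b) \<in> ?R"
      then have ba: "(b, a) \<in> ?R" by (rule H.arcs_symmetric)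
      have "a \<in> pverts H" "b \<in> pverts H" using ab H.wellformed' by auto
      then have at: "anchored a (\<pi> a)" "anchored b (\<pi> b)" using \<pi> by auto
      show "int (\<pi> b) \<le> int (\<pi> a) + 1"
      proof (cases "a \<in> set ps \<and> b \<in> set ps")
        case True
        then have "a = ps ! \<pi> a" "\<pi> a < ?m" "b = ps ! \<pi> b" "\<pi> b < ?m"
          using at unfolding anchored_def by blast+
        then have "\<pi> b = \<pi> a + 1 \<or> \<pi> a = \<pi> b + 1" using arcs ab by metis
        then show ?thesis by auto
      next
        case False
        then consider "a \<notin> set ps" | "b \<notin> set ps" by blast
        then have "\<pi> b = \<pi> a"
        proof cases
          case 1
          then have "{y. (a, y) \<in> ?R} = {ps ! \<pi> a}" "\<pi> a < ?m"
            using at(1) nth_mem[of "\<pi> a" ps] unfolding anchored_def by (metis, metis add_lessD1)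
          moreover from this have "b = ps ! \<pi> a" using ab by blast
          ultimately show ?thesis using \<pi>_nth by simp
        next
          case 2
          then have "{y. (b, y) \<in> ?R} = {ps ! \<pi> b}" "\<pi> b < ?m"
            using at(2) nth_mem[of "\<pi> b" ps] unfolding anchored_def by (metis, metis add_lessD1)
          moreover from this have "a = ps ! \<pi> b" using ba by blast
          ultimately show ?thesis using \<pi>_nth by simp
        qed
        then show ?thesis by simp
      qed
    qed
    moreover have "\<pi> (hd ps) = 0" "\<pi> (last ps) = ?m - 1"
      unfolding hl using len by (intro \<pi>_nth; linarith)+
    ultimately show ?thesis by simp
  qed
  then have ge: "ereal (real (?m - 1)) \<le> gdist (with_proj H) (hd ps) (last ps)"
    by (rule H.gdist_ge)
  have le: "diameter (with_proj H) \<le> ereal (real (?m - 1))"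
    using H.diameter_le_iff diam by blast
  have "gdist (with_proj H) (hd ps) (last ps) \<le> diameter (with_proj H)"
    unfolding diameter_def using hl by (intro SUP_upper2[of "(hd ps, last ps)"]) auto
  with ge le have "diameter (with_proj H) = ereal (real (?m - 1))"
    and "gdist (with_proj H) (hd ps) (last ps) = ereal (real (?m - 1))" by auto
  then show ?thesis using d ind ne by (simp add: diametrical_path_def)
qed

section \<open>Unicyclic graphs with a diametrical path\<close>

lemma set_closed_vwalk_arcs:
  assumes "cs \<noteq> []"
  shows "set (vwalk_arcs (cs @ [hd cs])) =
    {(cs ! i, cs ! (Suc i mod length cs)) | i. i < length cs}"
proof -
  have "(cs @ [hd cs]) ! Suc i = cs ! (Suc i mod length cs)" if "i < length cs" for i
    using that assms by (cases "Suc i = length cs") (auto simp: nth_append hd_conv_nth)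
  then have "((cs @ [hd cs]) ! i, (cs @ [hd cs]) ! Suc i) = (cs ! i, cs ! (Suc i mod length cs))"
    if "i < length cs" for i
    using that by (simp add: nth_append)
  then show ?thesis unfolding set_vwalk_arcs by (auto; metis)
qed

lemma is_cycle_card: "is_cycle k C \<Longrightarrow> card (pverts C) = k"
  by (auto simp: is_cycle_def cycle_graph_def distinct_card)

text \<open>Successor and predecessor in cyclic order differ because the cycle has at least three
  vertices.\<close>

lemma is_cycle_two_nbrs:
  assumes "is_cycle k C" and "x \<in> pverts C"
  obtains y z where "y \<noteq> z" "(x, y) \<in> parcs C" "(x, z) \<in> parcs C"
proof -
  obtain cs where cs: "k \<ge> 3" "distinct cs" "length cs = k" "C = cycle_graph cs"
    using assms(1) by (auto simp: is_cycle_def)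
  then have ne: "cs \<noteq> []" by auto
  obtain i where i: "i < k" "x = cs ! i" using assms(2) cs by (auto simp: cycle_graph_def in_set_conv_nth)
  have arc: "(cs ! j, cs ! (Suc j mod k)) \<in> parcs C" "(cs ! (Suc j mod k), cs ! j) \<in> parcs C"
    if "j < k" for j
    using that cs set_closed_vwalk_arcs[OF ne] by (auto simp: cycle_graph_def)
  define j where "j = (if i = 0 then k - 1 else i - 1)"
  have j: "j < k" "Suc j mod k = i" using i cs(1) by (auto simp: j_def)
  have "Suc i mod k < k" "Suc i mod k \<noteq> j"
    using i cs(1) by (auto simp: j_def mod_Suc split: if_splits)
  then have "cs ! (Suc i mod k) \<noteq> cs ! j" using j cs by (simp add: nth_eq_iff_index_eq)
  moreover have "(x, cs ! (Suc i mod k)) \<in> parcs C" using arc(1)[OF i(1)] i(2) by simp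
  moreover have "(x, cs ! j) \<in> parcs C" using arc(2)[OF j(1)] i(2) j(2) by simp
  ultimately show thesis by (rule that)
qed

lemma (in pair_graph) subgraph_cycle_graph:
  assumes "distinct cs" and "3 \<le> length cs" and "(last cs, hd cs) \<in> parcs G"
    and arcs: "\<And>i. Suc i < length cs \<Longrightarrow> (cs ! i, cs ! Suc i) \<in> parcs G"
  shows "subgraph (cycle_graph cs) G" and "is_cycle (length cs) (cycle_graph cs)"
proof -
  have ne: "cs \<noteq> []" using assms by auto
  have closed: "(cs ! i, cs ! (Suc i mod length cs)) \<in> parcs G" if i: "i < length cs" for i
  proof (cases "Suc i = length cs")
    case True
    then have "last cs = cs ! i" using ne by (simp add: last_conv_nth flip: True)
    then show ?thesis using True assms(3) ne by (simp add: hd_conv_nth)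
  next
    case False
    then show ?thesis using i arcs[of i] by simp
  qed
  have sub: "parcs (cycle_graph cs) \<subseteq> parcs G"
  proof
    fix e assume "e \<in> parcs (cycle_graph cs)"
    then obtain i where "i < length cs"
      "e = (cs ! i, cs ! (Suc i mod length cs)) \<or> e = (cs ! (Suc i mod length cs), cs ! i)"
      using set_closed_vwalk_arcs[OF ne] by (auto simp: cycle_graph_def)
    then show "e \<in> parcs G" using closed arcs_symmetric by blast
  qed
  have V: "set cs \<subseteq> pverts G"
  proof
    fix x assume "x \<in> set cs"
    then obtain i where i: "i < length cs" "x = cs ! i" by (auto simp: in_set_conv_nth)
    then show "x \<in> pverts G" using in_arcsD1[OF closed[OF i(1)]] by simp
  qed
  have W: "x \<in> set cs \<and> y \<in> set cs" if "(x, y) \<in> parcs (cycle_graph cs)" for x y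
    using that set_closed_vwalk_arcs[OF ne] ne by (auto simp: cycle_graph_def)
  have "wf_digraph (with_proj (cycle_graph cs))"
  proof
    fix e assume "e \<in> arcs (with_proj (cycle_graph cs))"
    then have "fst e \<in> set cs \<and> snd e \<in> set cs" using W[of "fst e" "snd e"] by simp
    then show "tail (with_proj (cycle_graph cs)) e \<in> verts (with_proj (cycle_graph cs))"
      "head (with_proj (cycle_graph cs)) e \<in> verts (with_proj (cycle_graph cs))"
      by (simp_all add: cycle_graph_def)
  qed
  then show "subgraph (cycle_graph cs) G"
    using sub V wf_digraph by (simp add: subgraph_def compatible_def) (simp add: cycle_graph_def)
  show "is_cycle (length cs) (cycle_graph cs)"
    using assms by (auto simp: is_cycle_def)
qed

text \<open>The metric content of a diametrical path, in relation powers: \<open>diam\<close> bounds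
  every distance by \<open>n - 1\<close>, and \<open>geodesic\<close> says that the ends of the path
  attain this bound.\<close>

locale unicyclic_path = even_path U v n for U :: "'a pair_pre_digraph" and v n +
  fixes C :: "'a pair_pre_digraph" and k :: nat
  assumes n6: "6 \<le> n"
    and cycle_C: "is_cycle k C" and sub_C: "subgraph C U"
    and cycle_unique: "is_cycle m D \<Longrightarrow> subgraph D U \<Longrightarrow> D = C"
    and diam: "x \<in> pverts U \<Longrightarrow> y \<in> pverts U \<Longrightarrow> \<exists>m\<le>n - 1. (x, y) \<in> parcs U ^^ m"
    and geodesic: "(v 1, v n) \<in> parcs U ^^ m \<Longrightarrow> n - 1 \<le> m"
begin

lemma sym_parcs: "sym (parcs U)"
  using arcs_symmetric by (auto simp: sym_def)

lemma path_walk: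
  assumes "1 \<le> i" and "i \<le> j" and "j \<le> n"
  shows "(v i, v j) \<in> parcs U ^^ (j - i)"
  by (rule relpow_path) (use assms v_arcs in auto)

text \<open>A shortcut between \<open>v i\<close> and \<open>v j\<close>, continued along the path
  on both sides, would join the ends in fewer than \<open>n - 1\<close> steps.\<close>

lemma path_geodesic:
  assumes "(v i, v j) \<in> parcs U ^^ m" and "i \<in> {1..n}" and "j \<in> {1..n}"
  shows "j \<le> i + m"
proof -
  have "(v 1, v n) \<in> parcs U ^^ ((i - 1) + m + (n - j))"
    by (intro relpow_trans[OF relpow_trans[OF _ assms(1)]] path_walk) (use assms in auto)
  from geodesic[OF this] show ?thesis using assms by auto
qed

text \<open>Uniqueness of the cycle enters here: any cycle that can be listed explicitly reveals the
  vertex set of \<open>C\<close> and the value of \<open>k\<close>.\<close>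

lemma cycle_eqI:
  assumes "distinct cs" and "3 \<le> length cs" and "(last cs, hd cs) \<in> parcs U"
    and "\<And>i. Suc i < length cs \<Longrightarrow> (cs ! i, cs ! Suc i) \<in> parcs U"
  shows "pverts C = set cs" and "k = length cs"
proof -
  have "cycle_graph cs = C"
    using cycle_unique subgraph_cycle_graph[OF assms] by blast
  then show "pverts C = set cs" by (auto simp: cycle_graph_def)
  then show "k = length cs" using is_cycle_card[OF cycle_C] assms(1) by (simp add: distinct_card)
qed

lemma C_sub: "pverts C \<subseteq> pverts U" "parcs C \<subseteq> parcs U"
  using sub_C by (auto simp: subgraph_def)

text \<open>The two arcs at \<open>x\<close> close the stretch of the path between them to a cycle.
  They also form a detour of length 2, which the geodesic does not allow to skip more than two
  steps.\<close>

lemma two_nbrs_cycle: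
  assumes x: "x \<in> outer" and ij: "i \<in> nbrs x" "j \<in> nbrs x" "i < j"
  shows "pverts C = insert x (v ` {i..j})" and "k = j - i + 2" and "j - i \<le> 2"
proof -
  have ij': "i \<in> {1..n}" "j \<in> {1..n}" using ij nbrsD by auto
  let ?cs = "x # map v [i..<j + 1]"
  have len: "length ?cs = j - i + 2" using ij by simp
  have set: "set ?cs = insert x (v ` {i..j})" by (auto simp: less_Suc_eq_le)
  have "inj_on v (set [i..<j + 1])" by (rule inj_on_subset[OF v_inj]) (use ij' in auto)
  then have "distinct (map v [i..<j + 1])" by (simp only: distinct_map distinct_upt simp_thms)
  moreover have vs: "set (map v [i..<j + 1]) = v ` {i..j}" by (auto simp: less_Suc_eq_le)
  moreover have "x \<notin> v ` {i..j}" using x ij' by (auto simp: outer_def)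
  ultimately have d: "distinct ?cs" by (simp del: upt_Suc set_map)
  have l: "last ?cs = v j" "hd ?cs = x" using ij by auto
  have arcs: "(?cs ! l, ?cs ! Suc l) \<in> parcs U" if "Suc l < length ?cs" for l
  proof (cases l)
    case 0
    then show ?thesis using nbrsD[OF ij(1)] ij by (auto simp del: upt_Suc)
  next
    case (Suc l')
    then show ?thesis using that ij ij' v_arcs by (auto simp del: upt_Suc)
  qed
  have "(last ?cs, hd ?cs) \<in> parcs U" unfolding l using nbrsD[OF ij(2)] by blast
  note eq = cycle_eqI[OF d _ this arcs]
  show "pverts C = insert x (v ` {i..j})" using eq(1) len ij set by simp
  show "k = j - i + 2" using eq(2) len ij by simp
  have "(v i, v j) \<in> parcs U ^^ (1 + 1)"
    using nbrsD[OF ij(1)] nbrsD[OF ij(2)] by (intro relpow_trans[of _ x]) auto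
  from path_geodesic[OF this ij'] show "j - i \<le> 2" by simp
qed

text \<open>As in \<open>two_nbrs_cycle\<close>, with a detour of length 3. Here the two positions
  may coincide.\<close>

lemma outer_arc_cycle:
  assumes xy: "x \<in> outer" "y \<in> outer" "(x, y) \<in> parcs U"
    and ij: "i \<in> nbrs x" "j \<in> nbrs y" "i \<le> j"
  shows "pverts C = {x, y} \<union> v ` {i..j}" and "k = j - i + 3" and "j - i \<le> 3"
proof -
  have ij': "i \<in> {1..n}" "j \<in> {1..n}" using ij nbrsD by auto
  let ?cs = "x # map v [i..<j + 1] @ [y]"
  have len: "length ?cs = j - i + 3" using ij by simp
  have set: "set ?cs = {x, y} \<union> v ` {i..j}" by (auto simp: less_Suc_eq_le)
  have "inj_on v (set [i..<j + 1])" by (rule inj_on_subset[OF v_inj]) (use ij' in auto)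
  then have "distinct (map v [i..<j + 1])" by (simp only: distinct_map distinct_upt simp_thms)
  moreover have "x \<noteq> y" using xy no_loops' by blast
  moreover have vs: "set (map v [i..<j + 1]) = v ` {i..j}" by (auto simp: less_Suc_eq_le)
  moreover have "x \<notin> v ` {i..j}" "y \<notin> v ` {i..j}" using xy ij' by (auto simp: outer_def)
  ultimately have d: "distinct ?cs" by (simp del: upt_Suc set_map)
  have l: "last ?cs = y" "hd ?cs = x" by auto
  have arcs: "(?cs ! l, ?cs ! Suc l) \<in> parcs U" if "Suc l < length ?cs" for l
  proof (cases l)
    case 0
    then show ?thesis using nbrsD[OF ij(1)] ij by (auto simp: nth_append simp del: upt_Suc)
  next
    case (Suc l')
    show ?thesis
    proof (cases "l' = j - i")
      case True
      then show ?thesis using nbrsD[OF ij(2)] ij Suc by (auto simp: nth_append simp del: upt_Suc)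
    next
      case False
      then show ?thesis using that ij ij' v_arcs Suc by (auto simp: nth_append simp del: upt_Suc)
    qed
  qed
  have "(last ?cs, hd ?cs) \<in> parcs U" unfolding l using xy arcs_symmetric by blast
  note eq = cycle_eqI[OF d _ this arcs]
  show "pverts C = {x, y} \<union> v ` {i..j}" using eq(1) len set by simp
  show "k = j - i + 3" using eq(2) len by simp
  have "(v i, v j) \<in> parcs U ^^ (1 + 1 + 1)"
    using nbrsD[OF ij(1)] nbrsD[OF ij(2)] xy
    by (intro relpow_trans[of _ y] relpow_trans[of _ x]) auto
  from path_geodesic[OF this ij'] show "j - i \<le> 3" by simp
qed

text \<open>In a cycle within the path, the vertex of highest position could only be adjacent to the
  position below it, whereas a cycle vertex has two neighbours.\<close>

lemma cycle_leaves_path: "pverts C \<inter> outer \<noteq> {}"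
proof
  assume "pverts C \<inter> outer = {}"
  then have sub: "pverts C \<subseteq> v ` {1..n}" using C_sub by (auto simp: outer_def)
  let ?M = "{m \<in> {1..n}. v m \<in> pverts C}"
  have "pverts C \<noteq> {}" using is_cycle_card[OF cycle_C] cycle_C by (auto simp: is_cycle_def)
  then have ne: "?M \<noteq> {}" using sub by auto
  define m where "m = Max ?M"
  have m: "m \<in> ?M" "\<And>l. l \<in> ?M \<Longrightarrow> l \<le> m"
    unfolding m_def using Max_in[of ?M] Max_ge[of ?M] ne by auto
  obtain y z where yz: "y \<noteq> z" "(v m, y) \<in> parcs C" "(v m, z) \<in> parcs C"
    using is_cycle_two_nbrs[OF cycle_C, of "v m"] m by blast
  have "x = v (m - 1)" if x: "(v m, x) \<in> parcs C" for x
  proof -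
    have "wf_digraph (with_proj C)" using sub_C by (simp add: subgraph_def)
    then have "x \<in> pverts C" using x wf_digraph.head_in_verts[of "with_proj C" "(v m, x)"] by simp
    then obtain l where "l \<in> {1..n}" "x = v l" using sub by blast
    then have l: "l \<in> ?M" "x = v l" using \<open>x \<in> pverts C\<close> by auto
    then have "l = m + 1 \<or> m = l + 1" using x C_sub v_arcs[of m l] m by auto
    then show ?thesis using l m(2)[OF l(1)] by auto
  qed
  then show False using yz by metis
qed

lemma nbrs_finite: "finite (nbrs x)"
  by (simp add: nbrs_def)

text \<open>An outer vertex with two path neighbours lies on the cycle, and so do the ends of an arc
  between outer vertices. If some \<open>w\<close> has two path neighbours, it is the only cycle
  vertex off the path, and neither phenomenon occurs elsewhere. Otherwise the cycle leaves the path
  at a vertex with a single path neighbour, so one of its two cycle neighbours is outer as well, and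
  these two exhaust the cycle off the path.\<close>

theorem outer_shapes:
  assumes adj: "\<And>x. x \<in> outer \<Longrightarrow> nbrs x \<noteq> {}"
  obtains (one) w i d where "one_outer w i d" "d \<in> {1, 2}" "pverts C = insert w (v ` {i..i + d})"
      "k = d + 2"
    | (two) w u i d where "two_outer w u i d" "d \<le> 3" "pverts C = {w, u} \<union> v ` {i..i + d}"
      "k = d + 3"
proof (cases "\<exists>w\<in>outer. \<nexists>p. nbrs w = {p}")
  case True
  then obtain w where w: "w \<in> outer" "\<And>p. nbrs w \<noteq> {p}" by blast
  define i j where "i = Min (nbrs w)" and "j = Max (nbrs w)"
  have i: "i \<in> nbrs w" "\<And>l. l \<in> nbrs w \<Longrightarrow> i \<le> l"
    unfolding i_def using adj[OF w(1)] nbrs_finite by auto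
  have j: "j \<in> nbrs w" "\<And>l. l \<in> nbrs w \<Longrightarrow> l \<le> j"
    unfolding j_def using adj[OF w(1)] nbrs_finite by auto
  have "i < j"
  proof (rule ccontr)
    assume "\<not> i < j"
    then have "l = i" if "l \<in> nbrs w" for l
      using i(2)[OF that] j(2)[OF that] by linarith
    then have "nbrs w = {i}" using i(1) by blast
    then show False using w(2) by blast
  qed
  note Cw = two_nbrs_cycle[OF w(1) i(1) j(1) this]
  have path: "v l \<notin> outer" if "l \<in> {i..j}" for l
    using that nbrsD[OF i(1)] nbrsD[OF j(1)] by (auto simp: outer_def)
  have C_outer: "pverts C \<inter> outer = {w}" using Cw(1) path w(1) by auto
  \<comment> \<open>A third neighbour between them would close a cycle of smaller length than
    \<open>k\<close>.\<close>
  have "nbrs w = {i, j}"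
  proof (rule ccontr)
    assume "nbrs w \<noteq> {i, j}"
    then obtain l where l: "l \<in> nbrs w" "l \<noteq> i" "l \<noteq> j" using i j by blast
    then have il: "i < l" "l < j" using i(2)[OF l(1)] j(2)[OF l(1)] by auto
    have "k = l - i + 2" by (rule two_nbrs_cycle(2)[OF w(1) i(1) l(1) il(1)])
    then show False using Cw(2) il by simp
  qed
  moreover have "\<exists>p. nbrs x = {p}" if x: "x \<in> outer - {w}" for x
  proof (rule ccontr)
    assume *: "\<nexists>p. nbrs x = {p}"
    obtain l where l: "l \<in> nbrs x" using adj x by blast
    then obtain l' where l': "l' \<in> nbrs x" "l' \<noteq> l" using * by blast
    have "x \<in> pverts C"
      using two_nbrs_cycle(1)[of x l l'] two_nbrs_cycle(1)[of x l' l] x l l' by (cases "l < l'") auto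
    then show False using C_outer x by blast
  qed
  moreover have "(x, y) \<notin> parcs U" if xy: "x \<in> outer" "y \<in> outer" for x y
  proof
    assume a: "(x, y) \<in> parcs U"
    then have a': "(y, x) \<in> parcs U" by (rule arcs_symmetric)
    obtain p q where pq: "p \<in> nbrs x" "q \<in> nbrs y" using adj xy by blast
    have "{x, y} \<subseteq> pverts C"
      using outer_arc_cycle(1)[OF xy a pq] outer_arc_cycle(1)[OF xy(2,1) a' pq(2,1)]
      by (cases "p \<le> q") auto
    then have "x = w" "y = w" using C_outer xy by auto
    then show False using a no_loops' by blast
  qed
  moreover have "i + (j - i) = j" using \<open>i < j\<close> by simp
  ultimately have "one_outer w i (j - i)"
    unfolding one_outer_def using w(1) \<open>i < j\<close> by (metis zero_less_diff)
  moreover have "j - i \<in> {1, 2}" using Cw(3) \<open>i < j\<close> by auto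
  ultimately show thesis using one[of w i "j - i"] Cw \<open>i < j\<close> by simp
next
  case False
  then have single: "\<exists>p. nbrs x = {p}" if "x \<in> outer" for x using that by blast
  obtain w where w: "w \<in> pverts C" "w \<in> outer" using cycle_leaves_path by blast
  obtain y z where yz: "y \<noteq> z" "(w, y) \<in> parcs C" "(w, z) \<in> parcs C"
    using is_cycle_two_nbrs[OF cycle_C w(1)] by blast
  then have yz': "(w, y) \<in> parcs U" "(w, z) \<in> parcs U" using C_sub by auto
  have "y \<in> outer \<or> z \<in> outer"
  proof (rule ccontr)
    assume "\<not> (y \<in> outer \<or> z \<in> outer)"
    then obtain l m where lm: "l \<in> {1..n}" "y = v l" "m \<in> {1..n}" "z = v m"
      using yz' wellformed' by (auto simp: outer_def)
    then have "l \<in> nbrs w" "m \<in> nbrs w" using yz' by (auto simp: nbrs_def)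
    then show False using single[OF w(2)] lm yz(1) by auto
  qed
  then obtain u where u: "u \<in> outer" "(w, u) \<in> parcs U" using yz' by blast
  \<comment> \<open>The two outer cycle vertices are interchangeable, so the position of
    \<open>w\<close> may be taken not to exceed that of \<open>u\<close>.\<close>
  have shape: thesis if wu: "w \<in> outer" "u \<in> outer" "(w, u) \<in> parcs U" and nb: "nbrs w = {i}" "nbrs u = {j}"
    and ij: "i \<le> j" for w u i j
  proof -
    have ij': "i \<in> nbrs w" "j \<in> nbrs u" using nb by auto
    note Cwu = outer_arc_cycle[OF wu ij' ij]
    have path: "v l \<notin> outer" if "l \<in> {i..j}" for l
      using that nbrsD[OF ij'(1)] nbrsD[OF ij'(2)] by (auto simp: outer_def)
    have C_outer: "pverts C \<inter> outer = {w, u}" using Cwu(1) path wu by auto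
    have "(x, y) \<in> parcs U \<longleftrightarrow> x = w \<and> y = u \<or> x = u \<and> y = w" if xy: "x \<in> outer" "y \<in> outer" for x y
    proof
      assume a: "(x, y) \<in> parcs U"
      then have a': "(y, x) \<in> parcs U" by (rule arcs_symmetric)
      obtain p q where pq: "p \<in> nbrs x" "q \<in> nbrs y" using adj xy by blast
      have "{x, y} \<subseteq> pverts C"
        using outer_arc_cycle(1)[OF xy a pq] outer_arc_cycle(1)[OF xy(2,1) a' pq(2,1)]
        by (cases "p \<le> q") auto
      then have "x \<in> {w, u}" "y \<in> {w, u}" using C_outer xy by auto
      moreover have "x \<noteq> y" using a no_loops' by blast
      ultimately show "x = w \<and> y = u \<or> x = u \<and> y = w" by blast
    qed (use wu arcs_symmetric in blast)
    moreover have "w \<noteq> u" using wu no_loops' by blast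
    moreover have "i + (j - i) = j" using ij by simp
    ultimately have "two_outer w u i (j - i)"
      unfolding two_outer_def using wu nb single by (metis DiffD1)
    then show thesis using two[of w u i "j - i"] Cwu ij by simp
  qed
  obtain i j where nb: "nbrs w = {i}" "nbrs u = {j}" using single[OF w(2)] single[OF u(1)] by auto
  show thesis
  proof (cases "i \<le> j")
    case True
    then show thesis using shape[OF w(2) u nb] by blast
  next
    case False
    then show thesis using shape[OF u(1) w(2) arcs_symmetric[OF u(2)] nb(2,1)] by simp
  qed
qed

text \<open>Every walk from \<open>x\<close> to the path passes its foot first, so \<open>x\<close>
  is one step farther than the foot from each path vertex. A foot at an end would put
  \<open>x\<close> at distance \<open>n\<close> from the other end.\<close>

lemma pendant_interior:
  assumes x: "x \<in> outer" and nb: "\<And>y. (x, y) \<in> parcs U \<Longrightarrow> y = v p" and p: "p \<in> {1..n}"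
  shows "1 < p" and "p < n"
proof -
  have reach: "\<exists>m. m + 1 \<le> n - 1 \<and> (v p, v l) \<in> parcs U ^^ m" if l: "l \<in> {1..n}" for l
  proof -
    obtain m where m: "m \<le> n - 1" "(x, v l) \<in> parcs U ^^ m"
      using diam[OF outer_verts[OF x] v_verts[OF l]] by blast
    have "m \<noteq> 0" using m(2) outer_path_neq[OF x l] by (metis pair_in_Id_conv relpow.simps(1))
    then obtain m' where m': "m = Suc m'" by (cases m) auto
    then obtain y where "(x, y) \<in> parcs U" "(y, v l) \<in> parcs U ^^ m'"
      using m(2) by (meson relpow_Suc_D2)
    then show ?thesis using nb m(1) m' by (intro exI[of _ m']) auto
  qed
  show "1 < p"
  proof (rule ccontr)
    assume "\<not> 1 < p"
    then have "p = 1" using p by simp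
    then obtain m where "m + 1 \<le> n - 1" "(v 1, v n) \<in> parcs U ^^ m" using reach[of n] n6 by auto
    then show False using geodesic by fastforce
  qed
  show "p < n"
  proof (rule ccontr)
    assume "\<not> p < n"
    then have "p = n" using p by simp
    then obtain m where "m + 1 \<le> n - 1" "(v n, v 1) \<in> parcs U ^^ m" using reach[of 1] n6 by auto
    then show False using geodesic relpow_sym[OF sym_parcs] by fastforce
  qed
qed

lemma deg_path:
  assumes p: "p \<in> {1..n}"
  shows "deg U (v p) = (if p = 1 \<or> p = n then 1 else 2) + card {x \<in> outer. p \<in> nbrs x}"
proof -
  let ?J = "{j \<in> {1..n}. j = p + 1 \<or> p = j + 1}" and ?X = "{x \<in> outer. p \<in> nbrs x}"
  have "{y. (v p, y) \<in> parcs U} = v ` ?J \<union> ?X"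
  proof (intro equalityI subsetI)
    fix y assume "y \<in> {y. (v p, y) \<in> parcs U}"
    then have y: "(v p, y) \<in> parcs U" "(y, v p) \<in> parcs U" using arcs_symmetric by auto
    then have "y \<in> v ` {1..n} \<or> y \<in> outer" using wellformed' by (auto simp: outer_def)
    then show "y \<in> v ` ?J \<union> ?X" using y p v_arcs by (auto simp: nbrs_def)
  next
    fix y assume "y \<in> v ` ?J \<union> ?X"
    then show "y \<in> {y. (v p, y) \<in> parcs U}" using p v_arcs nbrsD by auto
  qed
  moreover have "v ` ?J \<inter> ?X = {}" by (auto simp: outer_def)
  moreover have "finite ?X" using pair_finite_verts by (simp add: outer_def)
  moreover have "card (v ` ?J) = card ?J"
    by (rule card_image) (rule inj_on_subset[OF v_inj], auto)
  moreover have "card ?J = (if p = 1 \<or> p = n then 1 else 2)"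
  proof -
    have "?J = (if p = 1 then {} else {p - 1}) \<union> (if p = n then {} else {p + 1})"
      using p by auto
    moreover have "card \<dots> = (if p = 1 \<or> p = n then 1 else 2)"
      using n6 by (subst card_Un_disjoint) auto
    ultimately show ?thesis by simp
  qed
  ultimately show ?thesis by (simp add: deg_card card_Un_disjoint)
qed

end

section \<open>Deleting a vertex of the cycle\<close>

text \<open>Deletion kept within \<open>pair_pre_digraph\<close>, so that facts about
  \<open>pair_graph\<close> apply to the result.\<close>

definition del_pair :: "'a pair_pre_digraph \<Rightarrow> 'a \<Rightarrow> 'a pair_pre_digraph" where
  "del_pair G x = \<lparr> pverts = pverts G - {x}, parcs = {e \<in> parcs G. fst e \<noteq> x \<and> snd e \<noteq> x} \<rparr>"

lemma del_vert_with_proj: "pre_digraph.del_vert (with_proj G) x = with_proj (del_pair G x)"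
  by (simp add: pre_digraph.del_vert_def with_proj_def del_pair_def)

lemma (in pair_graph) pair_graph_del_pair: "pair_graph (del_pair G x)"
proof
  fix e assume e: "e \<in> parcs (del_pair G x)"
  then show "fst e \<in> pverts (del_pair G x)" "snd e \<in> pverts (del_pair G x)" "fst e \<noteq> snd e"
    using arc_fst_in_verts[of e] arc_snd_in_verts[of e] pair_no_loops[of e]
    by (simp_all add: del_pair_def)
next
  show "finite (pverts (del_pair G x))" using pair_finite_verts by (simp add: del_pair_def)
  have "parcs (del_pair G x) \<subseteq> parcs G" by (auto simp: del_pair_def)
  then show "finite (parcs (del_pair G x))" using pair_finite_arcs finite_subset by blast
  show "symmetric (with_proj (del_pair G x))"
    unfolding symmetric_def with_proj_simps
    by (rule symI) (use arcs_symmetric in \<open>simp add: del_pair_def\<close>)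
qed

text \<open>The free index range \<open>{a..<b}\<close> lets \<open>P\<close> and its prolongation
  by a position 0 or \<open>n + 1\<close> share one numbering, so leg positions need no
  shift.\<close>

lemma centipede_map:
  assumes H: "pair_graph H" and ab: "a + 3 \<le> b" and inj: "inj_on f {a..<b}"
    and sub: "f ` {a..<b} \<subseteq> pverts H"
    and arcs: "\<And>i j. i \<in> {a..<b} \<Longrightarrow> j \<in> {a..<b} \<Longrightarrow> (f i, f j) \<in> parcs H \<longleftrightarrow> j = i + 1 \<or> i = j + 1"
    and legs: "\<And>x. x \<in> pverts H - f ` {a..<b} \<Longrightarrow> \<exists>i. a < i \<and> i + 1 < b \<and> {y. (x, y) \<in> parcs H} = {f i}"
  shows "centipede (with_proj H) (map f [a..<b])"
    and "diametrical_path (with_proj H) (map f [a..<b])"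
proof -
  let ?ps = "map f [a..<b]"
  have d: "distinct ?ps" using inj by (simp add: distinct_map)
  have len: "length ?ps = b - a" "3 \<le> length ?ps" "2 \<le> length ?ps" using ab by auto
  have nth: "?ps ! i = f (a + i)" if "i < length ?ps" for i using that by simp
  have "induced_subgraph (path_graph ?ps) H"
    unfolding induced_path_graph_iff[OF H d]
    using sub arcs by (auto simp: nth simp del: nth_map)
  moreover have "\<exists>i. 0 < i \<and> i + 1 < length ?ps \<and> {y. (x, y) \<in> parcs H} = {?ps ! i}"
    if "x \<in> pverts H - set ?ps" for x
  proof -
    have "x \<in> pverts H - f ` {a..<b}" using that by simp
    then obtain i where i: "a < i" "i + 1 < b" "{y. (x, y) \<in> parcs H} = {f i}" using legs by blast
    then show ?thesis using nth[of "i - a"] by (intro exI[of _ "i - a"]) auto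
  qed
  ultimately show c: "centipede (with_proj H) ?ps" using centipede_iff[OF H len(3)] d by blast
  show "diametrical_path (with_proj H) ?ps" by (rule centipede_imp_diametrical_path[OF H c len(2)])
qed

context unicyclic_path
begin

definition P :: "'a list" where
  "P = map v [1..<n + 1]"

lemma set_P: "set P = v ` {1..n}"
  by (auto simp: P_def less_Suc_eq_le)

lemma outer_eq: "outer = pverts U - set P"
  by (simp add: outer_def set_P)

definition removal_ok :: "'a \<Rightarrow> bool" where
  "removal_ok w \<longleftrightarrow>
    (let T = pre_digraph.del_vert U w in
         (centipede T P \<and> diametrical_path T P \<and>
          \<not> (\<exists>r s. v r \<in> joints T P \<and> v s \<in> joints T P \<and>
                 odd r \<and> even s \<and> 3 \<le> r \<and> r < s \<and> s \<le> n - 2))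
         \<or>
         (\<exists>P' z. z \<in> pverts C - set P \<and> z \<noteq> w \<and>
            ((z, v 1) \<in> parcs U \<or> (z, v n) \<in> parcs U) \<and>
            set P' = set P \<union> {z} \<and> centipede T P' \<and> diametrical_path T P' \<and>
            ((z, v 1) \<in> parcs U \<longrightarrow> joints T P' \<subseteq> {v i | i. 1 \<le> i \<and> i \<le> n \<and> odd i}) \<and>
            ((z, v n) \<in> parcs U \<longrightarrow> joints T P' \<subseteq> {v i | i. 1 \<le> i \<and> i \<le> n \<and> even i})))"

text \<open>Every vertex off the path and different from the deleted one hangs on the path itself: in the
  second alternative \<open>z\<close> is not a joint.\<close>

lemma removal_ok_adjacent:
  assumes w: "removal_ok w" "w \<in> outer" and x: "x \<in> outer" "x \<noteq> w"
  shows "nbrs x \<noteq> {}"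
proof -
  let ?H = "del_pair U w"
  have H: "pair_graph ?H" by (rule pair_graph_del_pair)
  have T: "pre_digraph.del_vert U w = with_proj ?H" by (rule del_vert_with_proj)
  have xH: "x \<in> pverts ?H" using x outer_verts by (simp add: del_pair_def)
  have adj: "nbrs x \<noteq> {}" if "(x, v i) \<in> parcs U" "1 \<le> i" "i \<le> n" for i
    using that by (auto simp: nbrs_def)
  from w(1) consider
    (P) "centipede ?H P"
    | (P') P' z where "(z, v 1) \<in> parcs U \<or> (z, v n) \<in> parcs U"
      "set P' = set P \<union> {z}" "centipede ?H P'"
      "joints ?H P' \<subseteq> {v i | i. 1 \<le> i \<and> i \<le> n}"
    unfolding removal_ok_def Let_def T by blast
  then show ?thesis
  proof cases
    case P
    have "2 \<le> length P" using n6 by (simp add: P_def)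
    moreover have "x \<in> pverts ?H - set P" using xH x(1) by (simp add: outer_eq)
    ultimately obtain i where "i + 1 < length P" "{y. (x, y) \<in> parcs ?H} = {P ! i}"
      using centipede_iff[OF H] P by blast
    then have "(x, P ! i) \<in> parcs U" "P ! i \<in> set P" by (auto simp: del_pair_def)
    then show ?thesis using adj by (auto simp: set_P)
  next
    case P'
    show ?thesis
    proof (cases "x = z")
      case True
      then show ?thesis using P'(1) adj[of 1] adj[of n] n6 by auto
    next
      case False
      have "card (set P) = n" unfolding set_P using card_image[OF v_inj] by simp
      then have "n \<le> card (set P')" unfolding P'(2) by (metis List.finite_set P'(2) card_mono sup_ge1)
      then have "2 \<le> length P'" using card_length[of P'] n6 by linarith
      moreover have x': "x \<in> pverts ?H - set P'" using xH x(1) False P'(2) by (simp add: outer_eq)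
      ultimately obtain i where i: "i + 1 < length P'" "{y. (x, y) \<in> parcs ?H} = {P' ! i}"
        using centipede_iff[OF H] P'(3) by blast
      then have arc: "(x, P' ! i) \<in> parcs ?H" by blast
      then have "(P' ! i, x) \<in> parcs ?H" using arcs_symmetric by (simp add: del_pair_def)
      then have "P' ! i \<in> joints ?H P'" unfolding joints_def using i(1) x' by auto
      then obtain q where "P' ! i = v q" "1 \<le> q" "q \<le> n" using P'(4) by blast
      then show ?thesis using arc adj[of q] by (simp add: del_pair_def)
    qed
  qed
qed

text \<open>Deleting \<open>w\<close> says nothing about \<open>w\<close> itself. For that vertex
  another cycle vertex off the path is deleted; if there is none, both cycle neighbours of
  \<open>w\<close> are on the path.\<close>

lemma removals_ok_adjacent:
  assumes "\<And>w. w \<in> pverts C - set P \<Longrightarrow> removal_ok w" and x: "x \<in> outer"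
  shows "nbrs x \<noteq> {}"
proof -
  have C: "pverts C - set P = pverts C \<inter> outer" using C_sub by (auto simp: outer_eq)
  obtain w where w: "w \<in> pverts C" "w \<in> outer" using cycle_leaves_path by blast
  show ?thesis
  proof (cases "x = w")
    case False
    then show ?thesis using removal_ok_adjacent[of w x] assms w C by blast
  next
    case True
    show ?thesis
    proof (cases "\<exists>u. u \<in> pverts C \<inter> outer \<and> u \<noteq> w")
      case True
      then obtain u where "u \<in> pverts C \<inter> outer" "u \<noteq> w" by blast
      then show ?thesis using removal_ok_adjacent[of u x] assms C \<open>x = w\<close> by blast
    next
      case False
      obtain y where y: "(w, y) \<in> parcs C" using is_cycle_two_nbrs[OF cycle_C w(1)] by blast
      then have yU: "(w, y) \<in> parcs U" using C_sub by auto
      have "wf_digraph (with_proj C)" using sub_C by (simp add: subgraph_def)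
      then have "y \<in> pverts C" using y wf_digraph.head_in_verts[of "with_proj C" "(w, y)"] by simp
      moreover have "y \<noteq> w" using yU no_loops' by blast
      ultimately have "y \<notin> outer" using False by blast
      then obtain i where "i \<in> {1..n}" "y = v i"
        using yU wellformed' by (auto simp: outer_def)
      then show ?thesis using yU \<open>x = w\<close> by (auto simp: nbrs_def)
    qed
  qed
qed

text \<open>What the two shapes have in common: the vertex \<open>w\<close> of
  \<open>one_outer\<close>, and each of \<open>w\<close> and \<open>u\<close> in
  \<open>two_outer\<close>, leaves only legs off the path when deleted.\<close>

definition split_off :: "'a \<Rightarrow> bool" where
  "split_off x \<longleftrightarrow> x \<in> outer \<and> (\<forall>z\<in>outer - {x}. \<exists>p. nbrs z = {p}) \<and>
     (\<forall>z\<in>outer - {x}. \<forall>t\<in>outer - {x}. (z, t) \<notin> parcs U)"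

lemma split_off_nbrs:
  assumes "split_off x" and "z \<in> outer - {x}" and "nbrs z = {p}"
  shows "{y. (z, y) \<in> parcs (del_pair U x)} = {v p}" and "{y. (y, z) \<in> parcs (del_pair U x)} = {v p}"
proof -
  have p: "p \<in> {1..n}" "(z, v p) \<in> parcs U" using nbrsD[of p z] assms(3) by auto
  have xp: "v p \<noteq> x" using assms(1) p(1) outer_path_neq unfolding split_off_def by blast
  show 1: "{y. (z, y) \<in> parcs (del_pair U x)} = {v p}"
  proof (intro equalityI subsetI)
    fix y assume "y \<in> {y. (z, y) \<in> parcs (del_pair U x)}"
    then have y: "(z, y) \<in> parcs U" "y \<noteq> x" by (auto simp: del_pair_def)
    then have "y \<notin> outer" using assms(1,2) unfolding split_off_def by blast
    then obtain i where "i \<in> {1..n}" "y = v i" using y wellformed' by (auto simp: outer_def)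
    then have "i \<in> nbrs z" using y by (simp add: nbrs_def)
    then show "y \<in> {v p}" using assms(3) \<open>y = v i\<close> by simp
  qed (use p xp assms(2) in \<open>simp add: del_pair_def\<close>)
  have "(y, z) \<in> parcs (del_pair U x) \<longleftrightarrow> (z, y) \<in> parcs (del_pair U x)" for y
    using arcs_symmetric[of y z] arcs_symmetric[of z y] by (auto simp: del_pair_def)
  then show "{y. (y, z) \<in> parcs (del_pair U x)} = {v p}" using 1 by simp
qed

lemma split_off_joints:
  assumes x: "split_off x" and ps: "v ` {1..n} \<subseteq> set ps" "set ps \<subseteq> v ` {1..n} \<union> Y" and Y: "Y \<subseteq> set ps \<inter> outer"
  shows "joints (with_proj (del_pair U x)) ps = v ` legs (insert x Y)"
proof -
  have single: "\<exists>p. nbrs z = {p}" if "z \<in> outer - {x}" for z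
    using x that unfolding split_off_def by blast
  have off: "pverts (del_pair U x) - set ps = outer - insert x Y"
    using ps Y by (auto simp: outer_def del_pair_def)
  show ?thesis
  proof (intro equalityI subsetI)
    fix y assume "y \<in> joints (with_proj (del_pair U x)) ps"
    then obtain z where z: "z \<in> outer - insert x Y" "(y, z) \<in> parcs (del_pair U x)"
      unfolding joints_def with_proj_simps off by blast
    then obtain p where p: "nbrs z = {p}" using single by blast
    then have "y = v p" using split_off_nbrs(2)[OF x _ p] z by blast
    moreover have "p \<in> legs (insert x Y)" using z p by (auto simp: legs_def)
    ultimately show "y \<in> v ` legs (insert x Y)" by blast
  next
    fix y assume "y \<in> v ` legs (insert x Y)"
    then obtain z p where z: "y = v p" "z \<in> outer - insert x Y" "nbrs z = {p}"
      unfolding legs_def by blast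
    then have "(y, z) \<in> parcs (del_pair U x)" using split_off_nbrs(2)[OF x _ z(3)] by blast
    moreover have "y \<in> set ps" using z nbrsD[of p z] ps by auto
    ultimately show "y \<in> joints (with_proj (del_pair U x)) ps"
      unfolding joints_def with_proj_simps off using z by blast
  qed
qed

text \<open>\<open>Y\<close> collects the outer vertices absorbed into the path: it is empty for
  \<open>P\<close> itself and has one element for \<open>P\<close> prolonged at an end. The
  remaining outer vertices stay legs.\<close>

lemma split_off_centipede:
  assumes x: "split_off x" and ab: "a + 3 \<le> b" and inj: "inj_on f {a..<b}"
    and f: "\<And>i. i \<in> {a..<b} \<Longrightarrow> i \<in> {1..n} \<and> f i = v i \<or> f i \<in> Y"
    and v: "\<And>i. i \<in> {1..n} \<Longrightarrow> i \<in> {a..<b} \<and> f i = v i"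
    and Y: "Y \<subseteq> f ` {a..<b}" "Y \<subseteq> outer - {x}"
    and arcs: "\<And>i j. i \<in> {a..<b} \<Longrightarrow> j \<in> {a..<b} \<Longrightarrow> (f i, f j) \<in> parcs U \<longleftrightarrow> j = i + 1 \<or> i = j + 1"
    and legs: "\<And>p. p \<in> legs (insert x Y) \<Longrightarrow> a < p \<and> p + 1 < b"
  shows "centipede (with_proj (del_pair U x)) (map f [a..<b])"
    and "diametrical_path (with_proj (del_pair U x)) (map f [a..<b])"
    and "joints (with_proj (del_pair U x)) (map f [a..<b]) = v ` legs (insert x Y)"
proof -
  let ?H = "del_pair U x"
  have H: "pair_graph ?H" by (rule pair_graph_del_pair)
  have im: "f ` {a..<b} = v ` {1..n} \<union> Y"
  proof
    show "f ` {a..<b} \<subseteq> v ` {1..n} \<union> Y" using f by fastforce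
    have "v i \<in> f ` {a..<b}" if "i \<in> {1..n}" for i using v[OF that] by (metis imageI)
    then show "v ` {1..n} \<union> Y \<subseteq> f ` {a..<b}" using Y(1) by blast
  qed
  have nx: "y \<noteq> x \<and> y \<in> pverts U" if "y \<in> f ` {a..<b}" for y
  proof -
    have "x \<in> outer" using x by (simp add: split_off_def)
    moreover have "(\<exists>i\<in>{1..n}. y = v i) \<or> y \<in> Y" using that unfolding im by blast
    ultimately show ?thesis
      using Y(2) outer_path_neq v_verts outer_verts by blast
  qed
  have sub: "f ` {a..<b} \<subseteq> pverts ?H" using nx unfolding del_pair_def by fastforce
  have arcs': "(f i, f j) \<in> parcs ?H \<longleftrightarrow> j = i + 1 \<or> i = j + 1" if "i \<in> {a..<b}" "j \<in> {a..<b}" for i j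
    using arcs[OF that] nx[OF imageI[OF that(1)]] nx[OF imageI[OF that(2)]]
    by (simp add: del_pair_def)
  have leg: "\<exists>i. a < i \<and> i + 1 < b \<and> {y. (z, y) \<in> parcs ?H} = {f i}"
    if "z \<in> pverts ?H - f ` {a..<b}" for z
  proof -
    have z: "z \<in> outer - insert x Y" using that unfolding im by (auto simp: outer_def del_pair_def)
    then obtain p where p: "nbrs z = {p}" using x unfolding split_off_def by blast
    then have "p \<in> legs (insert x Y)" using z by (auto simp: legs_def)
    moreover have "p \<in> {1..n}" using nbrsD[of p z] p by simp
    ultimately show ?thesis using split_off_nbrs(1)[OF x _ p] z legs[of p] v[of p] by (intro exI[of _ p]) simp
  qed
  show "centipede (with_proj ?H) (map f [a..<b])"
    and "diametrical_path (with_proj ?H) (map f [a..<b])"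
    using centipede_map[OF H ab inj sub arcs' leg] by blast+
  show "joints (with_proj ?H) (map f [a..<b]) = v ` legs (insert x Y)"
    by (rule split_off_joints[OF x]) (use im Y in auto)
qed

lemma legs_path: "p \<in> legs S \<Longrightarrow> p \<in> {1..n}"
  by (auto simp: legs_def nbrs_def)

lemma split_off_P:
  assumes x: "split_off x" and legs: "\<And>p. p \<in> legs {x} \<Longrightarrow> 1 < p \<and> p < n"
  shows "centipede (pre_digraph.del_vert U x) P"
    and "diametrical_path (pre_digraph.del_vert U x) P"
    and "joints (pre_digraph.del_vert U x) P = v ` legs {x}"
proof -
  have inj: "inj_on v {1..<n + 1}" by (rule inj_on_subset[OF v_inj]) auto
  note c = split_off_centipede[OF x _ inj, of "{}"]
  show "centipede (pre_digraph.del_vert U x) P"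
    and "diametrical_path (pre_digraph.del_vert U x) P"
    and "joints (pre_digraph.del_vert U x) P = v ` legs {x}"
    unfolding del_vert_with_proj P_def by (rule c; use n6 v_arcs legs in force)+
qed

lemma removal_ok_P:
  assumes x: "split_off x" and legs: "\<And>p. p \<in> legs {x} \<Longrightarrow> 1 < p \<and> p < n"
    and "\<And>r s. r \<in> legs {x} \<Longrightarrow> s \<in> legs {x} \<Longrightarrow> odd r \<Longrightarrow> even s \<Longrightarrow> s < r"
  shows "removal_ok x"
proof -
  \<comment> \<open>Clause (1) quantifies \<open>r\<close> and \<open>s\<close> over all numbers,
    but \<open>v\<close> is injective only on \<open>{1..n}\<close>; the bounds in the clause bring
    both into this range.\<close>
  have leg: "r \<in> legs {x}" if "v r \<in> v ` legs {x}" "1 \<le> r" "r \<le> n" for r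
    using that legs_path[of _ "{x}"] v_eq_iff[of r] by auto
  have "\<not> (\<exists>r s. v r \<in> v ` legs {x} \<and> v s \<in> v ` legs {x} \<and> odd r \<and> even s \<and> 3 \<le> r \<and> r < s \<and> s \<le> n - 2)"
  proof (rule notI, elim exE conjE)
    fix r s assume rs: "v r \<in> v ` legs {x}" "v s \<in> v ` legs {x}" "odd r" "even s" "3 \<le> r" "r < s"
      "s \<le> n - 2"
    then have "r \<in> legs {x}" "s \<in> legs {x}"
      using leg[of r] leg[of s] by linarith+
    then have "s < r" using assms(3) rs by blast
    then show False using rs by simp
  qed
  then show ?thesis unfolding removal_ok_def Let_def using split_off_P[OF x legs] by simp
qed

text \<open>Since \<open>y\<close> hangs at an end of \<open>P\<close>, it cannot be a leg there;
  instead it becomes the new end of a path with one more vertex.\<close>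

lemma removal_ok_extend:
  assumes x: "split_off x" and y: "y \<in> outer - {x}" "y \<in> pverts C" "nbrs y = {q}"
    and legs: "\<And>p. p \<in> legs {x, y} \<Longrightarrow> 1 < p \<and> p < n"
    and q: "q = 1 \<and> (\<forall>p\<in>legs {x, y}. odd p) \<or> q = n \<and> (\<forall>p\<in>legs {x, y}. even p)"
  shows "removal_ok x"
proof -
  define f where "f i = (if i \<in> {1..n} then v i else y)" for i
  have f1: "f i = v i" if "i \<in> {1..n}" for i unfolding f_def using that by (rule if_P)
  have f2: "f i = y" if "i \<notin> {1..n}" for i unfolding f_def using that by (rule if_not_P)
  \<comment> \<open>The new vertex gets position 0 if it hangs at \<open>v 1\<close> and position
    \<open>n + 1\<close> if it hangs at \<open>v n\<close>; \<open>f\<close> sends both to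
    \<open>y\<close>.\<close>
  define a b where "a = (if q = 1 then 0 else 1 :: nat)" and "b = (if q = 1 then n + 1 else n + 2)"
  have ab: "{a..<b} = insert (if q = 1 then 0 else n + 1) {1..n}"
    using n6 by (auto simp: a_def b_def)
  have y': "y \<noteq> v i" if "i \<in> {1..n}" for i using outer_path_neq y(1) that by blast
  have yv: "(y, v i) \<in> parcs U \<longleftrightarrow> i = q" "(v i, y) \<in> parcs U \<longleftrightarrow> i = q" if "i \<in> {1..n}" for i
  proof -
    show 1: "(y, v i) \<in> parcs U \<longleftrightarrow> i = q" using y(3) that by (auto simp: nbrs_def)
    show "(v i, y) \<in> parcs U \<longleftrightarrow> i = q" using 1 arcs_symmetric by blast
  qed
  have yy: "(y, y) \<notin> parcs U" using no_loops' by blast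
  have inj: "inj_on f {a..<b}"
  proof -
    have "inj_on f {1..n}" using v_inj by (rule inj_on_cong[THEN iffD1, rotated]) (simp add: f_def)
    moreover have "f (if q = 1 then 0 else n + 1) = y" by (simp add: f_def)
    moreover have "y \<noteq> f i" if "i \<in> {1..n}" for i using y'[OF that] that by (simp add: f_def)
    ultimately show ?thesis unfolding ab unfolding inj_on_insert by blast
  qed
  have arcs: "(f i, f j) \<in> parcs U \<longleftrightarrow> j = i + 1 \<or> i = j + 1" if "i \<in> {a..<b}" "j \<in> {a..<b}" for i j
  proof (cases "i \<in> {1..n}"; cases "j \<in> {1..n}")
    assume ij: "i \<in> {1..n}" "j \<in> {1..n}"
    show ?thesis unfolding f1[OF ij(1)] f1[OF ij(2)] by (rule v_arcs[OF ij])
  next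
    assume ij: "i \<in> {1..n}" "j \<notin> {1..n}"
    have "(f i, f j) \<in> parcs U \<longleftrightarrow> i = q"
      unfolding f1[OF ij(1)] f2[OF ij(2)] by (rule yv(2)[OF ij(1)])
    moreover have "j = (if q = 1 then 0 else n + 1)" using that(2) ij ab by blast
    ultimately show ?thesis using q ij(1) n6 by auto
  next
    assume ij: "i \<notin> {1..n}" "j \<in> {1..n}"
    have "(f i, f j) \<in> parcs U \<longleftrightarrow> j = q"
      unfolding f2[OF ij(1)] f1[OF ij(2)] by (rule yv(1)[OF ij(2)])
    moreover have "i = (if q = 1 then 0 else n + 1)" using that(1) ij ab by blast
    ultimately show ?thesis using q ij(2) n6 by auto
  next
    assume ij: "i \<notin> {1..n}" "j \<notin> {1..n}"
    then have "i = (if q = 1 then 0 else n + 1)" "j = (if q = 1 then 0 else n + 1)"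
      using that ab by blast+
    moreover have "(f i, f j) \<notin> parcs U" unfolding f2[OF ij(1)] f2[OF ij(2)] by (rule yy)
    ultimately show ?thesis by simp
  qed
  have c: "centipede (with_proj (del_pair U x)) (map f [a..<b])"
    "diametrical_path (with_proj (del_pair U x)) (map f [a..<b])"
    "joints (with_proj (del_pair U x)) (map f [a..<b]) = v ` legs {x, y}"
  proof -
    have ab3: "a + 3 \<le> b" using n6 by (simp add: a_def b_def)
    have 1: "i \<in> {1..n} \<and> f i = v i \<or> f i \<in> {y}" for i using f1 f2 by blast
    have 2: "i \<in> {a..<b} \<and> f i = v i" if "i \<in> {1..n}" for i using that f1 unfolding ab by blast
    have 3: "{y} \<subseteq> f ` {a..<b}"
    proof -
      have "f (if q = 1 then 0 else n + 1) = y" by (simp add: f_def)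
      then show ?thesis unfolding ab by blast
    qed
    have 4: "a < p \<and> p + 1 < b" if "p \<in> legs {x, y}" for p
      using legs[OF that] by (simp add: a_def b_def)
    have 5: "{y} \<subseteq> outer - {x}" using y by simp
    show "centipede (with_proj (del_pair U x)) (map f [a..<b])"
      "diametrical_path (with_proj (del_pair U x)) (map f [a..<b])"
      "joints (with_proj (del_pair U x)) (map f [a..<b]) = v ` legs {x, y}"
      using split_off_centipede[OF x ab3 inj 1 2 3 5 arcs 4] by blast+
  qed
  have "set (map f [a..<b]) = f ` {a..<b}" by simp
  also have "\<dots> = insert (f (if q = 1 then 0 else n + 1)) (f ` {1..n})" unfolding ab by blast
  also have "f (if q = 1 then 0 else n + 1) = y" by (simp add: f_def)
  also have "f ` {1..n} = v ` {1..n}" using f1 by (rule image_cong[OF refl])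
  finally have set: "set (map f [a..<b]) = set P \<union> {y}" by (simp add: set_P)
  have sub: "v ` legs {x, y} \<subseteq> {v i | i. 1 \<le> i \<and> i \<le> n \<and> R i}" if "\<forall>p\<in>legs {x, y}. R p" for R
    using that legs by (auto dest!: less_imp_le)
  have q': "(y, v 1) \<in> parcs U \<longleftrightarrow> q = 1" "(y, v n) \<in> parcs U \<longleftrightarrow> q = n"
    using yv n6 by auto
  have "q = 1 \<Longrightarrow> v ` legs {x, y} \<subseteq> {v i | i. 1 \<le> i \<and> i \<le> n \<and> odd i}"
    using q n6 by (intro sub) auto
  moreover have "q = n \<Longrightarrow> v ` legs {x, y} \<subseteq> {v i | i. 1 \<le> i \<and> i \<le> n \<and> even i}"
    using q n6 by (intro sub) auto
  moreover have "y \<in> pverts C - set P" "y \<noteq> x" using y by (auto simp: outer_eq)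
  moreover have "(y, v 1) \<in> parcs U \<or> (y, v n) \<in> parcs U" using q q' by blast
  ultimately show ?thesis
    unfolding removal_ok_def Let_def del_vert_with_proj
    using c set q' by (intro disjI2 exI[of _ "map f [a..<b]"] exI[of _ y]) simp
qed

end

section \<open>Degrees and leg positions\<close>

text \<open>The degree clauses are stated for an arbitrary function \<open>D\<close> in place of the
  degrees along the path, which reduces their comparison with leg positions to arithmetic.\<close>

definition cond3 :: "nat \<Rightarrow> (nat \<Rightarrow> nat) \<Rightarrow> nat \<Rightarrow> bool" where
  "cond3 n D j \<longleftrightarrow>
     (j = 1 \<longrightarrow> D 1 = 2 \<and> D 2 = 3) \<and>
     (j = n - 1 \<longrightarrow> D n = 2 \<and> D (n - 1) = 3) \<and>
     (odd j \<and> 3 \<le> j \<and> j \<le> n - 3 \<longrightarrow> D j = 3 \<and> D (j + 1) = 3) \<and>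
     (\<forall>i. odd i \<and> 1 < i \<and> i < j \<longrightarrow> D i = 2) \<and>
     (\<forall>i. even i \<and> j + 1 < i \<and> i < n \<longrightarrow> D i = 2)"

definition cond4 :: "nat \<Rightarrow> (nat \<Rightarrow> nat) \<Rightarrow> nat \<Rightarrow> bool" where
  "cond4 n D j \<longleftrightarrow>
     (1 \<le> j \<and> j \<le> n - 2) \<and>
     D (j + 1) = 2 \<and>
     (j = 1 \<longrightarrow> D 1 = 2) \<and>
     (j = n - 2 \<longrightarrow> D n = 2) \<and>
     (j = 1 \<and> D 3 > 3 \<longrightarrow> (\<forall>i. even i \<and> 3 < i \<and> i < n \<longrightarrow> D i = 2)) \<and>
     (j = n - 2 \<and> D (n - 2) > 3 \<longrightarrow> (\<forall>i. odd i \<and> 1 < i \<and> i < n - 2 \<longrightarrow> D i = 2)) \<and>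
     (odd j \<and> 3 \<le> j \<and> j \<le> n - 3 \<and> (D j > 3 \<or> D (j + 2) > 3) \<longrightarrow>
        (\<forall>i. even i \<and> j + 2 < i \<and> i < n \<longrightarrow> D i = 2)) \<and>
     (even j \<and> 2 \<le> j \<and> j \<le> n - 4 \<and> (D j > 3 \<or> D (j + 2) > 3) \<longrightarrow>
        (\<forall>i. odd i \<and> 1 < i \<and> i < j \<longrightarrow> D i = 2)) \<and>
     (\<forall>r. odd r \<and> r \<noteq> j \<and> r \<noteq> j + 2 \<and> 3 \<le> r \<and> r \<le> n - 3 \<and> D r > 2 \<longrightarrow>
        (\<forall>i. even i \<and> r < i \<and> i < n \<and> i \<noteq> j \<and> i \<noteq> j + 2 \<longrightarrow> D i = 2)) \<and>
     (\<forall>r. even r \<and> r \<noteq> j \<and> r \<noteq> j + 2 \<and> 4 \<le> r \<and> r \<le> n - 2 \<and> D r > 2 \<longrightarrow>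
        (\<forall>i. odd i \<and> 1 < i \<and> i < r \<and> i \<noteq> j \<and> i \<noteq> j + 2 \<longrightarrow> D i = 2))"

definition cond5 :: "nat \<Rightarrow> (nat \<Rightarrow> nat) \<Rightarrow> nat \<Rightarrow> bool" where
  "cond5 n D j \<longleftrightarrow>
     odd j \<and> 3 \<le> j \<and> j \<le> n - 3 \<and>
     D j = 3 \<and> D (j + 1) = 3 \<and>
     (\<forall>i. odd i \<and> 1 < i \<and> i < j \<longrightarrow> D i = 2) \<and>
     (\<forall>i. even i \<and> j + 1 < i \<and> i < n \<longrightarrow> D i = 2)"

definition cond6 :: "nat \<Rightarrow> (nat \<Rightarrow> nat) \<Rightarrow> nat \<Rightarrow> bool" where
  "cond6 n D j \<longleftrightarrow>
     odd j \<and> 1 \<le> j \<and> j \<le> n - 3 \<and>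
     D (j + 1) = 2 \<and> D (j + 2) = 2 \<and>
     (j = 1 \<longrightarrow> D 1 = 2 \<and> D 4 = 3) \<and>
     (j = n - 3 \<longrightarrow> D n = 2 \<and> D (n - 3) = 3) \<and>
     (odd j \<and> 3 \<le> j \<and> j \<le> n - 5 \<longrightarrow> D j = 3 \<and> D (j + 3) = 3) \<and>
     (\<forall>i. odd i \<and> 1 < i \<and> i < j \<longrightarrow> D i = 2) \<and>
     (\<forall>i. even i \<and> j + 1 < i \<and> i < n \<and> i \<noteq> j + 3 \<longrightarrow> D i = 2)"

text \<open>\<open>Q\<close> is the set of leg positions and \<open>e\<close> counts the legs; \<open>i\<close> and \<open>i + d\<close> are the positions
  at which the cycle leaves the path.\<close>

locale path_degrees =
  fixes n :: nat and Q :: "nat set" and e D :: "nat \<Rightarrow> nat" and i d :: nat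
  assumes even_n: "even n" and n6: "6 \<le> n" and d: "0 < d" and id: "1 \<le> i" "i + d \<le> n"
    and Q: "p \<in> Q \<Longrightarrow> 1 < p \<and> p < n"
    and e: "e p = 0 \<longleftrightarrow> p \<notin> Q"
    and D: "1 \<le> p \<Longrightarrow> p \<le> n \<Longrightarrow>
      D p = (if p = 1 \<or> p = n then 1 else 2) + (if p = i \<or> p = i + d then 1 else 0) + e p"
begin

lemma D_plain: "1 < p \<Longrightarrow> p < n \<Longrightarrow> p \<noteq> i \<Longrightarrow> p \<noteq> i + d \<Longrightarrow> (D p = 2 \<longleftrightarrow> p \<notin> Q) \<and> (2 < D p \<longleftrightarrow> p \<in> Q)"
  using D[of p] e[of p] by auto

lemma D_cycle: "1 < p \<Longrightarrow> p < n \<Longrightarrow> p = i \<or> p = i + d \<Longrightarrow> (D p = 3 \<longleftrightarrow> p \<notin> Q) \<and> (3 < D p \<longleftrightarrow> p \<in> Q)"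
  using D[of p] e[of p] by auto

lemma end_not_Q: "1 \<notin> Q" "n \<notin> Q"
  using Q by blast+

lemma D_end: "i = 1 \<Longrightarrow> D 1 = 2" "i + d = n \<Longrightarrow> D n = 2"
  using D[of 1] D[of n] e[of 1] e[of n] end_not_Q n6 d by auto

text \<open>The last two clauses of \<open>cond3\<close> exclude odd legs before \<open>i\<close>
  and even legs after \<open>i + 1\<close>. For even \<open>i\<close> these are all the positions
  linked to \<open>i\<close> or \<open>i + 1\<close>. For odd \<open>i\<close> the positions
  \<open>i\<close> and \<open>i + 1\<close> are linked to each other too, and the first three
  clauses exclude them. An end of the path carries no leg anyway, so there only its inner neighbour
  is constrained.\<close>

lemma cond3_iff:
  assumes d1: "d = 1"
  shows "cond3 n D i \<longleftrightarrow> (\<forall>p\<in>Q. \<not> linked i p \<and> \<not> linked (i + 1) p)"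
proof -
  have odd_iff: "(\<forall>l. odd l \<and> 1 < l \<and> l < i \<longrightarrow> D l = 2) \<longleftrightarrow> (\<forall>p\<in>Q. odd p \<longrightarrow> i \<le> p)"
    using D_plain Q id d1 by (metis add_leD1 leD leI less_add_same_cancel1 less_le_trans less_one nat_neq_iff trans_less_add1)
  have even_iff: "(\<forall>l. even l \<and> i + 1 < l \<and> l < n \<longrightarrow> D l = 2) \<longleftrightarrow> (\<forall>p\<in>Q. even p \<longrightarrow> p \<le> i + 1)"
    using D_plain Q id d1 by (metis add_lessD1 leD leI le_less_trans less_add_same_cancel1 nat_neq_iff not_less_iff_gr_or_eq zero_less_one)
  have ends: "(i = 1 \<longrightarrow> D 1 = 2 \<and> D 2 = 3) \<and> (i = n - 1 \<longrightarrow> D n = 2 \<and> D (n - 1) = 3) \<and>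
      (odd i \<and> 3 \<le> i \<and> i \<le> n - 3 \<longrightarrow> D i = 3 \<and> D (i + 1) = 3) \<longleftrightarrow>
      (odd i \<longrightarrow> i \<notin> Q \<and> i + 1 \<notin> Q)"
  proof -
    have "even i \<or> i = 1 \<or> i = n - 1 \<and> i \<noteq> 1 \<or> odd i \<and> 3 \<le> i \<and> i \<le> n - 3"
      using id d1 even_n by presburger
    then consider "even i" | "i = 1" | "i = n - 1" "i \<noteq> 1" | "odd i" "3 \<le> i" "i \<le> n - 3"
      by blast
    then show ?thesis
    proof cases
      case 1
      then have "i \<noteq> 1" "i \<noteq> n - 1" using even_n n6 by presburger+
      then show ?thesis using 1 by simp
    next
      case 2
      then have "i \<noteq> n - 1" "i + 1 = 2" using n6 by auto
      then show ?thesis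
        using 2 D_end(1) D_cycle[of 2] end_not_Q n6 d1 by (simp flip: numeral_2_eq_2)
    next
      case 3
      then have "i + 1 = n" "odd i" using n6 even_n by presburger+
      then show ?thesis using 3 D_end(2) D_cycle[of "n - 1"] end_not_Q n6 d1 by auto
    next
      case 4
      then show ?thesis using D_cycle[of i] D_cycle[of "i + 1"] n6 d1 by auto
    qed
  qed
  have "cond3 n D i \<longleftrightarrow> (odd i \<longrightarrow> i \<notin> Q \<and> i + 1 \<notin> Q) \<and>
      (\<forall>p\<in>Q. odd p \<longrightarrow> i \<le> p) \<and> (\<forall>p\<in>Q. even p \<longrightarrow> p \<le> i + 1)"
    unfolding cond3_def odd_iff even_iff using ends by blast
  also have "\<dots> \<longleftrightarrow> (\<forall>p\<in>Q. (odd i \<longrightarrow> p \<noteq> i \<and> p \<noteq> i + 1) \<and> (odd p \<longrightarrow> i \<le> p) \<and> (even p \<longrightarrow> p \<le> i + 1))"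
    by blast
  also have "\<dots> \<longleftrightarrow> (\<forall>p\<in>Q. \<not> linked i p \<and> \<not> linked (i + 1) p)"
    unfolding linked_def by (intro ball_cong refl) presburger
  finally show ?thesis .
qed

text \<open>Only the degree of the middle vertex carries information. The end clauses hold because
  ends have no legs, and each remaining clause says that a leg at one position excludes linked legs
  elsewhere, which \<open>un\<close> already grants.\<close>

lemma cond4_iff:
  assumes d2: "d = 2" and un: "\<forall>p\<in>Q. \<forall>q\<in>Q. \<not> linked p q"
  shows "cond4 n D i \<longleftrightarrow> i + 1 \<notin> Q"
proof
  assume "cond4 n D i"
  then have "D (i + 1) = 2" by (simp add: cond4_def)
  then show "i + 1 \<notin> Q" using D_plain[of "i + 1"] id d2 by simp
next
  assume "i + 1 \<notin> Q"
  then have mid: "D (i + 1) = 2" using D_plain[of "i + 1"] id d2 by simp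
  have lo: "D l = 2" if "p \<in> Q" "odd p" "even l" "p < l" "l < n" "l \<noteq> i" "l \<noteq> i + 2" for p l
  proof -
    have "l \<notin> Q" using un that unfolding linked_def by blast
    then show ?thesis using D_plain[of l] Q[of p] that d2 by simp
  qed
  have hi: "D l = 2" if "p \<in> Q" "even p" "odd l" "l < p" "1 < l" "l \<noteq> i" "l \<noteq> i + 2" for p l
  proof -
    have "l \<notin> Q" using un that unfolding linked_def by blast
    then show ?thesis using D_plain[of l] Q[of p] that d2 by simp
  qed
  have big: "p \<in> Q" if "3 < D p" "p = i \<or> p = i + 2" "1 \<le> p" "p \<le> n" for p
    using that D[of p] e[of p] by (auto split: if_splits)
  have big': "p \<in> Q" if "2 < D p" "p \<noteq> i" "p \<noteq> i + 2" "1 < p" "p < n" for p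
    using that D_plain[of p] d2 by simp
  show "cond4 n D i"
    unfolding cond4_def
  proof (intro conjI impI allI)
    show "1 \<le> i" "i \<le> n - 2" "D (i + 1) = 2" using id d2 mid by auto
    show "D 1 = 2" if "i = 1" using D_end(1) that by simp
    show "D n = 2" if "i = n - 2" using D_end(2) that d2 n6 by simp
  next
    fix l assume a: "i = 1 \<and> 3 < D 3" "even l \<and> 3 < l \<and> l < n"
    then have "3 \<in> Q" using big[of 3] n6 by simp
    then show "D l = 2" using lo[of 3 l] a by simp
  next
    fix l assume a: "i = n - 2 \<and> 3 < D (n - 2)" "odd l \<and> 1 < l \<and> l < n - 2"
    then have "n - 2 \<in> Q" using big[of "n - 2"] n6 by simp
    moreover have "even (n - 2)" using even_n by simp
    ultimately show "D l = 2" using hi[of "n - 2" l] a n6 by simp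
  next
    fix l assume a: "odd i \<and> 3 \<le> i \<and> i \<le> n - 3 \<and> (3 < D i \<or> 3 < D (i + 2))"
      "even l \<and> i + 2 < l \<and> l < n"
    then obtain p where "p \<in> Q" "p = i \<or> p = i + 2" using big[of i] big[of "i + 2"] id d2 by auto
    then show "D l = 2" using lo[of p l] a by auto
  next
    fix l assume a: "even i \<and> 2 \<le> i \<and> i \<le> n - 4 \<and> (3 < D i \<or> 3 < D (i + 2))"
      "odd l \<and> 1 < l \<and> l < i"
    then obtain p where "p \<in> Q" "p = i \<or> p = i + 2" using big[of i] big[of "i + 2"] id d2 by auto
    then show "D l = 2" using hi[of p l] a by auto
  next
    fix r l assume a: "odd r \<and> r \<noteq> i \<and> r \<noteq> i + 2 \<and> 3 \<le> r \<and> r \<le> n - 3 \<and> 2 < D r"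
      "even l \<and> r < l \<and> l < n \<and> l \<noteq> i \<and> l \<noteq> i + 2"
    then have "r \<in> Q" using big'[of r] n6 by simp
    then show "D l = 2" using lo[of r l] a by simp
  next
    fix r l assume a: "even r \<and> r \<noteq> i \<and> r \<noteq> i + 2 \<and> 4 \<le> r \<and> r \<le> n - 2 \<and> 2 < D r"
      "odd l \<and> 1 < l \<and> l < r \<and> l \<noteq> i \<and> l \<noteq> i + 2"
    moreover from this have "r < n" using n6 by linarith
    ultimately have "r \<in> Q" using big'[of r] by simp
    then show "D l = 2" using hi[of r l] a by simp
  qed
qed

text \<open>Even legs before the cycle and odd legs behind it: the common normal form of the rank
  condition for \<open>two_outer\<close> and of clauses (5) and (6).\<close>

definition separated :: bool where
  "separated \<longleftrightarrow> odd i \<and> even (i + d) \<and> (\<forall>p\<in>Q. (odd p \<longrightarrow> i + d < p) \<and> (even p \<longrightarrow> p < i))"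

text \<open>Being linked forces the lower position \<open>i\<close> to be odd and the upper one to
  be even. Legs unlinked to both are then even before \<open>i\<close> or odd after
  \<open>i + d\<close>. Any odd leg thus comes after any even one, which makes the legs pairwise
  unlinked.\<close>

lemma separated_iff:
  "linked i (i + d) \<and> (\<forall>p\<in>Q. \<not> linked i p \<and> \<not> linked (i + d) p) \<and>
     (\<forall>p\<in>Q. \<forall>q\<in>Q. \<not> linked p q) \<longleftrightarrow> separated"
proof -
  have 1: "linked i (i + d) \<longleftrightarrow> odd i \<and> even (i + d)" using d by (auto simp: linked_def)
  have 2: "\<not> linked i p \<and> \<not> linked (i + d) p \<longleftrightarrow> (odd p \<longrightarrow> i + d < p) \<and> (even p \<longrightarrow> p < i)"
    if "odd i" "even (i + d)" for p
  proof -
    have "p \<noteq> i \<or> odd p" "p \<noteq> i + d \<or> even p" using that by blast+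
    then show ?thesis using that unfolding linked_def by (cases "odd p") auto
  qed
  have "\<not> linked p q" if separated "p \<in> Q" "q \<in> Q" for p q
  proof -
    have "(odd p \<longrightarrow> i + d < p) \<and> (even p \<longrightarrow> p < i)" "(odd q \<longrightarrow> i + d < q) \<and> (even q \<longrightarrow> q < i)"
      using that unfolding separated_def by blast+
    then show ?thesis unfolding linked_def by auto
  qed
  then show ?thesis using 1 2 unfolding separated_def by blast
qed

text \<open>Degree 3 keeps legs off the two cycle positions, and the last two clauses dispose of the
  other forbidden ones. The bounds on \<open>j\<close> in the clause follow from
  \<open>inner\<close> by parity.\<close>

lemma cond5_iff:
  assumes d1: "d = 1" and inner: "1 < i" "i + 1 < n"
  shows "cond5 n D i \<longleftrightarrow> separated"
proof
  assume c: "cond5 n D i"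
  have "(odd p \<longrightarrow> i + d < p) \<and> (even p \<longrightarrow> p < i)" if p: "p \<in> Q" for p
  proof -
    have 1: "1 < p" "p < n" using Q p by auto
    have "p \<noteq> i" "p \<noteq> i + 1" using c D_cycle[of i] D_cycle[of "i + 1"] inner d1 p unfolding cond5_def by auto
    then have "D p \<noteq> 2" using D_plain[of p] 1 p d1 by simp
    then have "\<not> (odd p \<and> p < i)" "\<not> (even p \<and> i + 1 < p)" using c 1 unfolding cond5_def by blast+
    then show ?thesis using \<open>p \<noteq> i\<close> \<open>p \<noteq> i + 1\<close> d1 by auto
  qed
  then show separated using c d1 unfolding separated_def cond5_def by auto
next
  assume s: separated
  then have odd: "odd i" unfolding separated_def by simp
  have Qs: "p \<notin> Q" if "odd p \<and> p \<le> i + 1 \<or> even p \<and> i \<le> p" for p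
    using s that d1 unfolding separated_def by auto
  have "3 \<le> i" "i \<le> n - 3" using odd inner even_n by presburger+
  moreover have "D i = 3" "D (i + 1) = 3"
    using D_cycle[of i] D_cycle[of "i + 1"] Qs[of i] Qs[of "i + 1"] inner odd d1 by auto
  moreover have "D l = 2" if "odd l \<and> 1 < l \<and> l < i" for l
    using D_plain[of l] Qs[of l] that inner d1 by auto
  moreover have "D l = 2" if "even l \<and> i + 1 < l \<and> l < n" for l
    using D_plain[of l] Qs[of l] that d1 by auto
  ultimately show "cond5 n D i" using odd unfolding cond5_def by blast
qed

lemma cond6_iff:
  assumes d3: "d = 3"
  shows "cond6 n D i \<longleftrightarrow> separated"
proof
  assume c: "cond6 n D i"
  then have odd: "odd i" by (simp add: cond6_def)
  \<comment> \<open>Which degree clause applies depends on whether the cycle touches an end of the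
    path. It cannot touch both, as \<open>n\<close> is at least 6, and the touched end carries no
    leg.\<close>
  have iQ: "i \<notin> Q \<and> i + 3 \<notin> Q"
  proof -
    have "i = 1 \<or> i = n - 3 \<and> i \<noteq> 1 \<or> 3 \<le> i \<and> i \<le> n - 5"
      using odd id d3 even_n by presburger
    then consider "i = 1" | "i = n - 3" "i \<noteq> 1" | "3 \<le> i" "i \<le> n - 5" by blast
    then show ?thesis
    proof cases
      case 1
      then have "D 4 = 3" using c by (simp add: cond6_def)
      then show ?thesis using D_cycle[of 4] 1 d3 n6 end_not_Q by simp
    next
      case 2
      then have "D (n - 3) = 3" using c by (simp add: cond6_def)
      moreover have "1 < i" "i + 3 = n" using 2 id(1) n6 by auto
      ultimately show ?thesis using D_cycle[of i] 2 d3 end_not_Q by auto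
    next
      case 3
      then have "D i = 3 \<and> D (i + 3) = 3" using c odd by (simp add: cond6_def)
      then show ?thesis using D_cycle[of i] D_cycle[of "i + 3"] 3 d3 n6 by auto
    qed
  qed
  have "(odd p \<longrightarrow> i + d < p) \<and> (even p \<longrightarrow> p < i)" if p: "p \<in> Q" for p
  proof -
    have 1: "1 < p" "p < n" using Q p by auto
    have 2: "p \<noteq> i" "p \<noteq> i + 3" using iQ p by auto
    then have "D p \<noteq> 2" using D_plain[of p] 1 p d3 by simp
    then have "\<not> (odd p \<and> p < i)" "\<not> (even p \<and> i + 1 < p)" "p \<noteq> i + 1" "p \<noteq> i + 2"
      using c 1 2 unfolding cond6_def by blast+
    then show ?thesis using 2 odd d3 by presburger
  qed
  then show separated using odd d3 unfolding separated_def by simp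
next
  assume s: separated
  then have odd: "odd i" unfolding separated_def by simp
  have Qs: "p \<notin> Q" if "odd p \<and> p \<le> i + 3 \<or> even p \<and> i \<le> p" for p
    using s that d3 unfolding separated_def by auto
  have "1 \<le> i" "i \<le> n - 3" using id d3 by auto
  moreover have "D (i + 1) = 2" "D (i + 2) = 2"
    using D_plain[of "i + 1"] D_plain[of "i + 2"] Qs[of "i + 1"] Qs[of "i + 2"] id odd d3 by auto
  moreover have "D 1 = 2 \<and> D 4 = 3" if "i = 1"
    using D_end(1) D_cycle[of 4] Qs[of 4] that d3 n6 by simp
  moreover have "D n = 2 \<and> D (n - 3) = 3" if "i = n - 3"
    using D_end(2) D_cycle[of i] Qs[of i] that d3 n6 odd by simp
  moreover have "D i = 3 \<and> D (i + 3) = 3" if "odd i \<and> 3 \<le> i \<and> i \<le> n - 5"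
    using D_cycle[of i] D_cycle[of "i + 3"] Qs[of i] Qs[of "i + 3"] that d3 n6 by auto
  moreover have "D l = 2" if "odd l \<and> 1 < l \<and> l < i" for l
    using D_plain[of l] Qs[of l] that id d3 by auto
  moreover have "D l = 2" if "even l \<and> i + 1 < l \<and> l < n \<and> l \<noteq> i + 3" for l
    using D_plain[of l] Qs[of l] that d3 by auto
  ultimately show "cond6 n D i" using odd unfolding cond6_def by blast
qed

end

section \<open>The characterization\<close>

lemma image_interval:
  fixes f :: "nat \<Rightarrow> 'a"
  shows "{f j, f (j + 1)} = f ` {j..j + 1}"
    and "{f j, f (j + 1), f (j + 2)} = f ` {j..j + 2}"
    and "{f j, f (j + 1), f (j + 2), f (j + 3)} = f ` {j..j + 3}"
proof -
  have "{j..j + 1} = {j, j + 1}" "{j..j + 2} = {j, j + 1, j + 2}"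
    "{j..j + 3} = {j, j + 1, j + 2, j + 3}" by auto
  then show "{f j, f (j + 1)} = f ` {j..j + 1}"
    and "{f j, f (j + 1), f (j + 2)} = f ` {j..j + 2}"
    and "{f j, f (j + 1), f (j + 2), f (j + 3)} = f ` {j..j + 3}" by simp_all
qed

context unicyclic_path
begin

text \<open>A \<open>j\<close> quantified in clauses (3) to (6) can therefore only be
  \<open>i\<close>, and the length of the interval selects the clause that applies.\<close>

lemma path_interval_eq_iff:
  assumes "{i..i + d} \<subseteq> {1..n}" and "{j..j + m} \<subseteq> {1..n}"
  shows "v ` {i..i + d} = v ` {j..j + m} \<longleftrightarrow> j = i \<and> d = m"
proof -
  have "v ` {i..i + d} = v ` {j..j + m} \<longleftrightarrow> {i..i + d} = {j..j + m}"
    by (rule inj_on_image_eq_iff[OF v_inj assms])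
  then show ?thesis by (auto simp: atLeastatMost_subset_iff)
qed

section \<open>Degrees and vertex deletions in the two shapes\<close>

lemma one_outer_split_off: "one_outer w i d \<Longrightarrow> split_off w"
  unfolding one_outer_def split_off_def by blast

lemma two_outer_split_off:
  assumes "two_outer w u i d"
  shows "split_off w" and "split_off u"
proof -
  have wu: "w \<in> outer" "u \<in> outer" "w \<noteq> u" "nbrs w = {i}" "nbrs u = {i + d}"
    and single: "\<forall>x\<in>outer - {w, u}. \<exists>p. nbrs x = {p}"
    and arc: "\<forall>x\<in>outer. \<forall>y\<in>outer. (x, y) \<in> parcs U \<longleftrightarrow> x = w \<and> y = u \<or> x = u \<and> y = w"
    using assms by (simp_all add: two_outer_def)
  have "\<exists>p. nbrs x = {p}" if "x \<in> outer" for x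
    using single wu that by (cases "x \<in> {w, u}") auto
  then show "split_off w" "split_off u" unfolding split_off_def using wu arc by auto
qed

lemma leg_interior:
  assumes p: "p \<in> legs S" and arc: "\<And>x y. x \<in> outer - S \<Longrightarrow> y \<in> outer \<Longrightarrow> (x, y) \<notin> parcs U"
  shows "1 < p \<and> p < n"
proof -
  obtain x where x: "x \<in> outer - S" "nbrs x = {p}" using p by (auto simp: legs_def)
  have "y = v p" if y: "(x, y) \<in> parcs U" for y
  proof -
    have "y \<notin> outer" using arc[OF x(1)] y by blast
    then obtain l where l: "l \<in> {1..n}" "y = v l" using wellformed'(2)[OF y] by (auto simp: outer_def)
    then have "l \<in> nbrs x" using y by (simp add: nbrs_def)
    then show ?thesis using x(2) l(2) by simp
  qed
  then show ?thesis using pendant_interior[of x p] x legs_path[OF p] by blast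
qed

lemma deg_legs:
  assumes S: "S \<subseteq> outer" and single: "\<And>x. x \<in> outer - S \<Longrightarrow> \<exists>p. nbrs x = {p}"
  obtains e where "\<And>p. e p = 0 \<longleftrightarrow> p \<notin> legs S"
    and "\<And>p. p \<in> {1..n} \<Longrightarrow>
      deg U (v p) = (if p = 1 \<or> p = n then 1 else 2) + card {x \<in> S. p \<in> nbrs x} + e p"
proof -
  define e where "e p = card {x \<in> outer - S. nbrs x = {p}}" for p
  have fin: "finite outer" using pair_finite_verts by (simp add: outer_def)
  have "e p = 0 \<longleftrightarrow> p \<notin> legs S" for p
  proof -
    have "finite {x \<in> outer - S. nbrs x = {p}}" using fin by simp
    then show ?thesis unfolding e_def legs_def by auto
  qed
  moreover have "deg U (v p) = (if p = 1 \<or> p = n then 1 else 2) + card {x \<in> S. p \<in> nbrs x} + e p"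
    if p: "p \<in> {1..n}" for p
  proof -
    have "{x \<in> outer. p \<in> nbrs x} = {x \<in> S. p \<in> nbrs x} \<union> {x \<in> outer - S. nbrs x = {p}}"
    proof (intro equalityI subsetI)
      fix x assume x: "x \<in> {x \<in> outer. p \<in> nbrs x}"
      show "x \<in> {x \<in> S. p \<in> nbrs x} \<union> {x \<in> outer - S. nbrs x = {p}}"
        using x single[of x] by (cases "x \<in> S") auto
    qed (use S in auto)
    moreover have "card \<dots> = card {x \<in> S. p \<in> nbrs x} + card {x \<in> outer - S. nbrs x = {p}}"
      using fin S finite_subset[OF S fin] by (intro card_Un_disjoint) auto
    ultimately show ?thesis using deg_path[OF p] by (simp add: e_def)
  qed
  ultimately show thesis by (rule that)
qed

lemma one_outer_degrees:
  assumes sh: "one_outer w i d"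
  obtains e where "path_degrees n (legs {w}) e (\<lambda>p. deg U (v p)) i d"
proof -
  have w: "w \<in> outer" "0 < d" "nbrs w = {i, i + d}"
    and single: "\<And>x. x \<in> outer - {w} \<Longrightarrow> \<exists>p. nbrs x = {p}"
    and arc: "\<And>x y. x \<in> outer \<Longrightarrow> y \<in> outer \<Longrightarrow> (x, y) \<notin> parcs U"
    using sh by (auto simp: one_outer_def)
  obtain e where e: "\<And>p. e p = 0 \<longleftrightarrow> p \<notin> legs {w}"
    and D: "\<And>p. p \<in> {1..n} \<Longrightarrow>
      deg U (v p) = (if p = 1 \<or> p = n then 1 else 2) + card {x \<in> {w}. p \<in> nbrs x} + e p"
    using deg_legs[of "{w}"] single w(1) by auto
  have W: "card {x \<in> {w}. p \<in> nbrs x} = (if p = i \<or> p = i + d then 1 else 0)" for p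
  proof -
    have "{x \<in> {w}. p \<in> nbrs x} = (if p = i \<or> p = i + d then {w} else {})" using w(3) by auto
    then show ?thesis by simp
  qed
  have "i \<in> {1..n}" "i + d \<in> {1..n}" using w(3) nbrsD[of i w] nbrsD[of "i + d" w] by simp_all
  moreover have "1 < p \<and> p < n" if "p \<in> legs {w}" for p
    using leg_interior[OF that] arc by blast
  ultimately have "path_degrees n (legs {w}) e (\<lambda>p. deg U (v p)) i d"
    using even_n n6 w(2) e D W by unfold_locales auto
  then show thesis by (rule that)
qed

lemma two_outer_leg_interior:
  assumes "two_outer w u i d" and "p \<in> legs {w, u}"
  shows "1 < p \<and> p < n"
proof (rule leg_interior[OF assms(2)])
  fix x y assume "x \<in> outer - {w, u}" "y \<in> outer"
  then show "(x, y) \<notin> parcs U" using assms(1) unfolding two_outer_def by blast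
qed

lemma two_outer_degrees:
  assumes sh: "two_outer w u i d" and d: "0 < d"
  obtains e where "path_degrees n (legs {w, u}) e (\<lambda>p. deg U (v p)) i d"
proof -
  have wu: "w \<in> outer" "u \<in> outer" "w \<noteq> u" "nbrs w = {i}" "nbrs u = {i + d}"
    and single: "\<forall>x\<in>outer - {w, u}. \<exists>p. nbrs x = {p}"
    using sh by (simp_all add: two_outer_def)
  obtain e where e: "\<And>p. e p = 0 \<longleftrightarrow> p \<notin> legs {w, u}"
    and D: "\<And>p. p \<in> {1..n} \<Longrightarrow>
      deg U (v p) = (if p = 1 \<or> p = n then 1 else 2) + card {x \<in> {w, u}. p \<in> nbrs x} + e p"
    using deg_legs[of "{w, u}"] single wu(1,2) by auto
  have W: "card {x \<in> {w, u}. p \<in> nbrs x} = (if p = i \<or> p = i + d then 1 else 0)" for p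
  proof -
    have "{x \<in> {w, u}. p \<in> nbrs x} = (if p = i then {w} else if p = i + d then {u} else {})"
      using wu d by auto
    then show ?thesis by simp
  qed
  have "i \<in> {1..n}" "i + d \<in> {1..n}" using wu(4,5) nbrsD[of i w] nbrsD[of "i + d" u] by simp_all
  then have "path_degrees n (legs {w, u}) e (\<lambda>p. deg U (v p)) i d"
    using even_n n6 d e D W two_outer_leg_interior[OF sh] by unfold_locales auto
  then show thesis by (rule that)
qed

text \<open>The second alternative of clause (1) asks for another cycle vertex off the path, and
  there is none; so the condition concerns the joints of \<open>P\<close>, which are the leg
  positions.\<close>

lemma one_outer_removal_ok:
  assumes sh: "one_outer w i d" and C: "pverts C \<inter> outer = {w}"
  shows "removal_ok w \<longleftrightarrow> (\<forall>p\<in>legs {w}. \<forall>q\<in>legs {w}. \<not> linked p q)"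
proof
  have split: "split_off w" using sh by (rule one_outer_split_off)
  have arc: "\<And>x y. x \<in> outer \<Longrightarrow> y \<in> outer \<Longrightarrow> (x, y) \<notin> parcs U"
    using sh by (simp add: one_outer_def)
  have legs: "1 < p \<and> p < n" if "p \<in> legs {w}" for p
    using leg_interior[OF that] arc by blast
  {
    assume ok: "removal_ok w"
    have C': "pverts C - set P = {w}" using C C_sub by (auto simp: outer_eq)
    have no: "\<not> (v r \<in> v ` legs {w} \<and> v s \<in> v ` legs {w} \<and> odd r \<and> even s \<and> 3 \<le> r \<and> r < s \<and> s \<le> n - 2)"
      for r s
    proof -
      have "\<not> (\<exists>r s. v r \<in> joints (pre_digraph.del_vert U w) P \<and> v s \<in> joints (pre_digraph.del_vert U w) P \<and>
          odd r \<and> even s \<and> 3 \<le> r \<and> r < s \<and> s \<le> n - 2)"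
        using ok unfolding removal_ok_def Let_def C' by blast
      then show ?thesis using split_off_P(3)[OF split legs] by simp
    qed
    have "\<not> (odd p \<and> even q \<and> p < q)" if "p \<in> legs {w}" "q \<in> legs {w}" for p q
    proof
      assume pq: "odd p \<and> even q \<and> p < q"
      \<comment> \<open>Legs are interior, and parity sharpens \<open>1 < p\<close> and
        \<open>q < n\<close> to the bounds of clause (1).\<close>
      then have "3 \<le> p" "q \<le> n - 2" using legs[OF that(1)] legs[OF that(2)] even_n by presburger+
      then show False using no[of p q] pq that by blast
    qed
    then show "\<forall>p\<in>legs {w}. \<forall>q\<in>legs {w}. \<not> linked p q" unfolding linked_def by blast
  next
    assume un: "\<forall>p\<in>legs {w}. \<forall>q\<in>legs {w}. \<not> linked p q"
    show "removal_ok w"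
    proof (rule removal_ok_P[OF split legs])
      fix r s assume rs: "r \<in> legs {w}" "s \<in> legs {w}" "odd r" "even s"
      then have "\<not> r < s" "r \<noteq> s" using un unfolding linked_def by blast+
      then show "s < r" by simp
    qed
  }
qed

text \<open>After deletion of \<open>w\<close>, the vertex \<open>u\<close> is a further leg at the
  even position \<open>i + d\<close>, before all odd legs. If \<open>i + d = n\<close> it prolongs
  the path instead, and all other legs are even because odd ones would lie beyond \<open>n\<close>.
  Deleting \<open>u\<close> is the mirror image, with \<open>w\<close> at the odd position
  \<open>i\<close>.\<close>

lemma two_outer_removal_ok:
  assumes sh: "two_outer w u i d" and C: "{w, u} \<subseteq> pverts C" and d: "0 < d"
    and s: "odd i" "even (i + d)"
    and Q: "\<And>p. p \<in> legs {w, u} \<Longrightarrow> (odd p \<longrightarrow> i + d < p) \<and> (even p \<longrightarrow> p < i)"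
  shows "removal_ok w" and "removal_ok u"
proof -
  have wu: "w \<in> outer" "u \<in> outer" "w \<noteq> u" "nbrs w = {i}" "nbrs u = {i + d}"
    using sh by (simp_all add: two_outer_def)
  note split = two_outer_split_off[OF sh]
  note legs = two_outer_leg_interior[OF sh]
  have id: "1 \<le> i" "i + d \<le> n" using wu(4,5) nbrsD[of i w] nbrsD[of "i + d" u] by simp_all
  have legs_w: "legs {w} = insert (i + d) (legs {w, u})" and legs_u: "legs {u} = insert i (legs {w, u})"
    using wu unfolding legs_def by auto
  show "removal_ok w"
  proof (cases "i + d < n")
    case True
    show ?thesis
    proof (rule removal_ok_P[OF split(1)])
      show "1 < p \<and> p < n" if "p \<in> legs {w}" for p using that True id d legs[of p] unfolding legs_w by auto
      fix r t assume r: "r \<in> legs {w}" "odd r" and t: "t \<in> legs {w}" "even t"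
      have "r \<in> legs {w, u}" using r s unfolding legs_w by blast
      then have "i + d < r" using Q r(2) by blast
      moreover have "t = i + d \<or> t < i" using t Q unfolding legs_w by blast
      ultimately show "t < r" by auto
    qed
  next
    case False
    then have n: "i + d = n" using id by simp
    have "\<forall>p\<in>legs {w, u}. even p" using Q legs n by fastforce
    then show ?thesis
      using removal_ok_extend[OF split(1), of u n] wu C legs n by simp
  qed
  show "removal_ok u"
  proof (cases "1 < i")
    case True
    show ?thesis
    proof (rule removal_ok_P[OF split(2)])
      show "1 < p \<and> p < n" if "p \<in> legs {u}" for p using that True id d legs[of p] unfolding legs_u by auto
      fix r t assume r: "r \<in> legs {u}" "odd r" and t: "t \<in> legs {u}" "even t"
      have "t \<in> legs {w, u}" using t s unfolding legs_u by blast
      then have "t < i" using Q t(2) by blast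
      moreover have "r = i \<or> i + d < r" using r Q unfolding legs_u by blast
      ultimately show "t < r" by auto
    qed
  next
    case False
    then have i: "i = 1" using id by simp
    have "\<forall>p\<in>legs {w, u}. odd p" using Q legs i by fastforce
    then show ?thesis
      using removal_ok_extend[OF split(2), of w 1] wu C legs i by (simp add: insert_commute)
  qed
qed

text \<open>The function \<open>\<phi>\<close> changes by at most one along every arc, so it bounds distances from below. Were
  \<open>i\<close> or \<open>i + 1\<close> an end of the path, the vertex hanging there would be too far from the other end.\<close>

lemma two_outer_interior:
  assumes sh: "two_outer w u i 1"
  shows "1 < i" and "i + 1 < n"
proof -
  have wu: "w \<in> outer" "u \<in> outer" "w \<noteq> u" "nbrs w = {i}" "nbrs u = {i + 1}"
    and single': "\<forall>x\<in>outer - {w, u}. \<exists>p. nbrs x = {p}"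
    and arc: "\<forall>x\<in>outer. \<forall>y\<in>outer. (x, y) \<in> parcs U \<longleftrightarrow> x = w \<and> y = u \<or> x = u \<and> y = w"
    using sh by (simp_all add: two_outer_def)
  have single: "\<exists>p. nbrs x = {p}" if "x \<in> outer" for x
    using single' wu that by (cases "x \<in> {w, u}") auto
  have i: "i \<in> {1..n}" "i + 1 \<in> {1..n}" using wu(4,5) nbrsD[of i w] nbrsD[of "i + 1" u] by simp_all
  have bound: "\<bar>int q - int p\<bar> + 1 \<le> int m"
    if s: "s = 1 \<or> s = - 1" and m: "(x, v q) \<in> parcs U ^^ m" and q: "q \<in> {1..n}"
      and x: "x \<in> {w, u}" "nbrs x = {p}" and sgn: "\<bar>int q - int p\<bar> = - s * (int q - int p)" for s m x p q
  proof -
    \<comment> \<open>An outer vertex takes the position of its foot, and \<open>w\<close> and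
      \<open>u\<close> are both shifted by \<open>s\<close>. The arc between them still changes the
      value by 1, since their feet are consecutive, and the shift points away from the target
      \<open>v q\<close>. This produces the extra 1 in the bound.\<close>
    define \<phi> where "\<phi> y = (if y \<in> outer then int (the_elem (nbrs y)) + (if y \<in> {w, u} then s else 0)
      else int (the_inv_into {1..n} v y))" for y
    have \<phi>v: "\<phi> (v l) = int l" if "l \<in> {1..n}" for l
    proof -
      have "v l \<notin> outer" using outer_path_neq that by blast
      then show ?thesis using the_inv_into_f_f[OF v_inj that] by (simp add: \<phi>_def)
    qed
    have step: "\<bar>\<phi> b - \<phi> a\<bar> \<le> 1" if ab: "(a, b) \<in> parcs U" for a b
    proof -
      have one: "\<bar>\<phi> z - int l\<bar> \<le> 1" if zl: "(z, v l) \<in> parcs U" "l \<in> {1..n}" for z l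
      proof (cases "z \<in> outer")
        case True
        then obtain p where p: "nbrs z = {p}" using single by blast
        then have "l = p" using zl by (auto simp: nbrs_def)
        then show ?thesis using s True p by (auto simp: \<phi>_def)
      next
        case False
        then obtain j where j: "j \<in> {1..n}" "z = v j" using wellformed'(1)[OF zl(1)] by (auto simp: outer_def)
        then show ?thesis using v_arcs[OF j(1) zl(2)] zl \<phi>v[OF j(1)] by auto
      qed
      show ?thesis
      proof (cases "a \<in> outer \<and> b \<in> outer")
        case True
        then have "a = w \<and> b = u \<or> a = u \<and> b = w"
          using bspec[OF bspec[OF arc, of a], of b] ab by simp
        then show ?thesis using wu by (auto simp: \<phi>_def)
      next
        case False
        note V = wellformed'[OF ab]
        consider l where "l \<in> {1..n}" "b = v l" | l where "l \<in> {1..n}" "a = v l"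
          using False V unfolding outer_def by blast
        then show ?thesis
        proof cases
          case 1
          then show ?thesis using one[of a l] ab \<phi>v by simp
        next
          case 2
          then show ?thesis using one[of b l] arcs_symmetric[OF ab] \<phi>v by simp
        qed
      qed
    qed
    have x\<phi>: "\<phi> x = int p + s" using x wu by (auto simp: \<phi>_def)
    have le: "\<phi> b \<le> \<phi> a + 1" "- \<phi> b \<le> - \<phi> a + 1" if "(a, b) \<in> parcs U" for a b
      using step[OF that] by auto
    have "\<phi> (v q) \<le> \<phi> x + int m" "- \<phi> (v q) \<le> - \<phi> x + int m"
      using relpow_potential[OF m, of \<phi>] relpow_potential[OF m, of "\<lambda>y. - \<phi> y"] le by auto
    then have "\<bar>int q - (int p + s)\<bar> \<le> int m" using \<phi>v[OF q] x\<phi> by auto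
    then show ?thesis using s sgn by auto
  qed
  show "1 < i"
  proof (rule ccontr)
    assume "\<not> 1 < i"
    then have i1: "i = 1" using i by simp
    obtain m where m: "m \<le> n - 1" "(w, v n) \<in> parcs U ^^ m"
      using diam[OF outer_verts[OF wu(1)] v_verts[of n]] n6 by auto
    have "\<bar>int n - int 1\<bar> + 1 \<le> int m"
      by (rule bound[of "- 1" w n m 1]) (use m wu i1 n6 in auto)
    then show False using m(1) n6 by auto
  qed
  show "i + 1 < n"
  proof (rule ccontr)
    assume "\<not> i + 1 < n"
    then have i1: "i + 1 = n" using i by simp
    obtain m where m: "m \<le> n - 1" "(u, v 1) \<in> parcs U ^^ m"
      using diam[OF outer_verts[OF wu(2)] v_verts[of 1]] n6 by auto
    have "\<bar>int 1 - int n\<bar> + 1 \<le> int m"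
      by (rule bound[of 1 u 1 m n]) (use m wu i1 n6 in auto)
    then show False using m(1) n6 by auto
  qed
qed

definition structure_ok :: bool where
  "structure_ok \<longleftrightarrow>
    (\<forall>w \<in> pverts C - set P. removal_ok w) \<and> k \<in> {3, 4, 6} \<and>
    (k = 3 \<longrightarrow> (\<exists>j. 1 \<le> j \<and> j \<le> n - 1 \<and> pverts C \<inter> set P = {v j, v (j + 1)} \<and>
       cond3 n (\<lambda>p. deg U (v p)) j)) \<and>
    (\<forall>j. k = 4 \<and> {j, j + 1, j + 2} \<subseteq> {1..n} \<and>
       pverts C \<inter> set P = {v j, v (j + 1), v (j + 2)} \<longrightarrow> cond4 n (\<lambda>p. deg U (v p)) j) \<and>
    (\<forall>j. k = 4 \<and> {j, j + 1} \<subseteq> {1..n} \<and> pverts C \<inter> set P = {v j, v (j + 1)} \<longrightarrow>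
       cond5 n (\<lambda>p. deg U (v p)) j) \<and>
    (k = 6 \<longrightarrow> (\<exists>j. pverts C \<inter> set P = {v j, v (j + 1), v (j + 2), v (j + 3)} \<and>
       cond6 n (\<lambda>p. deg U (v p)) j))"

text \<open>Clause (1) supplies that the legs are pairwise unlinked, and the gap selects the
  remaining clause: \<open>d = 1\<close> means \<open>k = 3\<close> and clause (3),
  \<open>d = 2\<close> means \<open>k = 4\<close> and clause (4), with (5) vacuous.\<close>

lemma one_outer_equiv:
  assumes sh: "one_outer w i d" and d: "d \<in> {1, 2}" and C: "pverts C = insert w (v ` {i..i + d})"
    and k: "k = d + 2"
  shows "mr_minus U = n \<longleftrightarrow> structure_ok"
proof -
  obtain e where "path_degrees n (legs {w}) e (\<lambda>p. deg U (v p)) i d"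
    using one_outer_degrees[OF sh] by blast
  then interpret D: path_degrees n "legs {w}" e "\<lambda>p. deg U (v p)" i d .
  have w: "w \<in> outer" using sh by (simp add: one_outer_def)
  have sub: "{i..i + d} \<subseteq> {1..n}" using D.id by auto
  have CP: "pverts C \<inter> set P = v ` {i..i + d}" and CQ: "pverts C - set P = {w}"
    using C w sub by (auto simp: set_P outer_def)
  have "pverts C \<inter> outer = {w}" using CQ C_sub by (auto simp: outer_eq)
  then have ok: "(\<forall>w \<in> pverts C - set P. removal_ok w) \<longleftrightarrow>
      (\<forall>p\<in>legs {w}. \<forall>q\<in>legs {w}. \<not> linked p q)"
    unfolding CQ using one_outer_removal_ok[OF sh] by simp
  note mr = mr_minus_one_outer[OF sh d]
  have two: "v ` {i..i + d} = {v j, v (j + 1)} \<longleftrightarrow> j = i \<and> d = 1" if "{j, j + 1} \<subseteq> {1..n}" for j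
    unfolding image_interval by (rule path_interval_eq_iff[OF sub]) (use that in auto)
  have three: "v ` {i..i + d} = {v j, v (j + 1), v (j + 2)} \<longleftrightarrow> j = i \<and> d = 2"
    if "{j, j + 1, j + 2} \<subseteq> {1..n}" for j
    unfolding image_interval by (rule path_interval_eq_iff[OF sub]) (use that in auto)
  show ?thesis
  proof (cases "d = 1")
    case True
    have "(\<exists>j. 1 \<le> j \<and> j \<le> n - 1 \<and> v ` {i..i + d} = {v j, v (j + 1)} \<and>
        cond3 n (\<lambda>p. deg U (v p)) j) \<longleftrightarrow> cond3 n (\<lambda>p. deg U (v p)) i" (is "?E \<longleftrightarrow> _")
    proof
      assume ?E
      then obtain j where j: "1 \<le> j" "j \<le> n - 1" "v ` {i..i + d} = {v j, v (j + 1)}"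
        "cond3 n (\<lambda>p. deg U (v p)) j" by blast
      then have "{j, j + 1} \<subseteq> {1..n}" using n6 by auto
      then show "cond3 n (\<lambda>p. deg U (v p)) i" using two[of j] j by simp
    next
      assume "cond3 n (\<lambda>p. deg U (v p)) i"
      moreover have "{i, i + 1} \<subseteq> {1..n}" "i \<le> n - 1" using D.id True by auto
      ultimately show ?E using two[of i] True D.id by blast
    qed
    then have "structure_ok \<longleftrightarrow> (\<forall>p\<in>legs {w}. \<forall>q\<in>legs {w}. \<not> linked p q) \<and>
        cond3 n (\<lambda>p. deg U (v p)) i"
      unfolding structure_ok_def ok CP using k True by simp
    also have "\<dots> \<longleftrightarrow> mr_minus U = n" unfolding mr D.cond3_iff[OF True] using True by simp
    finally show ?thesis by simp
  next
    case False
    then have d2: "d = 2" using d by simp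
    have A: "(\<forall>j. k = 4 \<and> {j, j + 1, j + 2} \<subseteq> {1..n} \<and> v ` {i..i + d} = {v j, v (j + 1), v (j + 2)} \<longrightarrow>
        cond4 n (\<lambda>p. deg U (v p)) j) \<longleftrightarrow> cond4 n (\<lambda>p. deg U (v p)) i"
    proof -
      have "{i, i + 1, i + 2} \<subseteq> {1..n}" using D.id d2 by auto
      then show ?thesis using three k d2 by auto
    qed
    have B: "\<forall>j. k = 4 \<and> {j, j + 1} \<subseteq> {1..n} \<and> v ` {i..i + d} = {v j, v (j + 1)} \<longrightarrow>
        cond5 n (\<lambda>p. deg U (v p)) j"
      using two d2 by auto
    have "structure_ok \<longleftrightarrow> (\<forall>p\<in>legs {w}. \<forall>q\<in>legs {w}. \<not> linked p q) \<and>
        cond4 n (\<lambda>p. deg U (v p)) i"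
      unfolding structure_ok_def ok CP A using k d2 B by simp
    also have "\<dots> \<longleftrightarrow> mr_minus U = n" unfolding mr using D.cond4_iff[OF d2] d2 by auto
    finally show ?thesis by simp
  qed
qed

text \<open>For even \<open>d\<close> both sides fail: \<open>i\<close> and \<open>i + d\<close>
  have equal parity and are not linked, while \<open>k = 5\<close> violates (2) and the triangle
  with one path vertex violates (3). For odd \<open>d\<close> the decisive clause is (5) or
  (6).\<close>

lemma two_outer_equiv:
  assumes sh: "two_outer w u i d" and d: "d \<le> 3" and C: "pverts C = {w, u} \<union> v ` {i..i + d}"
    and k: "k = d + 3"
  shows "mr_minus U = n \<longleftrightarrow> structure_ok"
proof -
  have wu: "w \<in> outer" "u \<in> outer" "nbrs w = {i}" "nbrs u = {i + d}"
    using sh by (simp_all add: two_outer_def)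
  have id: "1 \<le> i" "i + d \<le> n" using wu(3,4) nbrsD[of i w] nbrsD[of "i + d" u] by simp_all
  have sub: "{i..i + d} \<subseteq> {1..n}" using id by auto
  have CP: "pverts C \<inter> set P = v ` {i..i + d}" and CQ: "pverts C - set P = {w, u}"
    using C wu(1,2) sub by (auto simp: set_P outer_def)
  note mr = mr_minus_two_outer[OF sh]
  have img: "v ` {i..i + d} = v ` {j..j + m} \<longleftrightarrow> j = i \<and> d = m" if "1 \<le> j" "j + m \<le> n" for j m
    by (rule path_interval_eq_iff[OF sub]) (use that in auto)
  show ?thesis
  proof (cases "d = 0 \<or> d = 2")
    case True
    have "\<not> linked i (i + d)" using True by (auto simp: linked_def)
    moreover have "\<not> structure_ok"
    proof
      assume s: structure_ok
      then have k3: "k = 3" "d = 0" using True k unfolding structure_ok_def by auto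
      have "\<exists>j. 1 \<le> j \<and> j \<le> n - 1 \<and> v ` {i..i + d} = {v j, v (j + 1)} \<and>
          cond3 n (\<lambda>p. deg U (v p)) j"
        using s k3(1) unfolding structure_ok_def CP by simp
      then obtain j where j: "1 \<le> j" "j \<le> n - 1" "v ` {i..i + d} = v ` {j..j + 1}"
        unfolding image_interval by (elim exE conjE)
      moreover have "j + 1 \<le> n" using j(2) n6 by linarith
      ultimately show False using img[of j 1] k3(2) by simp
    qed
    ultimately show ?thesis using mr by blast
  next
    case False
    then have d13: "d = 1 \<or> d = 3" "0 < d" using d by auto
    obtain e where "path_degrees n (legs {w, u}) e (\<lambda>p. deg U (v p)) i d"
      using two_outer_degrees[OF sh d13(2)] by blast
    then interpret D: path_degrees n "legs {w, u}" e "\<lambda>p. deg U (v p)" i d .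
    have mr': "mr_minus U = n \<longleftrightarrow> D.separated" unfolding mr by (rule D.separated_iff)
    \<comment> \<open>Clause (1) is a consequence of \<open>separated\<close>, so the degree clause
      alone settles both directions.\<close>
    have ok: "\<forall>w \<in> pverts C - set P. removal_ok w" if D.separated
      unfolding CQ using two_outer_removal_ok[OF sh _ d13(2)] that C unfolding D.separated_def by auto
    from d13(1) show ?thesis
    proof
      assume d1: "d = 1"
      have A: "\<forall>j. k = 4 \<and> {j, j + 1, j + 2} \<subseteq> {1..n} \<and> v ` {i..i + d} = {v j, v (j + 1), v (j + 2)} \<longrightarrow>
          cond4 n (\<lambda>p. deg U (v p)) j"
      proof (intro allI impI)
        fix j assume "k = 4 \<and> {j, j + 1, j + 2} \<subseteq> {1..n} \<and> v ` {i..i + d} = {v j, v (j + 1), v (j + 2)}"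
        then have "d = 2" using img[of j 2] unfolding image_interval by simp
        then show "cond4 n (\<lambda>p. deg U (v p)) j" using d1 by simp
      qed
      have B: "(\<forall>j. k = 4 \<and> {j, j + 1} \<subseteq> {1..n} \<and> v ` {i..i + d} = {v j, v (j + 1)} \<longrightarrow>
          cond5 n (\<lambda>p. deg U (v p)) j) \<longleftrightarrow> cond5 n (\<lambda>p. deg U (v p)) i"
      proof
        assume *: "\<forall>j. k = 4 \<and> {j, j + 1} \<subseteq> {1..n} \<and> v ` {i..i + d} = {v j, v (j + 1)} \<longrightarrow>
          cond5 n (\<lambda>p. deg U (v p)) j"
        have "{i, i + 1} \<subseteq> {1..n}" "k = 4" "v ` {i..i + d} = {v i, v (i + 1)}"
          unfolding image_interval using id d1 k by auto
        then show "cond5 n (\<lambda>p. deg U (v p)) i" using * by blast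
      next
        assume *: "cond5 n (\<lambda>p. deg U (v p)) i"
        show "\<forall>j. k = 4 \<and> {j, j + 1} \<subseteq> {1..n} \<and> v ` {i..i + d} = {v j, v (j + 1)} \<longrightarrow>
          cond5 n (\<lambda>p. deg U (v p)) j"
        proof (intro allI impI)
          fix j assume "k = 4 \<and> {j, j + 1} \<subseteq> {1..n} \<and> v ` {i..i + d} = {v j, v (j + 1)}"
          then have "j = i" using img[of j 1] unfolding image_interval by simp
          then show "cond5 n (\<lambda>p. deg U (v p)) j" using * by simp
        qed
      qed
      have "cond5 n (\<lambda>p. deg U (v p)) i \<longleftrightarrow> D.separated"
        using D.cond5_iff[OF d1] two_outer_interior[of w u i] sh d1 by simp
      then show ?thesis
        unfolding mr' structure_ok_def CP B using A ok k d1 by auto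
    next
      assume d3: "d = 3"
      have "(\<exists>j. v ` {i..i + d} = {v j, v (j + 1), v (j + 2), v (j + 3)} \<and>
          cond6 n (\<lambda>p. deg U (v p)) j) \<longleftrightarrow> cond6 n (\<lambda>p. deg U (v p)) i" (is "?E \<longleftrightarrow> _")
      proof
        assume ?E
        then obtain j where j: "v ` {i..i + d} = v ` {j..j + 3}" "cond6 n (\<lambda>p. deg U (v p)) j"
          unfolding image_interval by (elim exE conjE)
        then have "1 \<le> j" "j + 3 \<le> n" using n6 unfolding cond6_def by auto
        then show "cond6 n (\<lambda>p. deg U (v p)) i" using img[of j 3] j by simp
      next
        assume "cond6 n (\<lambda>p. deg U (v p)) i"
        then show ?E unfolding image_interval using d3 by blast
      qed
      then show ?thesis
        unfolding mr' structure_ok_def CP using D.cond6_iff[OF d3] ok k d3 by auto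
    qed
  qed
qed

text \<open>A vertex without path neighbours falsifies both sides: it has some neighbour, so its
  column is not zero, and clause (1) would attach it to the path. Otherwise one of the two shapes is
  present.\<close>

theorem mr_minus_equiv: "mr_minus U = n \<longleftrightarrow> structure_ok"
proof (cases "\<forall>x\<in>outer. nbrs x \<noteq> {}")
  case True
  then have adj: "\<And>x. x \<in> outer \<Longrightarrow> nbrs x \<noteq> {}" by blast
  show ?thesis
  proof (rule outer_shapes[OF adj])
    show ?thesis if "one_outer w i d" "d \<in> {1, 2}" "pverts C = insert w (v ` {i..i + d})" "k = d + 2"
      for w i d
      using that by (rule one_outer_equiv)
    show ?thesis if "two_outer w u i d" "d \<le> 3" "pverts C = {w, u} \<union> v ` {i..i + d}" "k = d + 3"
      for w u i d
      using that by (rule two_outer_equiv)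
  qed
next
  case False
  then obtain x where x: "x \<in> outer" "nbrs x = {}" by blast
  have "1 \<in> {1..n}" using n6 by simp
  then have "v 1 \<in> pverts U" "x \<noteq> v 1" using v_verts outer_path_neq x(1) by blast+
  then obtain m where m: "(x, v 1) \<in> parcs U ^^ m" using diam outer_verts[OF x(1)] by blast
  then obtain m' where "m = Suc m'" using \<open>x \<noteq> v 1\<close> by (cases m) auto
  then obtain y where "(x, y) \<in> parcs U" using m by (meson relpow_Suc_D2)
  then have "(y, x) \<in> parcs U" by (rule arcs_symmetric)
  then have "mr_minus U \<noteq> n" using mr_minus_imp_adjacent x by blast
  moreover have "\<not> structure_ok"
    using removals_ok_adjacent[OF _ x(1)] x(2) unfolding structure_ok_def by meson
  ultimately show ?thesis by blast
qed

end

text \<open>No vertex is off the path, so the conditions of \<open>mr_minusI\<close> are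
  vacuous.\<close>

lemma mr_minus_path_graph:
  assumes "distinct (map v [1..<n + 1])" and "even n"
  shows "mr_minus (path_graph (map v [1..<n + 1])) = n"
proof -
  let ?P = "map v [1..<n + 1]"
  have nth: "v i = ?P ! (i - 1) \<and> i - 1 < length ?P" if "i \<in> {1..n}" for i
    using that by (auto simp del: upt_Suc)
  interpret G: pair_graph "path_graph ?P" using assms(1) by (rule pair_graph_path_graph)
  have set: "set ?P = v ` {1..n}" by (auto simp: less_Suc_eq_le)
  interpret G: even_path "path_graph ?P" v n
  proof unfold_locales
    show "even n" by fact
    have "{1..<n + 1} = {1..n}" by auto
    then show "inj_on v {1..n}" using assms(1) unfolding distinct_map by (simp del: upt_Suc)
    show "v i \<in> pverts (path_graph ?P)" if "i \<in> {1..n}" for i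
      using that set unfolding path_graph_verts by blast
    show "(v i, v j) \<in> parcs (path_graph ?P) \<longleftrightarrow> j = i + 1 \<or> i = j + 1"
      if "i \<in> {1..n}" "j \<in> {1..n}" for i j
    proof -
      have "(v i, v j) \<in> parcs (path_graph ?P) \<longleftrightarrow> j - 1 = i - 1 + 1 \<or> i - 1 = j - 1 + 1"
        using path_graph_arc_iff[OF assms(1), of "i - 1" "j - 1"] nth[OF that(1)] nth[OF that(2)]
        by metis
      then show ?thesis using that by auto
    qed
  qed
  have "G.outer = {}" unfolding G.outer_def path_graph_verts set by blast
  then show ?thesis by (intro G.mr_minusI) auto
qed

theorem theorem5p13:
  fixes U C :: "'a pair_pre_digraph" and v :: "nat \<Rightarrow> 'a" and P :: "'a list" and n k :: nat
  assumes "pair_graph U" and "Digraph_Component.connected U" and "unicyclic U"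
    and "is_cycle k C" and "subgraph C U"
    and "P = map v [1..<n + 1]" and "diametrical_path U P"
    and "even n" and "n \<ge> 6"
  shows "mr_minus U = mr_minus (path_graph P) \<longleftrightarrow>
    \<comment> \<open>(1)\<close>
    (\<forall>w \<in> pverts C - set P.
       (let T = pre_digraph.del_vert U w in
         (centipede T P \<and> diametrical_path T P \<and>
          \<not> (\<exists>r s. v r \<in> joints T P \<and> v s \<in> joints T P \<and>
                 odd r \<and> even s \<and> 3 \<le> r \<and> r < s \<and> s \<le> n - 2))
         \<or>
         (\<exists>P' z. z \<in> pverts C - set P \<and> z \<noteq> w \<and>
            ((z, v 1) \<in> parcs U \<or> (z, v n) \<in> parcs U) \<and>
            set P' = set P \<union> {z} \<and> centipede T P' \<and> diametrical_path T P' \<and>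
            ((z, v 1) \<in> parcs U \<longrightarrow> joints T P' \<subseteq> {v i | i. 1 \<le> i \<and> i \<le> n \<and> odd i}) \<and>
            ((z, v n) \<in> parcs U \<longrightarrow> joints T P' \<subseteq> {v i | i. 1 \<le> i \<and> i \<le> n \<and> even i}))))
    \<and> \<comment> \<open>(2)\<close>
    k \<in> {3, 4, 6}
    \<and> \<comment> \<open>(3)\<close>
    (k = 3 \<longrightarrow>
      (\<exists>j. 1 \<le> j \<and> j \<le> n - 1 \<and> pverts C \<inter> set P = {v j, v (j + 1)} \<and>
         (j = 1 \<longrightarrow> deg U (v 1) = 2 \<and> deg U (v 2) = 3) \<and>
         (j = n - 1 \<longrightarrow> deg U (v n) = 2 \<and> deg U (v (n - 1)) = 3) \<and>
         (odd j \<and> 3 \<le> j \<and> j \<le> n - 3 \<longrightarrow> deg U (v j) = 3 \<and> deg U (v (j + 1)) = 3) \<and>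
         (\<forall>i. odd i \<and> 1 < i \<and> i < j \<longrightarrow> deg U (v i) = 2) \<and>
         (\<forall>i. even i \<and> j + 1 < i \<and> i < n \<longrightarrow> deg U (v i) = 2)))
    \<and> \<comment> \<open>(4)\<close>
    (\<forall>j. k = 4 \<and> {j, j + 1, j + 2} \<subseteq> {1..n} \<and>
         pverts C \<inter> set P = {v j, v (j + 1), v (j + 2)} \<longrightarrow>
       (1 \<le> j \<and> j \<le> n - 2) \<and>
       deg U (v (j + 1)) = 2 \<and>
       (j = 1 \<longrightarrow> deg U (v 1) = 2) \<and>
       (j = n - 2 \<longrightarrow> deg U (v n) = 2) \<and>
       (j = 1 \<and> deg U (v 3) > 3 \<longrightarrow>
          (\<forall>i. even i \<and> 3 < i \<and> i < n \<longrightarrow> deg U (v i) = 2)) \<and>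
       (j = n - 2 \<and> deg U (v (n - 2)) > 3 \<longrightarrow>
          (\<forall>i. odd i \<and> 1 < i \<and> i < n - 2 \<longrightarrow> deg U (v i) = 2)) \<and>
       (odd j \<and> 3 \<le> j \<and> j \<le> n - 3 \<and> (deg U (v j) > 3 \<or> deg U (v (j + 2)) > 3) \<longrightarrow>
          (\<forall>i. even i \<and> j + 2 < i \<and> i < n \<longrightarrow> deg U (v i) = 2)) \<and>
       (even j \<and> 2 \<le> j \<and> j \<le> n - 4 \<and> (deg U (v j) > 3 \<or> deg U (v (j + 2)) > 3) \<longrightarrow>
          (\<forall>i. odd i \<and> 1 < i \<and> i < j \<longrightarrow> deg U (v i) = 2)) \<and>
       (\<forall>r. odd r \<and> r \<noteq> j \<and> r \<noteq> j + 2 \<and> 3 \<le> r \<and> r \<le> n - 3 \<and> deg U (v r) > 2 \<longrightarrow>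
          (\<forall>i. even i \<and> r < i \<and> i < n \<and> i \<noteq> j \<and> i \<noteq> j + 2 \<longrightarrow> deg U (v i) = 2)) \<and>
       (\<forall>r. even r \<and> r \<noteq> j \<and> r \<noteq> j + 2 \<and> 4 \<le> r \<and> r \<le> n - 2 \<and> deg U (v r) > 2 \<longrightarrow>
          (\<forall>i. odd i \<and> 1 < i \<and> i < r \<and> i \<noteq> j \<and> i \<noteq> j + 2 \<longrightarrow> deg U (v i) = 2)))
    \<and> \<comment> \<open>(5)\<close>
    (\<forall>j. k = 4 \<and> {j, j + 1} \<subseteq> {1..n} \<and> pverts C \<inter> set P = {v j, v (j + 1)} \<longrightarrow>
       odd j \<and> 3 \<le> j \<and> j \<le> n - 3 \<and>
       deg U (v j) = 3 \<and> deg U (v (j + 1)) = 3 \<and>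
       (\<forall>i. odd i \<and> 1 < i \<and> i < j \<longrightarrow> deg U (v i) = 2) \<and>
       (\<forall>i. even i \<and> j + 1 < i \<and> i < n \<longrightarrow> deg U (v i) = 2))
    \<and> \<comment> \<open>(6), where \<open>v (j + 3)\<close>, whose degree is prescribed separately, is exempt from the last clause\<close>
    (k = 6 \<longrightarrow>
      (\<exists>j. pverts C \<inter> set P = {v j, v (j + 1), v (j + 2), v (j + 3)} \<and>
         odd j \<and> 1 \<le> j \<and> j \<le> n - 3 \<and>
         deg U (v (j + 1)) = 2 \<and> deg U (v (j + 2)) = 2 \<and>
         (j = 1 \<longrightarrow> deg U (v 1) = 2 \<and> deg U (v 4) = 3) \<and>
         (j = n - 3 \<longrightarrow> deg U (v n) = 2 \<and> deg U (v (n - 3)) = 3) \<and>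
         (odd j \<and> 3 \<le> j \<and> j \<le> n - 5 \<longrightarrow> deg U (v j) = 3 \<and> deg U (v (j + 3)) = 3) \<and>
         (\<forall>i. odd i \<and> 1 < i \<and> i < j \<longrightarrow> deg U (v i) = 2) \<and>
         (\<forall>i. even i \<and> j + 1 < i \<and> i < n \<and> i \<noteq> j + 3 \<longrightarrow> deg U (v i) = 2)))"
proof -
  interpret pair_graph U by fact
  have P_ne: "P \<noteq> []" and dP: "distinct P" and ind: "induced_subgraph (path_graph P) U"
    and len: "ereal (real (vwalk_length P)) = diameter U"
    and dist: "gdist U (hd P) (last P) = diameter U"
    using assms(7) by (auto simp: diametrical_path_def)
  have lenP: "length P = n" using assms(6) by simp
  have nth: "v i = P ! (i - 1) \<and> i - 1 < length P" if "i \<in> {1..n}" for i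
    using that assms(6) by (auto simp del: upt_Suc)
  have set: "set P = v ` {1..n}" using assms(6) by (auto simp: less_Suc_eq_le)
  have diam_eq: "diameter U = ereal (real (n - 1))" using len lenP by simp
  have ends: "hd P = v 1" "last P = v n"
    using P_ne lenP nth[of 1] nth[of n] assms(9) by (auto simp: hd_conv_nth last_conv_nth)
  have arcs: "P ! i \<in> pverts U" "j < n \<Longrightarrow> (P ! i, P ! j) \<in> parcs U \<longleftrightarrow> j = i + 1 \<or> i = j + 1"
    if "i < n" for i j
    using ind that lenP unfolding induced_path_graph_iff[OF assms(1) dP] by auto
  \<comment> \<open>\<open>diametrical_path\<close> yields both metric assumptions: its length
    \<open>n - 1\<close> is the diameter, and its ends are at that distance.\<close>
  interpret U: unicyclic_path U v n C k
  proof unfold_locales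
    show "even n" "6 \<le> n" "is_cycle k C" "subgraph C U" by fact+
    have "{1..<n + 1} = {1..n}" by auto
    then show "inj_on v {1..n}" using dP unfolding assms(6) distinct_map by (simp del: upt_Suc)
    show "v i \<in> pverts U" if "i \<in> {1..n}" for i using nth[OF that] arcs(1) lenP by metis
    show "(v i, v j) \<in> parcs U \<longleftrightarrow> j = i + 1 \<or> i = j + 1" if "i \<in> {1..n}" "j \<in> {1..n}" for i j
    proof -
      have "(v i, v j) \<in> parcs U \<longleftrightarrow> j - 1 = i - 1 + 1 \<or> i - 1 = j - 1 + 1"
        using arcs(2)[of "i - 1" "j - 1"] nth[OF that(1)] nth[OF that(2)] lenP by metis
      then show ?thesis using that by auto
    qed
    show "D = C" if "is_cycle m D" "subgraph D U" for m D
      using assms(3,4,5) that unfolding unicyclic_def by blast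
    show "\<exists>m\<le>n - 1. (x, y) \<in> parcs U ^^ m" if "x \<in> pverts U" "y \<in> pverts U" for x y
      using diameter_le_iff[of "n - 1"] diam_eq that by simp
    show "n - 1 \<le> m" if m: "(v 1, v n) \<in> parcs U ^^ m" for m
    proof -
      have "v 1 \<in> pverts U" using nth[of 1] arcs(1)[of 0] assms(9) by simp
      then have "gdist U (v 1) (v n) \<le> ereal (real m)" using m by (rule gdist_le)
      then show ?thesis using dist diam_eq unfolding ends by simp
    qed
  qed
  have P: "U.P = P" using assms(6) by (simp add: U.P_def)
  have "mr_minus (path_graph P) = n"
    using mr_minus_path_graph[of v n] dP assms(6,8) by simp
  then show ?thesis
    using U.mr_minus_equiv
    unfolding U.structure_ok_def U.removal_ok_def cond3_def cond4_def cond5_def cond6_def P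
    by simp
qed

end
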